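(* Let $\Omega \subset \mathbb{R}^n$ be a bounded open set with finite perimeter and let $\Omega^\sharp$ be the ball centered at the origin with $|\Omega^\sharp| = |\Omega|$. If $\Lambda > 0$, then $$T_{\mathcal{F}}(\Omega,\Lambda) \le T_{\mathcal{F}}(\Omega^\sharp,\Lambda).$$
   Context: $|E|$ denotes the $n$-dimensional Lebesgue measure of $E$. A set $E\subset\mathbb{R}^n$ has finite perimeter if $\chi_E\in\mathrm{BV}(\mathbb{R}^n)$. For a bounded open set $\Omega\subset\mathbb{R}^n$ and $\Lambda>0$, define $$\mathcal{F}_\Lambda(\psi) := \frac12\int_\Omega |\nabla\psi|^2\,dx - \int_\Omega \psi\,dx + \Lambda\,\bigl|\{x\in\Omega : |\nabla\psi(x)|\neq 0\}\bigr|, \qquad \psi\in H^1_0(\Omega),$$ and $$T_{\mathcal{F}}(\Omega,\Lambda) := -\inf_{\psi\in H_0^1(\Omega)} \mathcal{F}_\Lambda(\psi).$$ *)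

theory Defs
  imports "HOL-Analysis.Analysis"
begin

definition partial :: "'a::euclidean_space \<Rightarrow> ('a \<Rightarrow> real) \<Rightarrow> 'a \<Rightarrow> real" where
  "partial b f x = frechet_derivative f (at x) b"

text \<open>Total differentiability is demanded at each stage because \<^const>\<open>frechet_derivative\<close> is
  unspecified where it fails; with continuity of the iterated partials this is the usual class of
  \<open>k\<close> times continuously differentiable functions on the whole space.\<close>

primrec Ck :: "nat \<Rightarrow> ('a::euclidean_space \<Rightarrow> real) \<Rightarrow> bool" where
  "Ck 0 f \<longleftrightarrow> continuous_on UNIV f"
| "Ck (Suc k) f \<longleftrightarrow> (\<forall>x. f differentiable (at x)) \<and> (\<forall>b\<in>Basis. Ck k (partial b f))"

definition smooth :: "('a::euclidean_space \<Rightarrow> real) \<Rightarrow> bool" where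
  "smooth f \<longleftrightarrow> (\<forall>k. Ck k f)"

definition compactly_supported_in :: "('a::euclidean_space \<Rightarrow> 'b::zero) \<Rightarrow> 'a set \<Rightarrow> bool" where
  "compactly_supported_in f \<Omega> \<longleftrightarrow>
     compact (closure {x. f x \<noteq> 0}) \<and> closure {x. f x \<noteq> 0} \<subseteq> \<Omega>"

text \<open>Test functions, extended by zero to the whole space.\<close>

definition test_functions :: "'a::euclidean_space set \<Rightarrow> ('a \<Rightarrow> real) set" where
  "test_functions \<Omega> = {\<phi>. smooth \<phi> \<and> compactly_supported_in \<phi> \<Omega>}"

text \<open>Elements of the function spaces below are functions on the whole space, of which only the
  values almost everywhere on \<open>\<Omega>\<close> matter; no quotient by almost-everywhere equality is taken.\<close>

definition L2 :: "'a::euclidean_space set \<Rightarrow> ('a \<Rightarrow> 'b::euclidean_space) set" where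
  "L2 \<Omega> = {f \<in> borel_measurable (lebesgue_on \<Omega>). integrable (lebesgue_on \<Omega>) (\<lambda>x. (norm (f x))\<^sup>2)}"

definition has_weak_gradient ::
    "'a::euclidean_space set \<Rightarrow> ('a \<Rightarrow> real) \<Rightarrow> ('a \<Rightarrow> 'a) \<Rightarrow> bool" where
  "has_weak_gradient \<Omega> u g \<longleftrightarrow>
     u \<in> L2 \<Omega> \<and> g \<in> L2 \<Omega> \<and>
     (\<forall>\<phi>\<in>test_functions \<Omega>. \<forall>b\<in>Basis.
        (LINT x|lebesgue_on \<Omega>. u x * partial b \<phi> x) = - (LINT x|lebesgue_on \<Omega>. (g x \<bullet> b) * \<phi> x))"

definition H1 :: "'a::euclidean_space set \<Rightarrow> ('a \<Rightarrow> real) set" where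
  "H1 \<Omega> = {u. \<exists>g. has_weak_gradient \<Omega> u g}"

text \<open>For open \<open>\<Omega>\<close> the weak gradient is unique almost everywhere, so the choice is immaterial.\<close>

definition weak_gradient :: "'a::euclidean_space set \<Rightarrow> ('a \<Rightarrow> real) \<Rightarrow> 'a \<Rightarrow> 'a" where
  "weak_gradient \<Omega> u = (SOME g. has_weak_gradient \<Omega> u g)"

definition H1_norm :: "'a::euclidean_space set \<Rightarrow> ('a \<Rightarrow> real) \<Rightarrow> real" where
  "H1_norm \<Omega> u = sqrt ((LINT x|lebesgue_on \<Omega>. (u x)\<^sup>2)
                     + (LINT x|lebesgue_on \<Omega>. (norm (weak_gradient \<Omega> u x))\<^sup>2))"

definition H10 :: "'a::euclidean_space set \<Rightarrow> ('a \<Rightarrow> real) set" where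
  "H10 \<Omega> = {u \<in> H1 \<Omega>. \<exists>\<phi>. (\<forall>k::nat. \<phi> k \<in> test_functions \<Omega>) \<and>
                       (\<lambda>k. H1_norm \<Omega> (\<lambda>x. \<phi> k x - u x)) \<longlonglongrightarrow> 0}"

definition divergence :: "('a::euclidean_space \<Rightarrow> 'a) \<Rightarrow> 'a \<Rightarrow> real" where
  "divergence X x = (\<Sum>b\<in>Basis. partial b (\<lambda>y. X y \<bullet> b) x)"

text \<open>Functions of bounded variation on the whole space: the total variation is the supremum of the
  distributional pairing with continuously differentiable, compactly supported vector fields of
  length at most one.\<close>

definition BV :: "('a::euclidean_space \<Rightarrow> real) set" where
  "BV = {u. integrable lebesgue u \<and>
            bdd_above {LINT x|lebesgue. u x * divergence X x | X.
              (\<forall>b\<in>Basis. Ck 1 (\<lambda>x. X x \<bullet> b)) \<and> compactly_supported_in X UNIV \<and>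
              (\<forall>x. norm (X x) \<le> 1)}}"

definition finite_perimeter :: "'a::euclidean_space set \<Rightarrow> bool" where
  "finite_perimeter E \<longleftrightarrow> (indicator E :: 'a \<Rightarrow> real) \<in> BV"

definition F_functional :: "'a::euclidean_space set \<Rightarrow> real \<Rightarrow> ('a \<Rightarrow> real) \<Rightarrow> real" where
  "F_functional \<Omega> \<Lambda> \<psi> =
     1/2 * (LINT x|lebesgue_on \<Omega>. (norm (weak_gradient \<Omega> \<psi> x))\<^sup>2)
     - (LINT x|lebesgue_on \<Omega>. \<psi> x)
     + \<Lambda> * measure lebesgue {x\<in>\<Omega>. weak_gradient \<Omega> \<psi> x \<noteq> 0}"

text \<open>The infimum is taken in the extended reals, where it is meaningful without first knowing that
  the functional is bounded below.\<close>

definition T_F :: "'a::euclidean_space set \<Rightarrow> real \<Rightarrow> ereal" where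
  "T_F \<Omega> \<Lambda> = - (INF \<psi>\<in>H10 \<Omega>. ereal (F_functional \<Omega> \<Lambda> \<psi>))"

end

theory Submission
  imports Defs
begin

text \<open>Let \<open>n\<close> be the dimension, \<open>\<kappa> = sqrt (2 \<Lambda>)\<close>, let \<open>E\<close> be the convex envelope of
  \<open>p \<mapsto> p\<^sup>2/2 + \<Lambda> [p \<noteq> 0]\<close> and \<open>E\<^sup>*(q) = max 0 ((q\<^sup>2 - \<kappa>\<^sup>2)/2)\<close> its Legendre transform. Both torsions
  are compared with \<open>T = \<integral> E\<^sup>*(|y|/n) dy\<close> over the ball.

  If \<open>S\<close> is a volume preserving Knothe map from \<open>\<Omega>\<close> to the ball, its derivative is triangular with
  positive diagonal and determinant one, so \<open>div S \<ge> n\<close>, and for a test function \<open>\<phi> \<ge> 0\<close>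
  \<open>n \<integral> \<phi> \<le> - \<integral> \<nabla>\<phi> \<bullet> S \<le> n \<integral> E(|\<nabla>\<phi>|) + n T\<close>, because \<open>|S|\<close> is distributed like \<open>|y|\<close> on the
  ball. Neither the coarea formula nor the isoperimetric inequality is needed. The map is not constructed either:
  only the dual statement is proved, that \<open>- \<nabla>\<phi>(u) \<bullet> v \<le> c(u) + d(v)\<close> implies
  \<open>n \<integral> \<phi> \<le> \<integral> c + \<integral> d\<close> (over \<open>\<Omega>\<close> and the ball), by induction on the number of integrated coordinates, each
  step using a monotone transport on the line. Since \<open>E\<close> is continuous, the estimate passes to
  \<open>H\<^sup>1\<close> limits although the measure of \<open>{\<nabla>\<psi> \<noteq> 0}\<close> does not.

  On the ball, the value \<open>- T\<close> is approached by radial test functions with \<open>\<nabla>v\<close> close to \<open>- x/n\<close>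
  where \<open>|x| > n \<kappa>\<close> and \<open>\<nabla>v = 0\<close> elsewhere.\<close>

section \<open>Smooth functions\<close>

text \<open>The Knothe map is assembled from conditional distribution functions, and its regularity
  is poor where the slices of \<Omega> are irregular. In the dual form only integrated quantities
  are carried along, and each step needs no more than continuous densities on the line. The
  logarithm in the transport inequalities stands for the Jacobian determinant: summing t' \<ge> 1 +
  ln t' over the coordinates says that the trace of the triangular derivative is at least n plus the
  logarithm of its determinant, which is a quotient of densities and becomes harmless when the
  volumes agree. Only the target must be convex: its slices are then intervals, so that inverse
  distribution functions are continuous.

  The argument |y|/n arises from p |y| = n p (|y|/n), where n is the lower bound of the divergence.
  The comparison is sharp on the ball because the identity is a transport there and Fenchel equality
  can be reached: the Legendre transform has slope 0 below \<kappa> and slope q above it. Optimal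
  gradients thus avoid the range 0 < |p| < \<kappa>, the only one where the envelope lies strictly
  below the original integrand.\<close>

lemma Ck_continuous: "Ck k f \<Longrightarrow> continuous_on UNIV f"
  by (cases k) (auto intro!: differentiable_imp_continuous_on simp: differentiable_on_def)

text \<open>Any explicit derivative may replace \<open>frechet_derivative\<close>, so closure
  properties of \<open>Ck\<close> follow from the derivative rules by induction on the
  order.\<close>

lemma Ck_SucI:
  assumes "\<And>x. (f has_derivative f' x) (at x)" "\<And>b. b \<in> Basis \<Longrightarrow> Ck k (\<lambda>x. f' x b)"
  shows "Ck (Suc k) f"
proof -
  have "partial b f = (\<lambda>x. f' x b)" for b
    using frechet_derivative_at[OF assms(1)] by (auto simp: partial_def fun_eq_iff)
  then show ?thesis using assms by (auto simp: differentiable_def)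
qed

lemma Ck_Suc_has_derivative:
  "Ck (Suc k) f \<Longrightarrow> (f has_derivative frechet_derivative f (at x)) (at x)"
  by (simp add: frechet_derivative_works)

lemma Ck_Suc_frechet:
  "Ck (Suc k) f \<Longrightarrow> b \<in> Basis \<Longrightarrow> Ck k (\<lambda>x. frechet_derivative f (at x) b)"
  by (auto simp: partial_def[abs_def])

lemma Ck_SucD: "Ck (Suc k) f \<Longrightarrow> Ck k f"
proof (induction k arbitrary: f)
  case 0
  then show ?case using Ck_continuous[of "Suc 0" f] by simp
next
  case (Suc k)
  have "Ck k (partial b f)" if "b \<in> Basis" for b
    using Suc.prems that by (intro Suc.IH) simp
  then show ?case using Suc.prems by simp
qed

lemma Ck_const: "Ck k (\<lambda>x. c)"
proof (induction k arbitrary: c)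
  case (Suc k)
  show ?case by (rule Ck_SucI[OF has_derivative_const]) (rule Suc)
qed simp

lemma Ck_add: "Ck k f \<Longrightarrow> Ck k g \<Longrightarrow> Ck k (\<lambda>x. f x + g x)"
proof (induction k arbitrary: f g)
  case (Suc k)
  show ?case
    by (rule Ck_SucI[OF has_derivative_add[OF Suc.prems[THEN Ck_Suc_has_derivative]]])
       (rule Suc.IH; rule Suc.prems[THEN Ck_Suc_frechet])
qed (auto intro!: continuous_intros)

lemma Ck_mult: "Ck k f \<Longrightarrow> Ck k g \<Longrightarrow> Ck k (\<lambda>x. f x * g x)"
proof (induction k arbitrary: f g)
  case (Suc k)
  show ?case
    by (rule Ck_SucI[OF has_derivative_mult[OF Suc.prems[THEN Ck_Suc_has_derivative]]])
       (intro Ck_add Suc.IH Suc.prems[THEN Ck_SucD] Suc.prems[THEN Ck_Suc_frechet])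
qed (auto intro!: continuous_intros)

lemma Ck_cmult: "Ck k f \<Longrightarrow> Ck k (\<lambda>x. c * f x)"
  by (intro Ck_mult Ck_const)

lemma Ck_diff: "Ck k f \<Longrightarrow> Ck k g \<Longrightarrow> Ck k (\<lambda>x. f x - g x)"
  using Ck_add[OF _ Ck_cmult[of k g "-1"], of f] by simp

lemma Ck_sum: "(\<And>i. i \<in> A \<Longrightarrow> Ck k (f i)) \<Longrightarrow> Ck k (\<lambda>x. \<Sum>i\<in>A. f i x)"
  by (induction A rule: infinite_finite_induct) (auto intro!: Ck_add Ck_const)

lemma Ck_prod: "(\<And>i. i \<in> A \<Longrightarrow> Ck k (f i)) \<Longrightarrow> Ck k (\<lambda>x. \<Prod>i\<in>A. f i x)"
  by (induction A rule: infinite_finite_induct) (auto intro!: Ck_mult Ck_const)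

lemma Ck_inner: "Ck k (\<lambda>x. x \<bullet> c)"
proof (cases k)
  case (Suc j)
  have "((\<lambda>x. x \<bullet> c) has_derivative (\<lambda>h. h \<bullet> c)) (at x)" for x
    by (auto intro!: derivative_eq_intros)
  then show ?thesis unfolding Suc by (rule Ck_SucI) (rule Ck_const)
qed (auto intro!: continuous_intros)

lemma Ck_norm_power2: "Ck k (\<lambda>x::'a::euclidean_space. (norm x)\<^sup>2)"
proof -
  have *: "(\<lambda>x::'a. (norm x)\<^sup>2) = (\<lambda>x. \<Sum>b\<in>Basis. (x \<bullet> b) * (x \<bullet> b))"
    by (rule ext, subst power2_norm_eq_inner, subst euclidean_inner) simp
  show ?thesis unfolding * by (intro Ck_sum Ck_mult Ck_inner)
qed

section \<open>Smooth cutoffs on the line\<close>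

text \<open>The powers of 1/t make the family closed under differentiation up to linear
  combinations. Smoothness of the classical member k = 0 is then proved for all members at
  once.\<close>

definition flat_exp :: "nat \<Rightarrow> real \<Rightarrow> real" where
  "flat_exp k t = (if t \<le> 0 then 0 else (1 / t) ^ k * exp (- (1 / t)))"

lemma flat_exp_tendsto_0: "(flat_exp k \<longlongrightarrow> 0) (at 0)"
proof -
  have "((\<lambda>x::real. x ^ k / exp x) \<longlongrightarrow> 0) at_top"
    by (rule tendsto_power_div_exp_0)
  then have "((\<lambda>t::real. (inverse t) ^ k / exp (inverse t)) \<longlongrightarrow> 0) (at_right 0)"
    by (rule filterlim_compose[OF _ filterlim_inverse_at_top_right])
  moreover have "\<forall>\<^sub>F t in at_right 0. (inverse t) ^ k / exp (inverse t) = flat_exp k t"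
    by (auto simp: flat_exp_def eventually_at_filter exp_minus field_simps)
  ultimately have "(flat_exp k \<longlongrightarrow> 0) (at_right 0)"
    by (rule Lim_transform_eventually)
  moreover have "(flat_exp k \<longlongrightarrow> 0) (at_left 0)"
    by (rule tendsto_eventually) (auto simp: flat_exp_def eventually_at_filter)
  ultimately show ?thesis by (simp add: filterlim_at_split)
qed

lemma flat_exp_deriv:
  "(flat_exp k has_real_derivative flat_exp (k+2) t - real k * flat_exp (k+1) t) (at t)"
proof -
  consider "t > 0" | "t < 0" | "t = 0" by linarith
  then show ?thesis
  proof cases
    case 1
    have "((\<lambda>t. (1 / t) ^ k * exp (- (1 / t))) has_real_derivative
        (1/t)^(k+2) * exp (-(1/t)) - real k * ((1/t)^(k+1) * exp (-(1/t)))) (at t)"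
    proof -
      have inv: "((\<lambda>t::real. 1 / t) has_real_derivative - ((1 / t)\<^sup>2)) (at t)"
        using 1 by (auto intro!: derivative_eq_intros simp: power2_eq_square)
      have "((\<lambda>u::real. u ^ k * exp (- u)) has_real_derivative
          real k * u ^ (k - 1) * exp (- u) - u ^ k * exp (- u)) (at u)" for u
        by (auto intro!: derivative_eq_intros)
      note d = DERIV_chain2[OF this inv]
      have "(real k * u ^ (k - 1) * e - u ^ k * e) * - (u\<^sup>2)
          = u ^ (k + 2) * e - real k * (u ^ (k + 1) * e)" for u e :: real
        by (cases k) (simp_all add: algebra_simps power2_eq_square)
      then show ?thesis by (rule DERIV_cong[OF d])
    qed
    moreover have "\<forall>\<^sub>F s in nhds t. (1 / s) ^ k * exp (- (1 / s)) = flat_exp k s"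
      using eventually_nhds_in_open[of "{0<..}" t] 1
      by (auto elim!: eventually_mono simp: flat_exp_def)
    ultimately show ?thesis
      using 1 by (subst (asm) DERIV_cong_ev[OF refl _ refl]) (auto simp: flat_exp_def)
  next
    case 2
    have "\<forall>\<^sub>F s in nhds t. 0 = flat_exp k s"
      using eventually_nhds_in_open[of "{..<0}" t] 2
      by (auto elim!: eventually_mono simp: flat_exp_def)
    then show ?thesis
      using 2 DERIV_cong_ev[OF refl _ refl, of "\<lambda>_. 0" "flat_exp k" t 0] by (auto simp: flat_exp_def)
  next
    case 3
    \<comment> \<open>Dividing by h raises the index, so the difference quotient at 0 is
      \<open>flat_exp (Suc k)\<close> itself.\<close>
    have "((\<lambda>h. (flat_exp k (0 + h) - flat_exp k 0) / h) \<longlongrightarrow> 0) (at 0)"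
      by (rule Lim_transform_eventually[OF flat_exp_tendsto_0[of "Suc k"]])
         (auto simp: eventually_at_filter flat_exp_def)
    then show ?thesis unfolding 3 DERIV_def by (simp add: flat_exp_def)
  qed
qed

lemma flat_exp_compose_deriv:
  assumes "(u has_derivative u') (at x)"
  shows "((\<lambda>x. flat_exp k (u x)) has_derivative
           (\<lambda>h. (flat_exp (k+2) (u x) - real k * flat_exp (k+1) (u x)) * u' h)) (at x)"
  using has_derivative_compose[OF assms flat_exp_deriv[of k "u x", unfolded has_field_derivative_def]]
  by simp

lemma Ck_flat_exp: "Ck j u \<Longrightarrow> Ck j (\<lambda>x. flat_exp k (u x))"
proof (induction j arbitrary: k u)
  case 0
  have "continuous_on UNIV (flat_exp k)"
    using flat_exp_deriv by (auto intro!: DERIV_isCont continuous_at_imp_continuous_on)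
  then show ?case using 0 by (auto intro: continuous_on_compose2[of UNIV "flat_exp k"])
next
  case (Suc j)
  show ?case
    by (rule Ck_SucI[OF flat_exp_compose_deriv[OF Ck_Suc_has_derivative[OF Suc.prems]]])
       (intro Ck_mult Ck_diff Ck_cmult Suc.IH Ck_SucD[OF Suc.prems] Ck_Suc_frechet[OF Suc.prems])
qed

lemma flat_exp_nonneg: "0 \<le> flat_exp k t"
  by (simp add: flat_exp_def)

lemma flat_exp_0_le_1: "flat_exp 0 t \<le> 1"
  by (simp add: flat_exp_def)

text \<open>The shift c is 0 for cutoffs that may reach the boundary of their set, and 1 for the
  radial cutoff on the ball, which has to vanish already at a distance from the sphere.\<close>

lemma flat_exp_0_scaled_tendsto:
  assumes "0 \<le> c"
  shows "(\<lambda>k. flat_exp 0 (real (Suc k) * t - c)) \<longlonglongrightarrow> (if t \<le> 0 then 0 else 1)"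
proof (cases "t \<le> 0")
  case True
  have "real (Suc k) * t - c \<le> 0" for k
    using mult_nonneg_nonpos[of "real (Suc k)" t] True assms by linarith
  then have "(\<lambda>k. flat_exp 0 (real (Suc k) * t - c)) = (\<lambda>k. 0)"
    by (simp add: flat_exp_def)
  then show ?thesis using True by (simp only: tendsto_const if_True)
next
  case False
  have "((\<lambda>s::real. exp (- (inverse s))) \<longlongrightarrow> exp (- 0)) at_top"
    by (intro tendsto_intros tendsto_inverse_0_at_top filterlim_ident)
  moreover have "\<forall>\<^sub>F s in at_top. exp (- (inverse s)) = flat_exp 0 s"
    using eventually_gt_at_top[of 0] by eventually_elim (simp add: flat_exp_def divide_simps)
  ultimately have "(flat_exp 0 \<longlongrightarrow> exp (- 0)) at_top" by (rule Lim_transform_eventually)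
  moreover have "filterlim (\<lambda>k. - c + t * real (Suc k)) at_top sequentially"
    using False
    by (intro filterlim_tendsto_add_at_top[OF tendsto_const] filterlim_tendsto_pos_mult_at_top[OF tendsto_const]
        filterlim_compose[OF filterlim_real_sequentially filterlim_Suc]) auto
  ultimately have "(\<lambda>k. flat_exp 0 (- c + t * real (Suc k))) \<longlonglongrightarrow> exp (- 0)"
    by (rule filterlim_compose)
  moreover have "- c + t * real (Suc k) = real (Suc k) * t - c" for k by (simp add: mult.commute)
  ultimately show ?thesis using False by (simp only: if_False exp_zero minus_zero)
qed

section \<open>Monotone transport on the line\<close>

lemma continuous_antiderivative:
  fixes X :: "real \<Rightarrow> real"
  assumes "continuous_on UNIV X"
  obtains Y where "\<And>s. l \<le> s \<Longrightarrow> (Y has_real_derivative X s) (at s)"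
    "\<And>s. l \<le> s \<Longrightarrow> integral {l..s} X = Y s" "Y l = 0"
proof -
  \<comment> \<open>Integrating from l - 1 makes l an interior point, so the derivative at l is
    two-sided.\<close>
  define Y where "Y s = integral {l-1..s} X - integral {l-1..l} X" for s
  have int: "X integrable_on {u..v}" for u v
    by (intro integrable_continuous_real continuous_on_subset[OF assms]) auto
  have "(Y has_real_derivative X s) (at s)" if "l \<le> s" for s
  proof -
    have "((\<lambda>s. integral {l-1..s} X) has_real_derivative X s) (at s within {l-1..s+1})"
      using that by (intro integral_has_real_derivative continuous_on_subset[OF assms]) auto
    moreover have "at s within {l-1..s+1} = at s"
      using that by (intro at_within_interior) auto
    ultimately show ?thesis
      unfolding Y_def by (auto intro!: derivative_eq_intros)
  qed
  moreover have "integral {l..s} X = Y s" if "l \<le> s" for s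
    using Henstock_Kurzweil_Integration.integral_combine[of "l-1" l s X] that int by (simp add: Y_def)
  moreover have "Y l = 0" by (simp add: Y_def)
  ultimately show ?thesis by (rule that)
qed

text \<open>Both K Y - X and K Y + X are nondecreasing. If Y is a distribution function, X cannot
  move where there is no mass; with K = 0 the statement says that X is constant.\<close>

lemma increment_bound_of_deriv_le:
  fixes X Y :: "real \<Rightarrow> real"
  assumes "p \<le> q"
    and "\<And>s. p \<le> s \<Longrightarrow> s \<le> q \<Longrightarrow> (X has_real_derivative X' s) (at s)"
    and "\<And>s. p \<le> s \<Longrightarrow> s \<le> q \<Longrightarrow> (Y has_real_derivative Y' s) (at s)"
    and "\<And>s. p \<le> s \<Longrightarrow> s \<le> q \<Longrightarrow> \<bar>X' s\<bar> \<le> K * Y' s"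
  shows "\<bar>X q - X p\<bar> \<le> K * (Y q - Y p)"
proof -
  have "K * Y p - X p \<le> K * Y q - X q"
  proof (rule DERIV_nonneg_imp_nondecreasing[OF assms(1)])
    fix s assume s: "p \<le> s" "s \<le> q"
    have "((\<lambda>s. K * Y s - X s) has_real_derivative K * Y' s - X' s) (at s)"
      using assms(2,3)[OF s] by (auto intro!: derivative_eq_intros)
    then show "\<exists>y. ((\<lambda>s. K * Y s - X s) has_real_derivative y) (at s) \<and> 0 \<le> y"
      using assms(4)[OF s] by (intro exI[of _ "K * Y' s - X' s"]) auto
  qed
  moreover have "K * Y p + X p \<le> K * Y q + X q"
  proof (rule DERIV_nonneg_imp_nondecreasing[OF assms(1)])
    fix s assume s: "p \<le> s" "s \<le> q"
    have "((\<lambda>s. K * Y s + X s) has_real_derivative K * Y' s + X' s) (at s)"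
      using assms(2,3)[OF s] by (auto intro!: derivative_eq_intros)
    then show "\<exists>y. ((\<lambda>s. K * Y s + X s) has_real_derivative y) (at s) \<and> 0 \<le> y"
      using assms(4)[OF s] by (intro exI[of _ "K * Y' s + X' s"]) auto
  qed
  ultimately show ?thesis
    by (simp add: abs_le_iff algebra_simps)
qed

lemma convex_open_real_interval:
  fixes S :: "real set"
  assumes "convex S" "open S" "S \<noteq> {}" "S \<subseteq> {l<..<u}"
  obtains \<alpha> \<beta> where "l \<le> \<alpha>" "\<alpha> < \<beta>" "\<beta> \<le> u" "S = {\<alpha><..<\<beta>}"
proof -
  have bdd: "bdd_below S" "bdd_above S"
    using assms(4) by (force intro!: bdd_belowI[of _ l] bdd_aboveI[of _ u])+
  define \<alpha> \<beta> where "\<alpha> = Inf S" and "\<beta> = Sup S"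
  have lo: "\<alpha> < x" "x < \<beta>" if "x \<in> S" for x
  proof -
    obtain e where e: "e > 0" "ball x e \<subseteq> S" using assms(2) \<open>x \<in> S\<close> openE by blast
    have "x - e/2 \<in> S" "x + e/2 \<in> S" using e by (auto simp: dist_real_def intro!: subsetD[OF e(2)])
    then have "\<alpha> \<le> x - e/2" "x + e/2 \<le> \<beta>"
      unfolding \<alpha>_def \<beta>_def using bdd by (auto intro: cInf_lower cSup_upper)
    then show "\<alpha> < x" "x < \<beta>" using e(1) by auto
  qed
  have "x \<in> S" if x: "\<alpha> < x" "x < \<beta>" for x
  proof -
    obtain y where y: "y \<in> S" "y < x" using x(1) assms(3) bdd unfolding \<alpha>_def by (meson cInf_less_iff)
    obtain z where z: "z \<in> S" "x < z" using x(2) assms(3) bdd unfolding \<beta>_def by (meson less_cSup_iff)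
    show ?thesis
      using assms(1) y z by (meson less_imp_le is_interval_1 is_interval_convex_1)
  qed
  then have S: "S = {\<alpha><..<\<beta>}" using lo by auto
  have "l \<le> \<alpha>" "\<beta> \<le> u"
    unfolding \<alpha>_def \<beta>_def using assms(3,4) by (force intro!: cInf_greatest cSup_least)+
  moreover have "\<alpha> < \<beta>" using S assms(3) by auto
  ultimately show ?thesis using that S by blast
qed

text \<open>The monotone map \<open>t\<close> transporting \<open>F/a\<close> to \<open>G/b\<close> has \<open>t' = (b/a) F / (G \<circ> t)\<close>. Integrating
  \<open>slice\<close> along its graph, \<open>\<integral> t \<Phi>' = - \<integral> t' \<Phi>\<close> and \<open>t' \<ge> 1 + ln t'\<close> raise the constant \<open>m\<close> by one
  and turn \<open>ln (G/F)\<close> into \<open>ln (b/a)\<close>.\<close>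

lemma monotone_transport_inequality:
  fixes F G \<Phi> \<Phi>' C E :: "real \<Rightarrow> real" and M K m :: real
  assumes cont: "continuous_on UNIV F" "continuous_on UNIV G" "continuous_on UNIV \<Phi>'"
      "continuous_on UNIV C" "continuous_on UNIV E"
    and F0: "\<And>s. 0 \<le> F s" and G0: "\<And>t. 0 \<le> G t" and E0: "\<And>t. 0 \<le> E t"
    and \<Phi>0: "\<And>s. 0 \<le> \<Phi> s"
    and d\<Phi>: "\<And>s. (\<Phi> has_real_derivative \<Phi>' s) (at s)"
    and bdry: "\<Phi> (-M) = 0" "\<Phi> M = 0"
    and bound: "\<And>s. \<bar>C s\<bar> \<le> K * F s" "\<And>s. \<bar>\<Phi> s\<bar> \<le> K * F s" "\<And>s. \<bar>\<Phi>' s\<bar> \<le> K * F s"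
    and G_supp: "\<And>t. M \<le> \<bar>t\<bar> \<Longrightarrow> G t = 0" and G_convex: "convex {t. 0 < G t}"
    and pos: "0 < integral {-M..M} F" "0 < integral {-M..M} G"
    and slice: "\<And>s t. 0 < F s \<Longrightarrow> 0 < G t \<Longrightarrow>
        (m + ln (G t / F s)) * \<Phi> s / F s \<le> (C s + t * \<Phi>' s) / F s + E t / G t"
  defines "a \<equiv> integral {-M..M} F" and "b \<equiv> integral {-M..M} G"
  shows "(m + 1 + ln (b / a)) * integral {-M..M} \<Phi> / a
           \<le> integral {-M..M} C / a + integral {-M..M} E / b"
proof -
  have ab: "a > 0" "b > 0" using pos by (auto simp: a_def b_def)
  have M: "M > 0"
  proof (rule ccontr)
    assume "\<not> M > 0"
    then have "{-M..M} \<subseteq> {M}" by auto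
    then have "integral {-M..M} F = 0" by (auto simp: subset_singleton_iff)
    then show False using pos by simp
  qed
  have c\<Phi>: "continuous_on UNIV \<Phi>"
    using d\<Phi> by (auto intro!: DERIV_isCont continuous_at_imp_continuous_on)
  obtain iF where iF: "\<And>s. -M \<le> s \<Longrightarrow> (iF has_real_derivative F s) (at s)"
    "\<And>s. -M \<le> s \<Longrightarrow> integral {-M..s} F = iF s" "iF (-M) = 0"
    using continuous_antiderivative[OF cont(1)] by blast
  obtain iG where iG: "\<And>s. -M \<le> s \<Longrightarrow> (iG has_real_derivative G s) (at s)"
    "\<And>s. -M \<le> s \<Longrightarrow> integral {-M..s} G = iG s" "iG (-M) = 0"
    using continuous_antiderivative[OF cont(2)] by blast
  obtain iC where iC: "\<And>s. -M \<le> s \<Longrightarrow> (iC has_real_derivative C s) (at s)"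
    "\<And>s. -M \<le> s \<Longrightarrow> integral {-M..s} C = iC s" "iC (-M) = 0"
    using continuous_antiderivative[OF cont(4)] by blast
  obtain iE where iE: "\<And>s. -M \<le> s \<Longrightarrow> (iE has_real_derivative E s) (at s)"
    "\<And>s. -M \<le> s \<Longrightarrow> integral {-M..s} E = iE s" "iE (-M) = 0"
    using continuous_antiderivative[OF cont(5)] by blast
  obtain iP where iP: "\<And>s. -M \<le> s \<Longrightarrow> (iP has_real_derivative \<Phi> s) (at s)"
    "\<And>s. -M \<le> s \<Longrightarrow> integral {-M..s} \<Phi> = iP s" "iP (-M) = 0"
    using continuous_antiderivative[OF c\<Phi>] by blast
  have aF: "a = iF M" and bG: "b = iG M" using iF(2)[of M] iG(2)[of M] M by (auto simp: a_def b_def)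
  have mono: "I x \<le> I y"
    if "\<And>s. -M \<le> s \<Longrightarrow> (I has_real_derivative J s) (at s)" "\<And>s. 0 \<le> J s" "-M \<le> x" "x \<le> y"
    for I J :: "real \<Rightarrow> real" and x y
    by (rule DERIV_nonneg_imp_nondecreasing[OF \<open>x \<le> y\<close>]) (meson that order_trans)
  have contI: "continuous_on {x..y} I"
    if "\<And>s. -M \<le> s \<Longrightarrow> (I has_real_derivative J s) (at s)" "-M \<le> x"
    for I J :: "real \<Rightarrow> real" and x y
    by (rule continuous_at_imp_continuous_on) (meson that order_trans DERIV_isCont atLeastAtMost_iff)

  have mono_iF: "iF x \<le> iF y" and mono_iG: "iG x \<le> iG y" and mono_iE: "iE x \<le> iE y"
    if "-M \<le> x" "x \<le> y" for x y
    using mono[of iF F x y] mono[of iG G x y] mono[of iE E x y] iF(1) iG(1) iE(1) F0 G0 E0 that by blast+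
  have cont_iF: "continuous_on {x..y} iF" and cont_iG: "continuous_on {x..y} iG"
    and cont_iC: "continuous_on {x..y} iC" and cont_iE: "continuous_on {x..y} iE"
    and cont_iP: "continuous_on {x..y} iP"
    if "-M \<le> x" for x y
    using contI[OF _ that] iF(1) iG(1) iC(1) iE(1) iP(1) by blast+
  have "open {t. 0 < G t}"
    using cont(2) by (auto intro!: open_Collect_less)
  moreover have "{t. 0 < G t} \<noteq> {}"
  proof
    assume "{t. 0 < G t} = {}"
    then have "G = (\<lambda>_. 0)" using G0 by (intro ext) (auto simp: order.antisym not_less)
    then show False using pos(2) by simp
  qed
  moreover have "{t. 0 < G t} \<subseteq> {-M<..<M}"
  proof
    fix t assume "t \<in> {t. 0 < G t}"
    then have "\<not> M \<le> \<bar>t\<bar>" using G_supp[of t] by auto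
    then show "t \<in> {-M<..<M}" by auto
  qed
  ultimately obtain \<alpha> \<beta> where \<alpha>\<beta>: "-M \<le> \<alpha>" "\<alpha> < \<beta>" "\<beta> \<le> M" "{t. 0 < G t} = {\<alpha><..<\<beta>}"
    using convex_open_real_interval[OF G_convex, of "-M" M] by blast
  have Gpos: "0 < G t \<longleftrightarrow> \<alpha> < t \<and> t < \<beta>" for t
    using \<alpha>\<beta>(4) by (auto simp: set_eq_iff)
  have G_out: "G t = 0" if "t \<le> \<alpha> \<or> \<beta> \<le> t" for t
    using that Gpos[of t] G0[of t] by force
  have iG\<alpha>: "iG \<alpha> = 0"
    using increment_bound_of_deriv_le[of "-M" \<alpha> iG G iG "G" 0, OF \<alpha>\<beta>(1) iG(1) iG(1)] iG(3) G_out by simp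
  have iG\<beta>: "iG \<beta> = b"
    using increment_bound_of_deriv_le[of \<beta> M iG G iG "G" 0, OF \<alpha>\<beta>(3) iG(1) iG(1)] G_out bG \<alpha>\<beta>(1,2) by simp
  have iG_strict: "iG x < iG y" if "\<alpha> \<le> x" "x < y" "y \<le> \<beta>" for x y
  proof (rule DERIV_pos_imp_increasing_open[OF \<open>x < y\<close>])
    show "continuous_on {x..y} iG" using that \<alpha>\<beta> by (intro cont_iG) auto
    fix z assume "x < z" "z < y"
    then have "- M \<le> z" "0 < G z" using that \<alpha>\<beta> Gpos by auto
    then show "\<exists>d. (iG has_real_derivative d) (at z) \<and> 0 < d" using iG(1) by blast
  qed
  have iG_inj: "inj_on iG {\<alpha>..\<beta>}"
    by (rule linorder_inj_onI) (use iG_strict in force)+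
  have iG_img: "iG ` {\<alpha>..\<beta>} = {0..b}"
  proof
    show "iG ` {\<alpha>..\<beta>} \<subseteq> {0..b}"
      using mono_iG[of \<alpha>] mono_iG[of _ \<beta>] \<alpha>\<beta> iG\<alpha> iG\<beta> by auto
    show "{0..b} \<subseteq> iG ` {\<alpha>..\<beta>}"
    proof
      fix y assume "y \<in> {0..b}"
      then obtain x where "\<alpha> \<le> x" "x \<le> \<beta>" "iG x = y"
        using IVT'[of iG \<alpha> y \<beta>] iG\<alpha> iG\<beta> \<alpha>\<beta> cont_iG[of \<alpha> \<beta>] by auto
      then show "y \<in> iG ` {\<alpha>..\<beta>}" by auto
    qed
  qed
  \<comment> \<open>The quantile function of \<open>G\<close>. Convexity of the positivity set makes
    \<open>iG\<close> strictly increasing on the whole interval, so \<open>T\<close> is continuous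
    up to the endpoints.\<close>
  define T where "T = inv_into {\<alpha>..\<beta>} iG"
  have T_in: "\<alpha> \<le> T y \<and> T y \<le> \<beta>" and T_inv: "iG (T y) = y" if "0 \<le> y" "y \<le> b" for y
  proof -
    have "y \<in> iG ` {\<alpha>..\<beta>}" using that iG_img by auto
    then show "\<alpha> \<le> T y \<and> T y \<le> \<beta>" "iG (T y) = y"
      unfolding T_def using inv_into_into[of y iG "{\<alpha>..\<beta>}"] f_inv_into_f[of y iG "{\<alpha>..\<beta>}"] by auto
  qed
  have T0: "T 0 = \<alpha>" and Tb: "T b = \<beta>"
    unfolding T_def using inv_into_f_f[OF iG_inj, of \<alpha>] inv_into_f_f[OF iG_inj, of \<beta>] \<alpha>\<beta> iG\<alpha> iG\<beta> by auto
  have T_cont: "continuous_on {0..b} T"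
    using continuous_on_inv[of "{\<alpha>..\<beta>}" iG T] cont_iG[of \<alpha> \<beta>] \<alpha>\<beta> iG_img inv_into_f_f[OF iG_inj]
    by (auto simp: T_def)
  have T_strict: "\<alpha> < T y \<and> T y < \<beta>" if "0 < y" "y < b" for y
    using T_in[of y] T_inv[of y] that iG\<alpha> iG\<beta> by (metis less_eq_real_def less_irrefl)
  have T_deriv: "(T has_real_derivative inverse (G (T y))) (at y)" if y: "0 < y" "y < b" for y
  proof (rule DERIV_inverse_function[where a = 0 and b = b])
    show "(iG has_real_derivative G (T y)) (at (T y))"
      using iG(1) T_strict[OF y] \<alpha>\<beta> by auto
    show "G (T y) \<noteq> 0" using Gpos T_strict[OF y] by (metis less_irrefl)
    show "isCont T y"
      using T_cont y by (auto intro: continuous_on_interior)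
  qed (use y T_inv in auto)

  \<comment> \<open>The points p and q obtained below are the last with no mass of \<open>F\<close>
    to the left and the first with none to the right. \<open>F\<close> may still vanish between
    them, but there 0 < \<open>iF\<close> < a, so the argument of \<open>T\<close> stays in the open
    interval where \<open>T\<close> is differentiable.\<close>
  have cl: "compact ({-M..M} \<inter> iF -` {z})" for z
    using continuous_closed_preimage[OF cont_iF, of "-M" M "{z}"] compact_Int_closed[of "{-M..M}" "{-M..M} \<inter> iF -` {z}"]
    by (simp add: Int_absorb1)
  have "-M \<in> {-M..M} \<inter> iF -` {0}" using iF(3) M by auto
  then obtain p where "p \<in> {-M..M} \<inter> iF -` {0}" "\<And>s. s \<in> {-M..M} \<inter> iF -` {0} \<Longrightarrow> s \<le> p"
    using compact_attains_sup[OF cl[of 0]] by blast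
  moreover have "M \<in> {-M..M} \<inter> iF -` {a}" using aF M by auto
  then obtain q where "q \<in> {-M..M} \<inter> iF -` {a}" "\<And>s. s \<in> {-M..M} \<inter> iF -` {a} \<Longrightarrow> q \<le> s"
    using compact_attains_inf[OF cl[of a]] by blast
  ultimately have p: "-M \<le> p" "p \<le> M" "iF p = 0" and p': "\<And>s. -M \<le> s \<Longrightarrow> s \<le> M \<Longrightarrow> iF s = 0 \<Longrightarrow> s \<le> p"
    and q: "-M \<le> q" "q \<le> M" "iF q = a" and q': "\<And>s. -M \<le> s \<Longrightarrow> s \<le> M \<Longrightarrow> iF s = a \<Longrightarrow> q \<le> s"
    by auto
  have pq: "p < q"
    using mono_iF[of q p] p q ab by linarith
  have iF_in: "0 \<le> iF s \<and> iF s \<le> a" if "-M \<le> s" "s \<le> M" for s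
    using mono_iF[of "-M" s] mono_iF[of s M] that aF iF(3) by auto
  have iF_strict: "0 < iF s \<and> iF s < a" if "p < s" "s < q" for s
    using iF_in[of s] p'[of s] q'[of s] that p q by (auto simp: less_le)

  define t where "t s = T (b / a * iF s)" for s
  \<comment> \<open>\<open>H\<close> is the claimed inequality truncated at s, with t \<Phi> as the
    boundary term of the integration by parts. By \<open>slice\<close> multiplied by
    \<open>F s\<close>, its derivative is at least \<open>(t' - 1 - ln t') * \<Phi> s\<close> where
    \<open>F s\<close> is positive.\<close>
  define H where "H s = iC s + t s * \<Phi> s + a / b * iE (t s) - (m + 1 + ln (b / a)) * iP s" for s
  have arg_in: "0 \<le> b / a * iF s \<and> b / a * iF s \<le> b" if "p \<le> s" "s \<le> q" for s
    using iF_in[of s] that p q ab by (auto simp: field_simps)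
  have t_cont: "continuous_on {p..q} t"
    unfolding t_def using arg_in cont_iF[OF p(1)]
    by (intro continuous_on_compose2[OF T_cont] continuous_intros) auto
  have H_cont: "continuous_on {p..q} H"
  proof -
    have "continuous_on {p..q} (\<lambda>s. iE (t s))"
      by (rule continuous_on_compose2[OF cont_iE t_cont, of \<alpha> \<beta>])
         (use \<alpha>\<beta> arg_in T_in in \<open>auto simp: t_def\<close>)
    then show ?thesis unfolding H_def
      using cont_iC[OF p(1)] cont_iP[OF p(1)] t_cont continuous_on_subset[OF c\<Phi>]
      by (intro continuous_intros) auto
  qed
  have H_mono: "H p \<le> H q"
  proof (rule DERIV_nonneg_imp_increasing_open[OF less_imp_le[OF pq] _ H_cont])
    fix s assume s: "p < s" "s < q"
    define y where "y = b / a * iF s"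
    have y: "0 < y" "y < b"
      using iF_strict[OF s] ab by (auto simp: y_def field_simps)
    have ts: "t s = T y" by (simp add: t_def y_def)
    have Gt: "0 < G (t s)" and ts': "\<alpha> < t s" "t s < \<beta>"
      using T_strict[OF y] Gpos ts by auto
    define t' where "t' = inverse (G (t s)) * (b / a * F s)"
    have dt: "(t has_real_derivative t') (at s)"
    proof -
      have "((\<lambda>s. b / a * iF s) has_real_derivative b / a * F s) (at s)"
        using iF(1)[of s] s p by (intro DERIV_cmult) auto
      from DERIV_chain2[OF T_deriv[OF y, unfolded y_def] this]
      show ?thesis by (simp add: t_def[abs_def] t'_def y_def)
    qed
    have dH: "(H has_real_derivative C s + (t' * \<Phi> s + t s * \<Phi>' s) + a / b * (E (t s) * t')
                 - (m + 1 + ln (b / a)) * \<Phi> s) (at s)"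
      unfolding H_def
      using iC(1)[of s] iP(1)[of s] s p d\<Phi>[of s] ts' \<alpha>\<beta>
      by (intro DERIV_add DERIV_diff DERIV_cmult DERIV_chain2[OF iE(1) dt] DERIV_cong[OF DERIV_mult[OF dt d\<Phi>]]) auto
    moreover have "0 \<le> C s + (t' * \<Phi> s + t s * \<Phi>' s) + a / b * (E (t s) * t')
                 - (m + 1 + ln (b / a)) * \<Phi> s"
    proof (cases "F s = 0")
      \<comment> \<open>Without mass at s, \<open>bound\<close> annihilates C, \<Phi> and \<Phi>',
        and t' is zero as well.\<close>
      case True
      then show ?thesis
        using bound[of s] E0 by (simp add: t'_def)
    next
      case False
      then have Fs: "F s > 0" using F0[of s] by simp
      have t'pos: "t' > 0" using Fs Gt ab by (simp add: t'_def)
      have "(m + ln (G (t s) / F s)) * \<Phi> s \<le> C s + t s * \<Phi>' s + E (t s) * (F s / G (t s))"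
      proof -
        have "X / F s * F s = X" "(X / F s + Y / G (t s)) * F s = X + Y * (F s / G (t s))" for X Y
          using Fs by (simp_all add: distrib_right)
        then show ?thesis using mult_right_mono[OF slice[OF Fs Gt] F0[of s]] by metis
      qed
      moreover have "F s / G (t s) = a / b * t'"
        using ab Gt by (simp add: t'_def field_simps)
      moreover have "G (t s) / F s = (b / a) / t'"
        using ab Gt Fs by (simp add: t'_def field_simps)
      moreover have "ln ((b / a) / t') = ln (b / a) - ln t'"
        using ln_div[of "b / a" t'] ab t'pos by (simp add: zero_less_divide_iff)
      moreover have "ln t' * \<Phi> s \<le> (t' - 1) * \<Phi> s"
        using ln_le_minus_one[OF t'pos] \<Phi>0[of s] by (intro mult_right_mono) auto
      ultimately have "(m + (ln (b / a) - ln t')) * \<Phi> s \<le> C s + t s * \<Phi>' s + E (t s) * (a / b * t')"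
        and "ln t' * \<Phi> s \<le> (t' - 1) * \<Phi> s" by simp_all
      moreover have "0 \<le> c + (t' * P + u) + r * (e * t') - (m + 1 + L) * P"
        if "(m + (L - n)) * P \<le> c + u + e * (r * t')" "n * P \<le> (t' - 1) * P" for c P u r e L n :: real
        using that by (simp add: algebra_simps)
      ultimately show ?thesis by blast
    qed
    ultimately show "\<exists>y. (H has_real_derivative y) (at s) \<and> 0 \<le> y" by blast
  qed
  have dz: "\<bar>X y - X x\<bar> \<le> K * (iF y - iF x)"
    if "\<And>s. -M \<le> s \<Longrightarrow> (X has_real_derivative X' s) (at s)" "\<And>s. \<bar>X' s\<bar> \<le> K * F s" "-M \<le> x" "x \<le> y"
    for X X' x y
    by (rule increment_bound_of_deriv_le[of x y X X' iF F K, OF _ that(1) iF(1) that(2)]) (use that in auto)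
  \<comment> \<open>No mass lies outside [p, q], so the primitives of C and \<Phi>, and \<Phi>
    itself, have the same values at p and q as at -M and M.\<close>
  have "iC p = 0" "iP p = 0" "\<Phi> p = 0"
    using dz[OF iC(1) bound(1), of "-M" p] dz[OF iP(1) bound(2), of "-M" p]
      dz[OF d\<Phi> bound(3), of "-M" p] p iF(3) iC(3) iP(3) bdry by auto
  moreover have "iC q = iC M" "iP q = iP M" "\<Phi> q = 0"
    using dz[OF iC(1) bound(1), of q M] dz[OF iP(1) bound(2), of q M]
      dz[OF d\<Phi> bound(3), of q M] q aF bdry by auto
  moreover have "t p = \<alpha>" "t q = \<beta>"
    using p q ab T0 Tb by (auto simp: t_def)
  ultimately have "(m + 1 + ln (b / a)) * iP M \<le> iC M + a / b * (iE \<beta> - iE \<alpha>)"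
    using H_mono by (simp add: H_def algebra_simps)
  also have "\<dots> \<le> iC M + a / b * iE M"
    using mono_iE[of "-M" \<alpha>] mono_iE[of \<beta> M] iE(3) \<alpha>\<beta> ab
    by (intro add_left_mono mult_left_mono) auto
  finally have "(m + 1 + ln (b / a)) * iP M / a \<le> (iC M + a / b * iE M) / a"
    using ab by (intro divide_right_mono) auto
  then show ?thesis
    using iC(2)[of M] iE(2)[of M] iP(2)[of M] M ab by (simp add: add_divide_distrib)
qed

section \<open>Iterated integrals\<close>

definition set_coord :: "'a::euclidean_space \<Rightarrow> real \<Rightarrow> 'a \<Rightarrow> 'a" where
  "set_coord i s x = x + (s - x \<bullet> i) *\<^sub>R i"

lemma inner_set_coord:
  "i \<in> Basis \<Longrightarrow> b \<in> Basis \<Longrightarrow> set_coord i s x \<bullet> b = (if b = i then s else x \<bullet> b)"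
  by (simp add: set_coord_def inner_add_left inner_Basis)

lemma set_coord_0_add: "set_coord i 0 x + t *\<^sub>R i = set_coord i t x"
  by (simp add: set_coord_def algebra_simps)

lemma set_coord_commute:
  assumes "i \<in> Basis" "j \<in> Basis" "i \<noteq> j"
  shows "set_coord j r (x + s *\<^sub>R i) = set_coord j r x + s *\<^sub>R i"
  using assms by (simp add: set_coord_def inner_add_left inner_Basis)

lemma continuous_set_coord [continuous_intros]:
  assumes "continuous_on A s" "continuous_on A x"
  shows "continuous_on A (\<lambda>z. set_coord i (s z) (x z))"
  unfolding set_coord_def by (intro continuous_intros assms)

text \<open>Coordinates that are not in the list are read off from the point, so every marginal is
  again a function on the full space and inductions over the coordinates stay within one type. The
  order of the list is the order of the triangular transport.\<close>

primrec iter_integral :: "real \<Rightarrow> 'a::euclidean_space list \<Rightarrow> ('a \<Rightarrow> real) \<Rightarrow> 'a \<Rightarrow> real" where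
  "iter_integral M [] h x = h x"
| "iter_integral M (i # js) h x = integral {-M..M} (\<lambda>s. iter_integral M js h (set_coord i s x))"

lemma continuous_iter_integral:
  "continuous_on UNIV h \<Longrightarrow> continuous_on UNIV (iter_integral M js h)"
proof (induction js)
  case (Cons i js)
  have "continuous_on (UNIV \<times> cbox (-M) M) (\<lambda>(x, s). iter_integral M js h (set_coord i s x))"
    unfolding case_prod_beta
    by (rule continuous_on_compose2[OF Cons.IH[OF Cons.prems]]) (auto intro!: continuous_intros)
  then show ?case
    using integral_continuous_on_param[of UNIV "-M" M "\<lambda>x s. iter_integral M js h (set_coord i s x)"]
    by simp
qed simp

lemma continuous_iter_integral_slice:
  assumes "continuous_on UNIV h"
  shows "continuous_on A (\<lambda>s. iter_integral M js h (set_coord i s x))"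
  by (rule continuous_on_compose2[OF continuous_iter_integral[OF assms], of A _ M js])
     (auto intro!: continuous_intros)

lemma integrable_iter_integral_slice:
  "continuous_on UNIV h \<Longrightarrow> (\<lambda>s. iter_integral M js h (set_coord i s x)) integrable_on {u..v::real}"
  by (intro integrable_continuous_real continuous_iter_integral_slice)

lemma iter_integral_add:
  assumes "continuous_on UNIV h" "continuous_on UNIV k"
  shows "iter_integral M js (\<lambda>u. h u + k u) x = iter_integral M js h x + iter_integral M js k x"
  by (induction js arbitrary: x)
     (simp_all add: Henstock_Kurzweil_Integration.integral_add integrable_iter_integral_slice assms)

lemma iter_integral_cmult:
  "iter_integral M js (\<lambda>u. c * h u) x = c * iter_integral M js h x"
  by (induction js arbitrary: x) simp_all

lemma iter_integral_mono:
  assumes "continuous_on UNIV h" "continuous_on UNIV k" "\<And>u. h u \<le> k u"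
  shows "iter_integral M js h x \<le> iter_integral M js k x"
  by (induction js arbitrary: x)
     (simp_all add: assms Henstock_Kurzweil_Integration.integral_le integrable_iter_integral_slice)

lemma iter_integral_zero: "iter_integral M js (\<lambda>_. 0) x = 0"
  by (induction js arbitrary: x) simp_all

lemma iter_integral_nonneg:
  assumes "continuous_on UNIV h" "\<And>u. 0 \<le> h u"
  shows "0 \<le> iter_integral M js h x"
  using iter_integral_mono[of "\<lambda>_. 0" h M js x] assms by (simp add: iter_integral_zero)

lemma iter_integral_abs_le:
  assumes "continuous_on UNIV h" "continuous_on UNIV k" "\<And>u. \<bar>h u\<bar> \<le> K * k u"
  shows "\<bar>iter_integral M js h x\<bar> \<le> K * iter_integral M js k x"
proof -
  have "- K * k u \<le> h u \<and> h u \<le> K * k u" for u using assms(3)[of u] by (simp add: abs_le_iff)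
  then have "iter_integral M js (\<lambda>u. - K * k u) x \<le> iter_integral M js h x"
    "iter_integral M js h x \<le> iter_integral M js (\<lambda>u. K * k u) x"
    by (auto intro!: iter_integral_mono continuous_intros assms simp del: mult_minus_left)
  then show ?thesis
    using iter_integral_cmult[of M js "- K" k x] iter_integral_cmult[of M js K k x]
    by (simp add: abs_le_iff)
qed

lemma iter_integral_cong_slice:
  assumes "set js \<subseteq> Basis"
    and "\<And>u. (\<And>b. b \<in> Basis - set js \<Longrightarrow> u \<bullet> b = x \<bullet> b) \<Longrightarrow> h u = k u"
  shows "iter_integral M js h x = iter_integral M js k x"
  using assms
proof (induction js arbitrary: x)
  case Nil
  then show ?case by simp
next
  case (Cons i js)
  have "iter_integral M js h (set_coord i s x) = iter_integral M js k (set_coord i s x)" for s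
  proof (rule Cons.IH)
    fix u assume u: "\<And>b. b \<in> Basis - set js \<Longrightarrow> u \<bullet> b = set_coord i s x \<bullet> b"
    show "h u = k u"
      by (rule Cons.prems(2)) (use u Cons.prems(1) in \<open>auto simp: inner_set_coord\<close>)
  qed (use Cons.prems in auto)
  then show ?case by simp
qed

lemma iter_integral_slice_eq_0:
  assumes "set js \<subseteq> Basis" "i \<in> Basis" "i \<notin> set js" "\<And>u. M \<le> \<bar>u \<bullet> i\<bar> \<Longrightarrow> h u = 0" "M \<le> \<bar>s\<bar>"
  shows "iter_integral M' js h (set_coord i s x) = 0"
  by (subst iter_integral_cong_slice[OF assms(1), of "set_coord i s x" h "\<lambda>_. 0"])
     (use assms in \<open>auto simp: iter_integral_zero inner_set_coord\<close>)

lemma iter_integral_deriv: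
  assumes "set js \<subseteq> Basis" "i \<in> Basis" "i \<notin> set js" "continuous_on UNIV h" "continuous_on UNIV D"
    and "\<And>x s. ((\<lambda>s. h (x + s *\<^sub>R i)) has_real_derivative D (x + s *\<^sub>R i)) (at s)"
  shows "((\<lambda>s. iter_integral M js h (x + s *\<^sub>R i)) has_real_derivative
            iter_integral M js D (x + s *\<^sub>R i)) (at s)"
  using assms(1,3)
proof (induction js arbitrary: x s)
  case Nil
  then show ?case using assms(6) by simp
next
  case (Cons j js)
  then have j: "j \<in> Basis" "i \<noteq> j" by auto
  have eq: "iter_integral M (j # js) k (x + s *\<^sub>R i)
      = integral (cbox (-M) M) (\<lambda>r. iter_integral M js k (set_coord j r x + s *\<^sub>R i))" for k s
    by (simp add: set_coord_commute[OF assms(2) j])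
  have "((\<lambda>s. integral (cbox (-M) M) (\<lambda>r. iter_integral M js h (set_coord j r x + s *\<^sub>R i)))
          has_real_derivative
          integral (cbox (-M) M) (\<lambda>r. iter_integral M js D (set_coord j r x + s *\<^sub>R i))) (at s within UNIV)"
  proof (rule leibniz_rule_field_derivative)
    fix s r :: real
    show "((\<lambda>s. iter_integral M js h (set_coord j r x + s *\<^sub>R i)) has_real_derivative
        iter_integral M js D (set_coord j r x + s *\<^sub>R i)) (at s within UNIV)"
      using Cons by simp
  next
    fix s :: real
    show "(\<lambda>r. iter_integral M js h (set_coord j r x + s *\<^sub>R i)) integrable_on cbox (-M) M"
      by (intro integrable_continuous continuous_on_compose2[OF continuous_iter_integral[OF assms(4)], of _ _ M js])
         (auto intro!: continuous_intros)
  next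
    show "continuous_on (UNIV \<times> cbox (-M) M) (\<lambda>(s, r). iter_integral M js D (set_coord j r x + s *\<^sub>R i))"
      unfolding case_prod_beta
      by (intro continuous_on_compose2[OF continuous_iter_integral[OF assms(5)], of _ _ M js])
         (auto intro!: continuous_intros)
  qed auto
  then show ?case unfolding eq by simp
qed

text \<open>A continuous nonnegative function on an interval has positive integral iff it is
  positive somewhere. The positivity set of a marginal is therefore the projection of the previous
  one along the integrated coordinate, and projections preserve convexity.\<close>

lemma convex_iter_integral_pos:
  assumes "0 < M" "set js \<subseteq> Basis" "distinct js" "continuous_on UNIV g" "\<And>u. 0 \<le> g u"
    and "\<And>u j. j \<in> set js \<Longrightarrow> M \<le> \<bar>u \<bullet> j\<bar> \<Longrightarrow> g u = 0" and "convex {v. 0 < g v}"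
  shows "convex {v. 0 < iter_integral M js g v}"
  using assms(2,3,6)
proof (induction js)
  case Nil
  then show ?case using assms(7) by simp
next
  case (Cons i js)
  have nn: "0 \<le> iter_integral M js' g v" for js' v
    using iter_integral_nonneg assms(4,5) by blast
  have pos: "0 < iter_integral M (i # js) g v \<longleftrightarrow> (\<exists>s. 0 < iter_integral M js g (set_coord i s v))" for v
  proof -
    have "0 < iter_integral M (i # js) g v \<longleftrightarrow> iter_integral M (i # js) g v \<noteq> 0"
      using nn[of "i # js" v] by linarith
    also have "\<dots> \<longleftrightarrow> (\<exists>s\<in>{-M..M}. iter_integral M js g (set_coord i s v) \<noteq> 0)"
      using integral_eq_0_iff[OF continuous_iter_integral_slice[OF assms(4)], of "-M" M M js i v] nn assms(1)
      by auto
    also have "\<dots> \<longleftrightarrow> (\<exists>s. 0 < iter_integral M js g (set_coord i s v))"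
      using iter_integral_slice_eq_0[of js i M g _ M v] Cons.prems nn
      by (auto simp: less_le) (metis abs_le_iff atLeastAtMost_iff linorder_le_cases minus_le_iff)
    finally show ?thesis .
  qed
  have cv: "convex {v. 0 < iter_integral M js g v}"
    using Cons by auto
  show ?case
  proof (rule convexI)
    fix v w and p q :: real
    assume "v \<in> {v. 0 < iter_integral M (i # js) g v}" "w \<in> {v. 0 < iter_integral M (i # js) g v}"
      and pq: "0 \<le> p" "0 \<le> q" "p + q = 1"
    then obtain s t where "0 < iter_integral M js g (set_coord i s v)" "0 < iter_integral M js g (set_coord i t w)"
      by (auto simp only: pos mem_Collect_eq)
    then have "0 < iter_integral M js g (p *\<^sub>R set_coord i s v + q *\<^sub>R set_coord i t w)"
      using convexD[OF cv _ _ pq] by auto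
    also have "p *\<^sub>R set_coord i s v + q *\<^sub>R set_coord i t w = set_coord i (p * s + q * t) (p *\<^sub>R v + q *\<^sub>R w)"
      by (simp add: set_coord_def inner_add_left algebra_simps)
    finally show "p *\<^sub>R v + q *\<^sub>R w \<in> {v. 0 < iter_integral M (i # js) g v}"
      unfolding mem_Collect_eq pos by blast
  qed
qed

text \<open>Kantorovich dual form of the Knothe transport from the density \<open>f\<close> to the density \<open>g\<close>: the pair
  \<open>(c, d)\<close> plays the role of the potentials for the cost \<open>- \<nabla>\<phi>(u) \<bullet> v\<close>. In the induction step the part
  of this cost belonging to the new coordinate is constant in \<open>v\<close> on slices and is absorbed into \<open>c\<close>.\<close>

lemma iterated_transport_inequality:
  fixes f g \<phi> c d :: "'a::euclidean_space \<Rightarrow> real" and D :: "'a \<Rightarrow> 'a \<Rightarrow> real"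
  assumes M: "0 < M"
    and cont: "continuous_on UNIV f" "continuous_on UNIV g" "continuous_on UNIV \<phi>" "continuous_on UNIV d"
    and f: "\<And>u. 0 \<le> f u" "\<And>u. \<phi> u \<noteq> 0 \<Longrightarrow> f u = 1" and g: "\<And>u. 0 \<le> g u" "\<And>u. g u \<le> 1"
    and \<phi>: "\<And>u. 0 \<le> \<phi> u" "\<And>u. \<phi> u \<le> K\<phi>" and d: "\<And>v. 0 \<le> d v"
    and g_convex: "convex {v. 0 < g v}"
    and js: "distinct js" "set js \<subseteq> Basis"
    and D: "\<And>j. j \<in> set js \<Longrightarrow> continuous_on UNIV (D j)"
      "\<And>j u. j \<in> set js \<Longrightarrow> \<bar>D j u\<bar> \<le> KD" "\<And>j u. j \<in> set js \<Longrightarrow> \<phi> u = 0 \<Longrightarrow> D j u = 0"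
      "\<And>j x s. j \<in> set js \<Longrightarrow> ((\<lambda>s. \<phi> (x + s *\<^sub>R j)) has_real_derivative D j (x + s *\<^sub>R j)) (at s)"
    and supp: "\<And>j u. j \<in> set js \<Longrightarrow> M \<le> \<bar>u \<bullet> j\<bar> \<Longrightarrow> \<phi> u = 0" "\<And>j u. j \<in> set js \<Longrightarrow> M \<le> \<bar>u \<bullet> j\<bar> \<Longrightarrow> g u = 0"
    and c: "continuous_on UNIV c" "\<And>u. \<bar>c u * f u\<bar> \<le> Kc * f u"
    and duality: "\<And>u v. 0 < g v \<Longrightarrow> (\<And>b. b \<in> Basis - set js \<Longrightarrow> v \<bullet> b = y \<bullet> b) \<Longrightarrow>
        - (\<Sum>j\<in>set js. D j u * (v \<bullet> j)) \<le> c u + d v"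
    and pos: "0 < iter_integral M js f x" "0 < iter_integral M js g y"
  shows "(real (length js) + ln (iter_integral M js g y / iter_integral M js f x))
            * iter_integral M js \<phi> x / iter_integral M js f x
         \<le> iter_integral M js (\<lambda>u. c u * f u) x / iter_integral M js f x
           + iter_integral M js (\<lambda>v. d v * g v) y / iter_integral M js g y"
  using js D supp c duality pos
proof (induction js arbitrary: c Kc x y)
  case Nil
  have cd: "0 \<le> c x + d y"
    using Nil.prems(11)[of y x] Nil.prems(13) by simp
  show ?case
  proof (cases "\<phi> x = 0")
    case True
    then show ?thesis using cd Nil.prems(12,13) by simp
  next
    case False
    \<comment> \<open>With no coordinates left the logarithm must have the right sign:
      \<open>f\<close> is 1 where \<phi> does not vanish, and \<open>g\<close> is at most 1.\<close>
    then have "f x = 1" using f by simp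
    moreover have "ln (g y) * \<phi> x \<le> 0"
      using g(2)[of y] \<phi>(1)[of x] Nil.prems(13) by (intro mult_nonpos_nonneg) auto
    ultimately show ?thesis using cd Nil.prems(13) by simp
  qed
next
  case (Cons i js)
  note js = Cons.prems(1,2) and D = Cons.prems(3-6) and supp = Cons.prems(7,8)
    and c = Cons.prems(9,10) and duality = Cons.prems(11) and pos = Cons.prems(12,13)
  have i: "i \<in> Basis" "i \<notin> set js" "set js \<subseteq> Basis" "distinct js" using js by auto
  define I where "I h s = iter_integral M js h (set_coord i s x)" for h s
  define J where "J h s = iter_integral M js h (set_coord i s y)" for h s
  have IJ: "iter_integral M (i # js) h x = integral {-M..M} (I h)"
    "iter_integral M (i # js) h y = integral {-M..M} (J h)" for h
    by (simp_all add: I_def[abs_def] J_def[abs_def])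
  have cI: "continuous_on UNIV (I h)" and cJ: "continuous_on UNIV (J h)" if "continuous_on UNIV h" for h
    unfolding I_def J_def using that by (auto intro: continuous_iter_integral_slice)
  have ccf: "continuous_on UNIV (\<lambda>u. c u * f u)" and cdg: "continuous_on UNIV (\<lambda>v. d v * g v)"
    by (intro continuous_intros c cont)+
  have cDi: "continuous_on UNIV (D i)" using D(1) by simp
  \<comment> \<open>The derivative lives where \<open>f\<close> is 1, so t times it can be absorbed
    into the potential although the potential is integrated against \<open>f\<close>.\<close>
  have Dif: "D i u * f u = D i u" for u
    using f(2)[of u] D(3)[of i u] by (cases "\<phi> u = 0") auto
  have "(real (length js) + 1 + ln (integral {-M..M} (J g) / integral {-M..M} (I f))) *
      integral {-M..M} (I \<phi>) / integral {-M..M} (I f)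
      \<le> integral {-M..M} (I (\<lambda>u. c u * f u)) / integral {-M..M} (I f)
        + integral {-M..M} (J (\<lambda>v. d v * g v)) / integral {-M..M} (J g)"
  proof (rule monotone_transport_inequality[where \<Phi>' = "I (D i)" and K = "max Kc (max K\<phi> KD)"])
    show "continuous_on UNIV (I f)" "continuous_on UNIV (J g)" "continuous_on UNIV (I (D i))"
      "continuous_on UNIV (I (\<lambda>u. c u * f u))" "continuous_on UNIV (J (\<lambda>v. d v * g v))"
      using cI cJ cont cDi ccf cdg by auto
    show "0 \<le> I f s" "0 \<le> J g s" "0 \<le> J (\<lambda>v. d v * g v) s" "0 \<le> I \<phi> s" for s
      unfolding I_def J_def using cont f g \<phi> d cdg by (auto intro!: iter_integral_nonneg)
    show "(I \<phi> has_real_derivative I (D i) s) (at s)" for s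
    proof -
      have "((\<lambda>s. iter_integral M js \<phi> (set_coord i 0 x + s *\<^sub>R i)) has_real_derivative
          iter_integral M js (D i) (set_coord i 0 x + s *\<^sub>R i)) (at s)"
        using i by (intro iter_integral_deriv cont cDi D(4)) auto
      then show ?thesis by (simp only: set_coord_0_add I_def[abs_def])
    qed
    show "I \<phi> (-M) = 0" "I \<phi> M = 0"
      unfolding I_def using i M supp(1)[of i] by (auto intro!: iter_integral_slice_eq_0[of js i M])
    show "J g t = 0" if "M \<le> \<bar>t\<bar>" for t
      unfolding J_def using i that supp(2)[of i] by (intro iter_integral_slice_eq_0[of js i M]) auto
    let ?K = "max Kc (max K\<phi> KD)"
    have le: "z * f u \<le> ?K * f u" if "z \<in> {Kc, K\<phi>, KD}" for z u
      using that f(1)[of u] by (intro mult_right_mono) auto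
    show "\<bar>I (\<lambda>u. c u * f u) s\<bar> \<le> ?K * I f s" for s
      unfolding I_def using c(2) le[of Kc] by (intro iter_integral_abs_le ccf cont) (meson insertI1 order_trans)
    show "\<bar>I \<phi> s\<bar> \<le> ?K * I f s" for s
    proof -
      have "\<bar>\<phi> u\<bar> \<le> ?K * f u" for u
        using f[of u] \<phi>[of u] le[of K\<phi> u] order_trans[OF abs_ge_zero D(2)[of i u]] by (cases "\<phi> u = 0") auto
      from iter_integral_abs_le[OF cont(3,1) this] show ?thesis unfolding I_def .
    qed
    show "\<bar>I (D i) s\<bar> \<le> ?K * I f s" for s
    proof -
      have "\<bar>D i u\<bar> \<le> ?K * f u" for u
        using f[of u] D(2,3)[of i u] le[of KD u] order_trans[OF abs_ge_zero D(2)[of i u]] by (cases "\<phi> u = 0") auto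
      from iter_integral_abs_le[OF cDi cont(1) this] show ?thesis unfolding I_def .
    qed
    show "convex {t. 0 < J g t}"
    proof -
      have "convex {v. 0 < iter_integral M js g v}"
        using i supp(2) by (intro convex_iter_integral_pos M cont g g_convex) auto
      then have "0 < J g (p * s + q * t)"
        if "0 < J g s" "0 < J g t" "0 \<le> p" "0 \<le> q" "p + q = 1" for p q s t
      proof -
        have "p *\<^sub>R set_coord i s y + q *\<^sub>R set_coord i t y
            = set_coord i (p * s + q * t) (p *\<^sub>R y + q *\<^sub>R y)"
          by (simp add: set_coord_def inner_add_left algebra_simps)
        also have "p *\<^sub>R y + q *\<^sub>R y = y"
          using that(5) by (simp flip: scaleR_add_left)
        finally show ?thesis
          using convexD[OF \<open>convex {v. 0 < iter_integral M js g v}\<close>, of "set_coord i s y" "set_coord i t y" p q] that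
          by (simp add: J_def)
      qed
      then show ?thesis by (intro convexI) auto
    qed
    show "0 < integral {-M..M} (I f)" "0 < integral {-M..M} (J g)"
      using pos unfolding IJ by auto
    show "(real (length js) + ln (J g t / I f s)) * I \<phi> s / I f s
        \<le> (I (\<lambda>u. c u * f u) s + t * I (D i) s) / I f s + J (\<lambda>v. d v * g v) t / J g t"
      if st: "0 < I f s" "0 < J g t" for s t
    proof -
      define c' where "c' u = c u + t * D i u" for u
      have "(real (length js) + ln (J g t / I f s)) * I \<phi> s / I f s
        \<le> I (\<lambda>u. c' u * f u) s / I f s + J (\<lambda>v. d v * g v) t / J g t"
        unfolding I_def J_def
      proof (rule Cons.IH)
        show "continuous_on UNIV c'" unfolding c'_def by (intro continuous_intros c cDi)
        \<comment> \<open>This bound depends on t and serves only inside one slice; the constant K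
          given to the one-dimensional inequality is independent of s and t.\<close>
        show "\<bar>c' u * f u\<bar> \<le> (Kc + \<bar>t\<bar> * KD) * f u" for u
        proof -
          have "\<bar>t * D i u * f u\<bar> \<le> \<bar>t\<bar> * KD * f u"
            using D(2)[of i u] f(1)[of u] by (auto simp: abs_mult intro!: mult_right_mono mult_left_mono)
          then show ?thesis
            using c(2)[of u] by (simp add: c'_def distrib_right)
        qed
        show "- (\<Sum>j\<in>set js. D j u * (v \<bullet> j)) \<le> c' u + d v"
          if v: "0 < g v" "\<And>b. b \<in> Basis - set js \<Longrightarrow> v \<bullet> b = set_coord i t y \<bullet> b" for u v
        proof -
          have "v \<bullet> i = t" using v(2)[of i] i by (simp add: inner_set_coord)
          moreover have "- (\<Sum>j\<in>set (i # js). D j u * (v \<bullet> j)) \<le> c u + d v"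
            by (rule duality) (use v i in \<open>auto simp: inner_set_coord\<close>)
          ultimately show ?thesis using i by (simp add: c'_def mult.commute)
        qed
        show "\<phi> u = 0" "g u = 0" if "j \<in> set js" "M \<le> \<bar>u \<bullet> j\<bar>" for j u
          using supp[of j u] that by simp_all
      qed (use i D st in \<open>auto simp: I_def J_def\<close>)
      also have "I (\<lambda>u. c' u * f u) s = I (\<lambda>u. c u * f u) s + t * I (D i) s"
        unfolding I_def c'_def distrib_right mult.assoc Dif
        by (subst iter_integral_add) (auto intro!: continuous_intros c cont cDi simp: iter_integral_cmult)
      finally show ?thesis .
    qed
  qed
  then show ?case unfolding IJ by (simp add: add.commute)
qed

text \<open>Tonelli's theorem, one coordinate at a time with the others frozen at x. Truncation to
  [-M, M] loses nothing because h vanishes outside.\<close>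

lemma nn_integral_iter_integral:
  assumes "0 \<le> M" "continuous_on UNIV h" "\<And>u. 0 \<le> h u"
    and "distinct js" "set js \<subseteq> Basis" "\<And>u j. j \<in> set js \<Longrightarrow> M \<le> \<bar>u \<bullet> j\<bar> \<Longrightarrow> h u = 0"
  shows "ennreal (iter_integral M js h x) =
    (\<integral>\<^sup>+ y. ennreal (h ((\<Sum>b\<in>set js. y b *\<^sub>R b) + (\<Sum>b\<in>Basis - set js. (x \<bullet> b) *\<^sub>R b)))
       \<partial>Pi\<^sub>M (set js) (\<lambda>_. lborel :: real measure))"
  using assms(4-6)
proof (induction js arbitrary: x)
  case Nil
  interpret product_sigma_finite "\<lambda>_::'a. lborel :: real measure" ..
  show ?case by (simp add: euclidean_representation PiM_empty nn_integral_count_space_finite)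
next
  case (Cons i js)
  interpret product_sigma_finite "\<lambda>_::'a. lborel :: real measure" ..
  have i: "i \<in> Basis" "i \<notin> set js" "set js \<subseteq> Basis" "distinct js" using Cons.prems by auto
  have hm: "h \<in> borel_measurable borel" using assms(2) by (rule borel_measurable_continuous_onI)
  have nn: "0 \<le> iter_integral M js h v" for v using assms iter_integral_nonneg by blast
  have "ennreal (iter_integral M (i # js) h x)
      = (\<integral>\<^sup>+ s. ennreal (iter_integral M js h (set_coord i s x)) * indicator {-M..M} s \<partial>lborel)"
  proof -
    have "((\<lambda>s. iter_integral M js h (set_coord i s x)) has_integral iter_integral M (i # js) h x) {-M..M}"
      using integrable_integral[OF integrable_iter_integral_slice[OF assms(2)]] by simp
    from nn_integral_has_integral_lebesgue'[OF nn this] show ?thesis by simp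
  qed
  also have "\<dots> = (\<integral>\<^sup>+ s. ennreal (iter_integral M js h (set_coord i s x)) \<partial>lborel)"
  proof (rule nn_integral_cong)
    fix s
    have "iter_integral M js h (set_coord i s x) = 0" if "s \<notin> {-M..M}"
      using i Cons.prems(3)[of i] that by (intro iter_integral_slice_eq_0[of js i M]) auto
    then show "ennreal (iter_integral M js h (set_coord i s x)) * indicator {-M..M} s
        = ennreal (iter_integral M js h (set_coord i s x))" by (auto simp: indicator_def)
  qed
  also have "\<dots> = (\<integral>\<^sup>+ s. (\<integral>\<^sup>+ y. ennreal (h ((\<Sum>b\<in>set (i # js). (y(i := s)) b *\<^sub>R b)
      + (\<Sum>b\<in>Basis - set (i # js). (x \<bullet> b) *\<^sub>R b))) \<partial>Pi\<^sub>M (set js) (\<lambda>_. lborel)) \<partial>lborel)"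
  proof (rule nn_integral_cong)
    fix s :: real
    have "(\<Sum>b\<in>set js. y b *\<^sub>R b) + (\<Sum>b\<in>Basis - set js. (set_coord i s x \<bullet> b) *\<^sub>R b)
        = (\<Sum>b\<in>set (i # js). (y(i := s)) b *\<^sub>R b) + (\<Sum>b\<in>Basis - set (i # js). (x \<bullet> b) *\<^sub>R b)" for y
    proof -
      have "(Basis - set js) - {i} = Basis - set (i # js)" by auto
      then have "(\<Sum>b\<in>Basis - set js. (set_coord i s x \<bullet> b) *\<^sub>R b)
          = (set_coord i s x \<bullet> i) *\<^sub>R i + (\<Sum>b\<in>Basis - set (i # js). (set_coord i s x \<bullet> b) *\<^sub>R b)"
        using i by (subst sum.remove[of _ i]) auto
      also have "set_coord i s x \<bullet> i = s"
        using i by (simp add: inner_set_coord)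
      also have "(\<Sum>b\<in>Basis - set (i # js). (set_coord i s x \<bullet> b) *\<^sub>R b) = (\<Sum>b\<in>Basis - set (i # js). (x \<bullet> b) *\<^sub>R b)"
        using i by (intro sum.cong) (auto simp: inner_set_coord)
      moreover have "(\<Sum>b\<in>set (i # js). (y(i := s)) b *\<^sub>R b) = s *\<^sub>R i + (\<Sum>b\<in>set js. y b *\<^sub>R b)"
        using i by (auto intro!: sum.cong)
      ultimately show ?thesis by simp
    qed
    note eq = this
    have IH: "ennreal (iter_integral M js h (set_coord i s x)) =
      (\<integral>\<^sup>+ y. ennreal (h ((\<Sum>b\<in>set js. y b *\<^sub>R b)
        + (\<Sum>b\<in>Basis - set js. (set_coord i s x \<bullet> b) *\<^sub>R b))) \<partial>Pi\<^sub>M (set js) (\<lambda>_. lborel))"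
      by (rule Cons.IH[OF i(4,3)]) (use Cons.prems(3) in auto)
    show "ennreal (iter_integral M js h (set_coord i s x)) =
       (\<integral>\<^sup>+ y. ennreal (h ((\<Sum>b\<in>set (i # js). (y(i := s)) b *\<^sub>R b)
      + (\<Sum>b\<in>Basis - set (i # js). (x \<bullet> b) *\<^sub>R b))) \<partial>Pi\<^sub>M (set js) (\<lambda>_. lborel))"
      unfolding IH eq ..
  qed
  also have "\<dots> = (\<integral>\<^sup>+ y. ennreal (h ((\<Sum>b\<in>set (i # js). y b *\<^sub>R b)
      + (\<Sum>b\<in>Basis - set (i # js). (x \<bullet> b) *\<^sub>R b))) \<partial>Pi\<^sub>M (insert i (set js)) (\<lambda>_. lborel))"
    by (rule product_nn_integral_insert_rev[symmetric])
       (use i hm in \<open>auto intro!: measurable_compose[OF _ hm] borel_measurable_add borel_measurable_sum borel_measurable_scaleR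
          measurable_component_singleton measurable_compose[OF _ measurable_ennreal]\<close>)
  finally show ?case by simp
qed

lemma integral_eq_iter_integral:
  fixes h :: "'a::euclidean_space \<Rightarrow> real"
  assumes "0 \<le> M" "continuous_on UNIV h" "\<And>u. 0 \<le> h u"
    and "distinct js" "set js = Basis" "\<And>u j. j \<in> Basis \<Longrightarrow> M \<le> \<bar>u \<bullet> j\<bar> \<Longrightarrow> h u = 0"
  shows "has_bochner_integral lborel h (iter_integral M js h 0)"
proof (rule has_bochner_integral_nn_integral)
  have hm: "h \<in> borel_measurable borel" using assms(2) by (rule borel_measurable_continuous_onI)
  then show "h \<in> borel_measurable lborel" by simp
  show "AE x in lborel. 0 \<le> h x" using assms by simp
  show "0 \<le> iter_integral M js h 0" using assms iter_integral_nonneg by blast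
  have "(\<integral>\<^sup>+ x. ennreal (h x) \<partial>lborel) = (\<integral>\<^sup>+ y. ennreal (h (\<Sum>b\<in>Basis. y b *\<^sub>R b)) \<partial>Pi\<^sub>M Basis (\<lambda>_. lborel))"
    using hm by (subst lborel_eq) (auto intro!: nn_integral_distr)
  then show "(\<integral>\<^sup>+ x. ennreal (h x) \<partial>lborel) = ennreal (iter_integral M js h 0)"
    using nn_integral_iter_integral[OF assms(1-4), of 0] assms(5,6) by simp
qed

section \<open>The transport inequality for gradients\<close>

lemma integrable_lebesgue_on_continuous:
  fixes c :: "'a::euclidean_space \<Rightarrow> 'b::euclidean_space"
  assumes "continuous_on UNIV c" "bounded \<Omega>" "\<Omega> \<in> sets lebesgue"
  shows "integrable (lebesgue_on \<Omega>) c"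
proof -
  obtain M where M: "\<Omega> \<subseteq> cbox (-M) M" using assms(2) bounded_subset_cbox_symmetric by metis
  have "set_integrable lborel (cbox (-M) M) c"
    unfolding set_integrable_def
    by (intro borel_integrable_compact compact_cbox continuous_on_subset[OF assms(1)]) auto
  then have "set_integrable lebesgue (cbox (-M) M) c"
    unfolding set_integrable_def by (simp add: integrable_completion)
  then have "set_integrable lebesgue \<Omega> c"
    by (rule set_integrable_subset) (use assms M in auto)
  then show ?thesis
    using assms(3) by (simp add: set_integrable_def integrable_restrict_space)
qed

lemma integral_lebesgue_on_eq_lborel:
  fixes h :: "'a::euclidean_space \<Rightarrow> real"
  assumes "h \<in> borel_measurable borel" "\<Omega> \<in> sets lebesgue" "\<And>x. x \<notin> \<Omega> \<Longrightarrow> h x = 0"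
  shows "integral\<^sup>L (lebesgue_on \<Omega>) h = integral\<^sup>L lborel h"
proof -
  have "integral\<^sup>L (lebesgue_on \<Omega>) h = integral\<^sup>L lebesgue (\<lambda>x. indicator \<Omega> x *\<^sub>R h x)"
    using assms(2) by (simp add: integral_restrict_space)
  also have "\<dots> = integral\<^sup>L lebesgue h"
    using assms(3) by (intro Bochner_Integration.integral_cong) (auto simp: indicator_def)
  finally show ?thesis using assms(1) by (simp add: integral_completion)
qed

text \<open>Passage from continuous densities to the sets. For the source one Urysohn function,
  equal to 1 on the support of \<phi>, is enough, since its mass a only has to satisfy a \<le>
  |\<Omega>|. The target densities tend to the indicator of the ball, and equality of the volumes
  turns the logarithm into 0 in the limit.\<close>

lemma gradient_transport_inequality:
  fixes \<phi> c d :: "'a::euclidean_space \<Rightarrow> real" and D :: "'a \<Rightarrow> 'a \<Rightarrow> real"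
  assumes \<Omega>: "open \<Omega>" "bounded \<Omega>" and r: "0 < r"
    and vol: "measure lebesgue (ball (0::'a) r) = measure lebesgue \<Omega>"
    and \<phi>: "continuous_on UNIV \<phi>" "\<And>u. 0 \<le> \<phi> u" "compactly_supported_in \<phi> \<Omega>"
    and D: "\<And>j. j \<in> Basis \<Longrightarrow> continuous_on UNIV (D j)"
      "\<And>j u. j \<in> Basis \<Longrightarrow> \<phi> u = 0 \<Longrightarrow> D j u = 0"
      "\<And>j x s. j \<in> Basis \<Longrightarrow> ((\<lambda>s. \<phi> (x + s *\<^sub>R j)) has_real_derivative D j (x + s *\<^sub>R j)) (at s)"
    and cd: "continuous_on UNIV c" "\<And>u. 0 \<le> c u" "continuous_on UNIV d" "\<And>v. 0 \<le> d v"
    and duality: "\<And>u v. - (\<Sum>j\<in>Basis. D j u * (v \<bullet> j)) \<le> c u + d v"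
  shows "real DIM('a) * integral\<^sup>L lborel \<phi>
    \<le> integral\<^sup>L (lebesgue_on \<Omega>) c + integral\<^sup>L (lebesgue_on (ball 0 r)) d"
proof (cases "0 < integral\<^sup>L lborel \<phi>")
  case False
  have "0 \<le> integral\<^sup>L (lebesgue_on \<Omega>) c" "0 \<le> integral\<^sup>L (lebesgue_on (ball 0 r)) d"
    using cd by auto
  moreover have "real DIM('a) * integral\<^sup>L lborel \<phi> \<le> 0"
    using False by (intro mult_nonneg_nonpos) auto
  ultimately show ?thesis by linarith
next
  case True
  define V where "V = measure lborel (ball (0::'a) r)"
  have V: "0 < V" using r by (simp add: V_def content_ball_pos)
  have V\<Omega>: "V = measure lborel \<Omega>"
    using vol \<Omega>(1) by (simp add: V_def)
  define K where "K = closure {x. \<phi> x \<noteq> 0}"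
  have K: "compact K" "K \<subseteq> \<Omega>" "\<And>x. \<phi> x \<noteq> 0 \<Longrightarrow> x \<in> K"
    using \<phi>(3) closure_subset[of "{x. \<phi> x \<noteq> 0}"] by (auto simp: compactly_supported_in_def K_def)
  obtain f where f: "continuous_on UNIV f" "\<And>x. f x \<in> closed_segment 0 (1::real)"
      "\<And>x. x \<in> - \<Omega> \<Longrightarrow> f x = 0" "\<And>x. x \<in> K \<Longrightarrow> f x = 1"
    using Urysohn[of "- \<Omega>" K "0::real" 1] \<Omega> K by (auto simp: compact_imp_closed)
  have f01: "0 \<le> f x" "f x \<le> 1" for x using f(2)[of x] by (auto simp: closed_segment_eq_real_ivl)
  obtain B where B: "\<And>x. x \<in> \<Omega> \<union> ball 0 r \<Longrightarrow> norm x \<le> B"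
    using \<Omega>(2) by (meson bounded_Un bounded_ball bounded_iff)
  define M where "M = max B 0 + 1"
  have outside: "u \<notin> \<Omega>" "u \<notin> ball 0 r" if "M \<le> \<bar>u \<bullet> j\<bar>" "j \<in> Basis" for u :: 'a and j
    using B[of u] Basis_le_norm[OF that(2), of u] that(1) by (auto simp: M_def)
  have M: "0 < M" by (simp add: M_def)
  have \<phi>_out: "\<phi> u = 0" if "u \<notin> \<Omega>" for u using K that by blast
  obtain js :: "'a list" where js: "distinct js" "set js = Basis"
    using finite_distinct_list[OF finite_Basis] by blast
  have bdd_on: "\<exists>C. \<forall>u\<in>S. \<bar>h u\<bar> \<le> C" if "continuous_on UNIV h" "compact S" for h :: "'a \<Rightarrow> real" and S
    using compact_imp_bounded[OF compact_continuous_image[OF continuous_on_subset[OF that(1)] that(2)]]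
    by (auto simp: bounded_iff)
  obtain K\<phi> where K\<phi>: "\<And>u. \<phi> u \<le> K\<phi>"
  proof -
    obtain C where C: "\<forall>u\<in>K. \<bar>\<phi> u\<bar> \<le> C" using bdd_on[OF \<phi>(1) K(1)] by blast
    have "\<phi> u \<le> max C 0" for u using C K(3)[of u] by (cases "\<phi> u = 0") fastforce+
    then show ?thesis using that by blast
  qed
  obtain KD where KD: "\<And>j u. j \<in> Basis \<Longrightarrow> \<bar>D j u\<bar> \<le> KD"
  proof -
    have "\<forall>j\<in>Basis. \<exists>C. \<forall>u\<in>K. \<bar>D j u\<bar> \<le> C" using bdd_on D(1) K(1) by blast
    then obtain C where C: "\<And>j u. j \<in> Basis \<Longrightarrow> u \<in> K \<Longrightarrow> \<bar>D j u\<bar> \<le> C j" by metis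
    have "\<bar>D j u\<bar> \<le> (\<Sum>j\<in>Basis. \<bar>C j\<bar>)" if "j \<in> Basis" for j u
    proof (cases "\<phi> u = 0")
      case True
      then show ?thesis using D(2) that by (simp add: sum_nonneg)
    next
      case False
      then have "\<bar>D j u\<bar> \<le> \<bar>C j\<bar>" using C[OF that K(3)] by fastforce
      also have "\<dots> \<le> (\<Sum>j\<in>Basis. \<bar>C j\<bar>)" using that by (intro member_le_sum) auto
      finally show ?thesis .
    qed
    then show ?thesis using that by blast
  qed
  obtain Kc where Kc: "\<And>u. \<bar>c u * f u\<bar> \<le> Kc * f u"
  proof -
    obtain C where C: "\<forall>u\<in>closure \<Omega>. \<bar>c u\<bar> \<le> C"
      using bdd_on[OF cd(1)] \<Omega>(2) compact_closure by blast
    have "\<bar>c u * f u\<bar> \<le> C * f u" for u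
    proof (cases "u \<in> \<Omega>")
      case True
      then show ?thesis using C closure_subset[of \<Omega>] f01[of u] by (auto simp: abs_mult intro!: mult_right_mono)
    qed (use f in simp)
    then show ?thesis using that by blast
  qed
  \<comment> \<open>Positive exactly on the ball, so the convexity required of the target holds for
    every k and not only in the limit.\<close>
  define g where "g k v = min 1 (real (Suc k) * max 0 (r - norm v))" for k and v :: 'a
  have g: "continuous_on UNIV (g k)" "0 \<le> g k v" "g k v \<le> 1" for k v
    unfolding g_def by (intro continuous_intros) auto
  have g_pos: "0 < g k v \<longleftrightarrow> v \<in> ball 0 r" for k v
    by (auto simp: g_def zero_less_mult_iff)
  have g_out: "g k v = 0" if "v \<notin> ball 0 r" for k v
    using g_pos[of k v] g(2)[of k v] that by force
  have bint: "has_bochner_integral lborel h (iter_integral M js h 0)"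
    if "continuous_on UNIV h" "\<And>u. 0 \<le> h u" "\<And>u. u \<notin> \<Omega> \<union> ball 0 r \<Longrightarrow> h u = 0" for h
    using that outside M js by (intro integral_eq_iter_integral) auto
  note int_eq = bint[THEN has_bochner_integral_integral_eq] and int_able = bint[THEN integrable.intros]
  define a where "a = integral\<^sup>L lborel f"
  define b where "b k = integral\<^sup>L lborel (g k)" for k
  have ccf: "continuous_on UNIV (\<lambda>u. c u * f u)" and cdg: "continuous_on UNIV (\<lambda>v. d v * g k v)" for k
    by (intro continuous_intros f cd g)+
  have I_f: "iter_integral M js f 0 = a" "integrable lborel f"
    using int_eq[of f] int_able[of f] f f01 by (auto simp: a_def)
  have I_g: "iter_integral M js (g k) 0 = b k" "integrable lborel (g k)" for k
    using int_eq[of "g k"] int_able[of "g k"] g g_out by (auto simp: b_def)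
  have I_\<phi>: "iter_integral M js \<phi> 0 = integral\<^sup>L lborel \<phi>" "integrable lborel \<phi>"
    using int_eq[of \<phi>] int_able[of \<phi>] \<phi> \<phi>_out by auto
  have I_c: "iter_integral M js (\<lambda>u. c u * f u) 0 \<le> integral\<^sup>L (lebesgue_on \<Omega>) c"
  proof -
    have "iter_integral M js (\<lambda>u. c u * f u) 0 = integral\<^sup>L lborel (\<lambda>u. c u * f u)"
      using int_eq[OF ccf] cd f f01 by auto
    also have "\<dots> = integral\<^sup>L (lebesgue_on \<Omega>) (\<lambda>u. c u * f u)"
      using ccf f \<Omega>(1) by (intro integral_lebesgue_on_eq_lborel[symmetric] borel_measurable_continuous_onI) auto
    also have "\<dots> \<le> integral\<^sup>L (lebesgue_on \<Omega>) c"
      using \<Omega> f01 cd by (intro integral_mono integrable_lebesgue_on_continuous ccf) (auto intro: mult_left_le)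
    finally show ?thesis .
  qed
  have I_d: "iter_integral M js (\<lambda>v. d v * g k v) 0 \<le> integral\<^sup>L (lebesgue_on (ball 0 r)) d" for k
  proof -
    have "iter_integral M js (\<lambda>v. d v * g k v) 0 = integral\<^sup>L lborel (\<lambda>v. d v * g k v)"
      using int_eq[OF cdg, of k] cd g g_out by auto
    also have "\<dots> = integral\<^sup>L (lebesgue_on (ball 0 r)) (\<lambda>v. d v * g k v)"
      using cdg g_out by (intro integral_lebesgue_on_eq_lborel[symmetric] borel_measurable_continuous_onI) auto
    also have "\<dots> \<le> integral\<^sup>L (lebesgue_on (ball 0 r)) d"
      using g cd by (intro integral_mono integrable_lebesgue_on_continuous cdg) (auto intro: mult_left_le)
    finally show ?thesis .
  qed
  have "integral\<^sup>L lborel \<phi> \<le> integral\<^sup>L lborel (\<lambda>u. K\<phi> * f u)"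
  proof (rule integral_mono)
    show "\<phi> u \<le> K\<phi> * f u" for u
      using K\<phi>[of u] f(4)[OF K(3), of u] f01[of u] order_trans[OF \<phi>(2)[of u] K\<phi>[of u]] by (cases "\<phi> u = 0") auto
  qed (use I_f I_\<phi> in auto)
  \<comment> \<open>Since \<phi> is at most a multiple of \<open>f\<close>, its positive integral
    forces \<open>f\<close> to have positive mass.\<close>
  then have "0 < K\<phi> * a" using True by (simp add: a_def)
  moreover have "0 \<le> a" unfolding a_def using f01 by simp
  ultimately have a: "0 < a" by (auto simp: zero_less_mult_iff)
  have "a \<le> integral\<^sup>L lborel (indicator \<Omega>)"
    unfolding a_def
  proof (rule integral_mono)
    show "integrable lborel (indicator \<Omega> :: 'a \<Rightarrow> real)"
      using \<Omega> by (auto intro!: integrable_real_indicator emeasure_bounded_finite)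
    show "f u \<le> indicator \<Omega> u" for u using f f01 by (cases "u \<in> \<Omega>") auto
  qed (use I_f in auto)
  then have aV: "a \<le> V" using V\<Omega> by simp
  have "b \<longlonglongrightarrow> integral\<^sup>L lborel (indicator (ball (0::'a) r))"
    unfolding b_def
  proof (rule integral_dominated_convergence[where w = "indicator (ball (0::'a) r)"])
    show "AE v in lborel. (\<lambda>k. g k v) \<longlonglongrightarrow> indicator (ball 0 r) v"
    proof (intro AE_I2)
      fix v :: 'a
      show "(\<lambda>k. g k v) \<longlonglongrightarrow> indicator (ball 0 r) v"
      proof (cases "v \<in> ball 0 r")
        case True
        then have pos: "0 < r - norm v" by simp
        obtain N :: nat where N: "1 < real N * (r - norm v)" using reals_Archimedean3[OF pos] by blast
        have "g k v = 1" if "N \<le> k" for k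
        proof -
          have "real N * (r - norm v) \<le> real (Suc k) * (r - norm v)"
            using pos that by (intro mult_right_mono) auto
          then have "1 < real (Suc k) * (r - norm v)" using N by (rule less_le_trans[rotated])
          then have "1 \<le> real (Suc k) * max 0 (r - norm v)"
            using pos by (simp only: max_absorb2 less_imp_le)
          then show ?thesis unfolding g_def by (rule min_absorb1)
        qed
        then have "\<forall>\<^sub>F k in sequentially. g k v = 1"
          using eventually_sequentially by blast
        then show ?thesis using True by (simp add: tendsto_eventually)
      next
        case False
        then show ?thesis using g_out by simp
      qed
    qed
    show "AE v in lborel. norm (g k v) \<le> indicator (ball 0 r) v" for k
    proof (intro AE_I2)
      show "norm (g k v) \<le> indicator (ball 0 r) v" for v
        using g(2,3)[of k v] g_out[of v k] by (cases "v \<in> ball 0 r") auto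
    qed
    show "integrable lborel (indicator (ball (0::'a) r) :: 'a \<Rightarrow> real)"
      by (intro integrable_real_indicator emeasure_bounded_finite) auto
    then show "(indicator (ball 0 r) :: 'a \<Rightarrow> real) \<in> borel_measurable lborel"
      by (rule borel_measurable_integrable)
  qed (use I_g in auto)
  then have b: "b \<longlonglongrightarrow> V" by (simp add: V_def)
  then have b_pos: "\<forall>\<^sub>F k in sequentially. 0 < b k"
    using order_tendstoD(1) V by blast
  let ?C = "integral\<^sup>L (lebesgue_on \<Omega>) c" and ?D = "integral\<^sup>L (lebesgue_on (ball 0 r)) d"
  have D0: "0 \<le> ?D" using cd by simp
  have main: "(real DIM('a) + ln (b k / V)) * integral\<^sup>L lborel \<phi> \<le> ?C + V / b k * ?D" if bk: "0 < b k" for k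
  proof -
    have "(real (length js) + ln (iter_integral M js (g k) 0 / iter_integral M js f 0))
            * iter_integral M js \<phi> 0 / iter_integral M js f 0
         \<le> iter_integral M js (\<lambda>u. c u * f u) 0 / iter_integral M js f 0
           + iter_integral M js (\<lambda>v. d v * g k v) 0 / iter_integral M js (g k) 0"
    proof (rule iterated_transport_inequality[where D = D and K\<phi> = K\<phi> and KD = KD and Kc = Kc])
      show "convex {v. 0 < g k v}" by (simp only: g_pos Collect_mem_eq convex_ball)
    qed (use M f f01 g \<phi> K K\<phi> KD Kc cd js D \<phi>_out outside g_out duality a bk I_f I_g in auto)
    then have "(real DIM('a) + ln (b k / a)) * integral\<^sup>L lborel \<phi> / a \<le> ?C / a + ?D / b k"
      using I_f I_g I_\<phi> divide_right_mono[OF I_c, of a] divide_right_mono[OF I_d[of k], of "b k"] a bk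
        distinct_card[OF js(1)] js(2) by simp
    from mult_left_mono[OF this, of a]
    have "(real DIM('a) + ln (b k / a)) * integral\<^sup>L lborel \<phi> \<le> ?C + a / b k * ?D"
      using a by (simp add: distrib_left)
    \<comment> \<open>Replacing a by the larger V decreases the logarithm on the left and increases
      the factor of \<open>?D\<close> on the right, so the estimate survives.\<close>
    moreover have "(real DIM('a) + ln (b k / V)) * integral\<^sup>L lborel \<phi>
        \<le> (real DIM('a) + ln (b k / a)) * integral\<^sup>L lborel \<phi>"
      using a aV bk True V by (intro mult_right_mono add_left_mono ln_mono) (auto intro!: divide_left_mono)
    moreover have "a / b k * ?D \<le> V / b k * ?D"
      using aV bk D0 by (intro mult_right_mono divide_right_mono) auto
    ultimately show ?thesis by linarith
  qed
  have "(\<lambda>k. (real DIM('a) + ln (b k / V)) * integral\<^sup>L lborel \<phi>)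
      \<longlonglongrightarrow> (real DIM('a) + ln (V / V)) * integral\<^sup>L lborel \<phi>"
    using V by (intro tendsto_intros b) auto
  moreover have "(\<lambda>k. ?C + V / b k * ?D) \<longlonglongrightarrow> ?C + V / V * ?D"
    using V by (intro tendsto_intros b) auto
  moreover have "\<forall>\<^sub>F k in sequentially. (real DIM('a) + ln (b k / V)) * integral\<^sup>L lborel \<phi> \<le> ?C + V / b k * ?D"
    using b_pos by eventually_elim (rule main)
  ultimately have "(real DIM('a) + ln (V / V)) * integral\<^sup>L lborel \<phi> \<le> ?C + V / V * ?D"
    by (intro tendsto_le[OF sequentially_bot])
  then show ?thesis using V by simp
qed

section \<open>Classical gradients\<close>

definition grad :: "('a::euclidean_space \<Rightarrow> real) \<Rightarrow> 'a \<Rightarrow> 'a" where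
  "grad f x = (\<Sum>b\<in>Basis. partial b f x *\<^sub>R b)"

lemma inner_grad: "b \<in> Basis \<Longrightarrow> grad f x \<bullet> b = partial b f x"
  by (simp add: grad_def inner_sum_left inner_Basis if_distrib cong: if_cong)

lemma Ck_1_has_derivative:
  assumes "Ck (Suc k) f"
  shows "(f has_derivative (\<lambda>h. grad f x \<bullet> h)) (at x)"
proof -
  note d = Ck_Suc_has_derivative[OF assms, of x]
  have "frechet_derivative f (at x) h = grad f x \<bullet> h" for h
  proof -
    have "frechet_derivative f (at x) h = (\<Sum>b\<in>Basis. (h \<bullet> b) * frechet_derivative f (at x) b)"
      using Linear_Algebra.linear_componentwise[OF has_derivative_linear[OF d], of h 1] by simp
    also have "\<dots> = grad f x \<bullet> h"
      unfolding grad_def inner_sum_left by (intro sum.cong) (auto simp: partial_def inner_commute)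
    finally show ?thesis .
  qed
  then show ?thesis using d by presburger
qed

lemma continuous_partial: "Ck (Suc k) f \<Longrightarrow> b \<in> Basis \<Longrightarrow> continuous_on UNIV (partial b f)"
  by (auto intro: Ck_continuous)

lemma continuous_grad: "Ck (Suc k) f \<Longrightarrow> continuous_on UNIV (grad f)"
  unfolding grad_def by (intro continuous_intros continuous_partial)

lemma partial_directional_derivative:
  assumes "Ck (Suc k) f" "b \<in> Basis"
  shows "((\<lambda>s. f (x + s *\<^sub>R b)) has_real_derivative partial b f (x + s *\<^sub>R b)) (at s)"
proof -
  have "((\<lambda>s. x + s *\<^sub>R b) has_derivative (\<lambda>h. h *\<^sub>R b)) (at s)"
    by (auto intro!: derivative_eq_intros)
  from has_derivative_compose[OF this Ck_1_has_derivative[OF assms(1)]]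
  show ?thesis
    using assms(2) by (simp add: has_field_derivative_def inner_grad mult_commute_abs)
qed

lemma compactly_supported_inD:
  assumes "compactly_supported_in f \<Omega>" "x \<notin> \<Omega>"
  shows "f x = 0"
  using assms closure_subset[of "{x. f x \<noteq> 0}"] by (auto simp: compactly_supported_in_def)

lemma partial_eq_0:
  assumes "x \<notin> closure {x. f x \<noteq> 0}"
  shows "partial b f x = 0"
proof -
  have "(f has_derivative (\<lambda>_. 0)) (at x)"
  proof (rule has_derivative_transform_within_open[where f = "\<lambda>_. 0"])
    show "open (- closure {x. f x \<noteq> 0})" by (simp add: open_Compl)
    show "0 = f y" if "y \<in> - closure {x. f x \<noteq> 0}" for y
      using that closure_subset[of "{x. f x \<noteq> 0}"] by auto
  qed (use assms in auto)
  then show ?thesis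
    by (simp add: partial_def frechet_derivative_at[symmetric])
qed

text \<open>The transport inequality asks for a nonnegative function, whereas test functions have no
  sign. This is a C^1 substitute for the positive part, off by less than \<epsilon> and with slope
  in [0, 1), so that gradients do not grow.\<close>

definition smooth_pos_part :: "real \<Rightarrow> real \<Rightarrow> real" where
  "smooth_pos_part \<epsilon> t = (max 0 t)\<^sup>2 / (max 0 t + \<epsilon>)"

text \<open>For positive t the function above equals
  \<open>t - \<epsilon> + \<epsilon>\<^sup>2 / (t + \<epsilon>)\<close>, which explains this
  formula.\<close>

definition smooth_pos_part' :: "real \<Rightarrow> real \<Rightarrow> real" where
  "smooth_pos_part' \<epsilon> t = 1 - (\<epsilon> / (max 0 t + \<epsilon>))\<^sup>2"

lemma smooth_pos_part_props:
  assumes "0 < \<epsilon>"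
  shows "0 \<le> smooth_pos_part \<epsilon> t" "t - \<epsilon> \<le> smooth_pos_part \<epsilon> t"
    and "0 \<le> smooth_pos_part' \<epsilon> t" "smooth_pos_part' \<epsilon> t \<le> 1"
    and "smooth_pos_part \<epsilon> t = 0 \<Longrightarrow> smooth_pos_part' \<epsilon> t = 0"
    and "continuous_on UNIV (smooth_pos_part \<epsilon>)" "continuous_on UNIV (smooth_pos_part' \<epsilon>)"
proof -
  have pos: "0 < max 0 t + \<epsilon>" for t using assms by linarith
  show "0 \<le> smooth_pos_part \<epsilon> t" using pos[of t] by (simp add: smooth_pos_part_def)
  have "max 0 t - \<epsilon> \<le> smooth_pos_part \<epsilon> t"
  proof -
    have "(max 0 t - \<epsilon>) * (max 0 t + \<epsilon>) \<le> (max 0 t)\<^sup>2"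
      by (simp add: algebra_simps power2_eq_square)
    then show ?thesis using pos[of t] by (simp add: smooth_pos_part_def pos_le_divide_eq)
  qed
  then show "t - \<epsilon> \<le> smooth_pos_part \<epsilon> t" by linarith
  have "\<epsilon> / (max 0 t + \<epsilon>) \<le> 1" "0 \<le> \<epsilon> / (max 0 t + \<epsilon>)" using assms pos[of t] by simp_all
  then have "(\<epsilon> / (max 0 t + \<epsilon>))\<^sup>2 \<le> 1" by (simp add: power_le_one)
  then show "0 \<le> smooth_pos_part' \<epsilon> t" "smooth_pos_part' \<epsilon> t \<le> 1"
    by (simp_all add: smooth_pos_part'_def)
  show "smooth_pos_part \<epsilon> t = 0 \<Longrightarrow> smooth_pos_part' \<epsilon> t = 0"
    using pos[of t] assms by (auto simp: smooth_pos_part_def smooth_pos_part'_def)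
  show "continuous_on UNIV (smooth_pos_part \<epsilon>)" "continuous_on UNIV (smooth_pos_part' \<epsilon>)"
    unfolding smooth_pos_part_def smooth_pos_part'_def using pos
    by (auto intro!: continuous_intros simp: less_imp_neq[THEN not_sym])
qed

lemma smooth_pos_part_deriv:
  assumes "0 < \<epsilon>"
  shows "(smooth_pos_part \<epsilon> has_real_derivative smooth_pos_part' \<epsilon> t) (at t)"
proof -
  consider "t > 0" | "t < 0" | "t = 0" by linarith
  then show ?thesis
  proof cases
    case 1
    have "((\<lambda>t. t\<^sup>2 / (t + \<epsilon>)) has_real_derivative (2 * t * (t + \<epsilon>) - t\<^sup>2) / (t + \<epsilon>)\<^sup>2) (at t)"
      using 1 assms by (auto intro!: derivative_eq_intros simp: power2_eq_square)
    moreover have "(2 * t * (t + \<epsilon>) - t\<^sup>2) / (t + \<epsilon>)\<^sup>2 = smooth_pos_part' \<epsilon> t"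
      using 1 assms by (simp add: smooth_pos_part'_def power_divide divide_simps) (simp add: power2_eq_square algebra_simps)
    moreover have "\<forall>\<^sub>F s in nhds t. s\<^sup>2 / (s + \<epsilon>) = smooth_pos_part \<epsilon> s"
      using eventually_nhds_in_open[of "{0<..}" t] 1
      by (auto elim!: eventually_mono simp: smooth_pos_part_def)
    ultimately show ?thesis
      using DERIV_cong_ev[OF refl _ refl, of "\<lambda>t. t\<^sup>2 / (t + \<epsilon>)" "smooth_pos_part \<epsilon>" t] by simp
  next
    case 2
    have "\<forall>\<^sub>F s in nhds t. 0 = smooth_pos_part \<epsilon> s"
      using eventually_nhds_in_open[of "{..<0}" t] 2
      by (auto elim!: eventually_mono simp: smooth_pos_part_def)
    then show ?thesis
      using 2 assms DERIV_cong_ev[OF refl _ refl, of "\<lambda>_. 0" "smooth_pos_part \<epsilon>" t 0]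
      by (auto simp: smooth_pos_part'_def)
  next
    case 3
    have "((\<lambda>h. max 0 h * (max 0 h / h) / (max 0 h + \<epsilon>)) \<longlongrightarrow> 0) (at 0)"
    proof (rule Lim_null_comparison[where g = "\<lambda>h. \<bar>h\<bar> / \<epsilon>"])
      have "\<bar>max 0 h * (max 0 h / h) / (max 0 h + \<epsilon>)\<bar> \<le> \<bar>h\<bar> / \<epsilon>" if "h \<noteq> 0" for h
      proof (cases "0 < h")
        case True
        then have "h / (h + \<epsilon>) \<le> h / \<epsilon>" using assms by (intro divide_left_mono) auto
        then show ?thesis using True assms by simp
      qed (use assms in \<open>auto simp: max_def divide_nonpos_pos\<close>)
      then show "\<forall>\<^sub>F h in at 0. norm (max 0 h * (max 0 h / h) / (max 0 h + \<epsilon>)) \<le> \<bar>h\<bar> / \<epsilon>"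
        by (simp add: eventually_at_filter)
      show "((\<lambda>h. \<bar>h\<bar> / \<epsilon>) \<longlongrightarrow> 0) (at 0)"
        using assms by (auto intro!: tendsto_eq_intros)
    qed
    then have "((\<lambda>h. (smooth_pos_part \<epsilon> (0 + h) - smooth_pos_part \<epsilon> 0) / h) \<longlongrightarrow> 0) (at 0)"
      by (simp add: smooth_pos_part_def power2_eq_square mult.commute)
    then show ?thesis unfolding 3 DERIV_def using assms by (simp add: smooth_pos_part'_def)
  qed
qed

text \<open>The convex envelope of \<open>p \<mapsto> p\<^sup>2/2 + \<Lambda> [p \<noteq> 0]\<close> on \<open>p \<ge> 0\<close>, with \<open>\<kappa> = sqrt (2 \<Lambda>)\<close>,
  and its Legendre transform.\<close>

definition energy_envelope :: "real \<Rightarrow> real \<Rightarrow> real" where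
  "energy_envelope \<kappa> p = \<kappa> * p + (max 0 (p - \<kappa>))\<^sup>2 / 2"

definition energy_dual :: "real \<Rightarrow> real \<Rightarrow> real" where
  "energy_dual \<kappa> q = max 0 ((q\<^sup>2 - \<kappa>\<^sup>2) / 2)"

text \<open>Below the threshold the linear part \<kappa> p suffices. Above it, Young's inequality
  for q - \<kappa> and the positive part of p - \<kappa> gives the claim, because \<kappa> (q -
  \<kappa>) + (q - \<kappa>)^2/2 = (q^2 - \<kappa>^2)/2.\<close>

lemma energy_fenchel:
  assumes "0 \<le> \<kappa>" "0 \<le> p" "0 \<le> q"
  shows "p * q \<le> energy_envelope \<kappa> p + energy_dual \<kappa> q"
proof (cases "q \<le> \<kappa>")
  case True
  then have "p * q \<le> \<kappa> * p" using assms mult_left_mono[of q \<kappa> p] by (simp add: mult.commute)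
  moreover have "0 \<le> (max 0 (p - \<kappa>))\<^sup>2 / 2" "0 \<le> energy_dual \<kappa> q"
    by (simp_all add: energy_dual_def)
  ultimately show ?thesis unfolding energy_envelope_def by linarith
next
  case False
  define w where "w = q - \<kappa>"
  have "w * (p - \<kappa>) \<le> w * max 0 (p - \<kappa>)" using False by (intro mult_left_mono) (auto simp: w_def)
  also have "\<dots> \<le> w\<^sup>2 / 2 + (max 0 (p - \<kappa>))\<^sup>2 / 2"
    using sum_squares_bound[of w "max 0 (p - \<kappa>)"] by simp
  finally have "p * q \<le> energy_envelope \<kappa> p + (q\<^sup>2 - \<kappa>\<^sup>2) / 2"
    by (simp add: w_def energy_envelope_def power2_eq_square field_simps)
  then show ?thesis by (simp add: energy_dual_def)
qed

text \<open>For nonzero p the gap is half the difference between (p - \<kappa>)^2 and the square of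
  its positive part. The jump \<kappa>^2/2 is \<Lambda>.\<close>

lemma energy_envelope_le:
  assumes "0 \<le> \<kappa>" "0 \<le> p"
  shows "energy_envelope \<kappa> p \<le> p\<^sup>2 / 2 + (if p = 0 then 0 else \<kappa>\<^sup>2 / 2)"
proof (cases "p = 0")
  case True
  then show ?thesis using assms by (simp add: energy_envelope_def)
next
  case False
  have "(max 0 (p - \<kappa>))\<^sup>2 \<le> (p - \<kappa>)\<^sup>2" by (simp add: max_def)
  then show ?thesis using False by (simp add: energy_envelope_def power2_eq_square field_simps)
qed

text \<open>Quantitative continuity for the passage to H^1 limits: p is the norm of the limit
  gradient and h that of the error. The coefficient \<kappa> + p is square integrable, so the mixed
  term can be split by Young's inequality.\<close>

lemma energy_envelope_add_le:
  assumes "0 \<le> \<kappa>" "0 \<le> p" "0 \<le> h" "0 \<le> q" "q \<le> p + h"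
  shows "energy_envelope \<kappa> q \<le> energy_envelope \<kappa> p + (\<kappa> + p) * h + h\<^sup>2 / 2"
proof -
  have "max 0 (q - \<kappa>) \<le> max 0 (p - \<kappa>) + h" using assms by linarith
  then have "(max 0 (q - \<kappa>))\<^sup>2 \<le> (max 0 (p - \<kappa>) + h)\<^sup>2" by (intro power_mono) auto
  moreover have "max 0 (p - \<kappa>) * h \<le> p * h" using assms by (intro mult_right_mono) auto
  moreover have "\<kappa> * q \<le> \<kappa> * p + \<kappa> * h" using assms by (simp flip: distrib_left add: mult_left_mono)
  ultimately show ?thesis
    by (simp add: energy_envelope_def power2_eq_square algebra_simps)
qed

lemma energy_nonneg: "0 \<le> \<kappa> \<Longrightarrow> 0 \<le> p \<Longrightarrow> 0 \<le> energy_envelope \<kappa> p" "0 \<le> energy_dual \<kappa> q"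
  by (auto simp: energy_envelope_def energy_dual_def)

text \<open>The transport inequality is applied to the smoothed positive part of \<phi> with the two
  sides of Fenchel's inequality, both multiplied by n, as potentials. The factor n then cancels.
  Dropping the negative part of \<phi> only helps, and the smoothing costs \<epsilon>
  |\<Omega>|.\<close>

lemma integral_le_envelope_dual:
  fixes \<phi> :: "'a::euclidean_space \<Rightarrow> real"
  assumes \<Omega>: "open \<Omega>" "bounded \<Omega>" and r: "0 < r"
    and vol: "measure lebesgue (ball (0::'a) r) = measure lebesgue \<Omega>"
    and \<phi>: "Ck (Suc 0) \<phi>" "compactly_supported_in \<phi> \<Omega>" and \<kappa>: "0 \<le> \<kappa>"
  shows "integral\<^sup>L (lebesgue_on \<Omega>) \<phi> \<le> integral\<^sup>L (lebesgue_on \<Omega>) (\<lambda>x. energy_envelope \<kappa> (norm (grad \<phi> x)))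
    + integral\<^sup>L (lebesgue_on (ball 0 r)) (\<lambda>y::'a. energy_dual \<kappa> (norm y / DIM('a)))"
    (is "_ \<le> ?E + ?T")
proof (rule field_le_epsilon)
  fix e :: real assume e: "0 < e"
  \<comment> \<open>The summand 1 keeps the quotient meaningful when \<Omega> has measure
    zero.\<close>
  define \<epsilon> where "\<epsilon> = e / (measure lebesgue \<Omega> + 1)"
  have \<epsilon>: "0 < \<epsilon>" "\<epsilon> * measure lebesgue \<Omega> \<le> e"
    using e by (auto simp: \<epsilon>_def field_simps add_pos_nonneg intro!: divide_pos_pos)
  note props = smooth_pos_part_props[OF \<epsilon>(1)]
  define \<psi> where "\<psi> x = smooth_pos_part \<epsilon> (\<phi> x)" for x
  define D where "D b x = smooth_pos_part' \<epsilon> (\<phi> x) * partial b \<phi> x" for b x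
  have c\<phi>: "continuous_on UNIV \<phi>" using \<phi>(1) by (rule Ck_continuous)
  have c\<psi>: "continuous_on UNIV \<psi>"
    unfolding \<psi>_def by (rule continuous_on_compose2[OF props(6) c\<phi>]) auto
  have s\<psi>: "compactly_supported_in \<psi> \<Omega>"
  proof -
    have "{x. \<psi> x \<noteq> 0} \<subseteq> {x. \<phi> x \<noteq> 0}" by (auto simp: \<psi>_def smooth_pos_part_def)
    then have "closure {x. \<psi> x \<noteq> 0} \<subseteq> closure {x. \<phi> x \<noteq> 0}" by (rule closure_mono)
    moreover from this have "compact (closure {x. \<psi> x \<noteq> 0})"
      using \<phi>(2) closed_Int_compact[of "closure {x. \<psi> x \<noteq> 0}" "closure {x. \<phi> x \<noteq> 0}"]
      by (simp add: compactly_supported_in_def Int_absorb2)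
    ultimately show ?thesis using \<phi>(2) by (auto simp: compactly_supported_in_def)
  qed
  have cE: "continuous_on UNIV (\<lambda>x. energy_envelope \<kappa> (norm (grad \<phi> x)))"
    unfolding energy_envelope_def by (intro continuous_intros continuous_grad[OF \<phi>(1)]) auto
  have cT: "continuous_on UNIV (\<lambda>y::'a. energy_dual \<kappa> (norm y / DIM('a)))"
    unfolding energy_dual_def by (intro continuous_intros) auto
  have "real DIM('a) * integral\<^sup>L lborel \<psi>
      \<le> integral\<^sup>L (lebesgue_on \<Omega>) (\<lambda>x. real DIM('a) * energy_envelope \<kappa> (norm (grad \<phi> x)))
       + integral\<^sup>L (lebesgue_on (ball 0 r)) (\<lambda>y::'a. real DIM('a) * energy_dual \<kappa> (norm y / DIM('a)))"
  proof (rule gradient_transport_inequality[OF \<Omega> r vol c\<psi> _ s\<psi>, where D = D])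
    show "0 \<le> \<psi> u" for u using props by (simp add: \<psi>_def)
    fix j :: 'a assume j: "j \<in> Basis"
    show "continuous_on UNIV (D j)"
      unfolding D_def using continuous_partial[OF \<phi>(1) j]
      by (intro continuous_intros continuous_on_compose2[OF props(7) c\<phi>]) auto
    show "D j u = 0" if "\<psi> u = 0" for u using props(5) that by (simp add: \<psi>_def D_def)
    show "((\<lambda>s. \<psi> (x + s *\<^sub>R j)) has_real_derivative D j (x + s *\<^sub>R j)) (at s)" for x s
      unfolding \<psi>_def D_def
      by (rule DERIV_chain2[OF smooth_pos_part_deriv[OF \<epsilon>(1)] partial_directional_derivative[OF \<phi>(1) j]])
  next
    fix u v :: 'a
    have "- (\<Sum>j\<in>Basis. D j u * (v \<bullet> j)) = - (smooth_pos_part' \<epsilon> (\<phi> u) * (grad \<phi> u \<bullet> v))"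
      unfolding D_def grad_def inner_sum_left sum_distrib_left
      by (intro arg_cong[of _ _ uminus] sum.cong) (auto simp: inner_commute)
    also have "\<dots> \<le> smooth_pos_part' \<epsilon> (\<phi> u) * (norm (grad \<phi> u) * norm v)"
      using mult_left_mono[of "- (grad \<phi> u \<bullet> v)" "norm (grad \<phi> u) * norm v" "smooth_pos_part' \<epsilon> (\<phi> u)"]
        Cauchy_Schwarz_ineq2[of "grad \<phi> u" v] props(3)[of "\<phi> u"] by simp
    also have "\<dots> \<le> norm (grad \<phi> u) * norm v"
      using props(3,4)[of "\<phi> u"] by (intro mult_left_le_one_le) auto
    also have "\<dots> = real DIM('a) * (norm (grad \<phi> u) * (norm v / DIM('a)))" by simp
    also have "\<dots> \<le> real DIM('a) * (energy_envelope \<kappa> (norm (grad \<phi> u)) + energy_dual \<kappa> (norm v / DIM('a)))"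
      using \<kappa> by (intro mult_left_mono energy_fenchel) auto
    finally show "- (\<Sum>j\<in>Basis. D j u * (v \<bullet> j)) \<le> real DIM('a) * energy_envelope \<kappa> (norm (grad \<phi> u))
        + real DIM('a) * energy_dual \<kappa> (norm v / DIM('a))"
      by (simp add: distrib_left)
  qed (use \<kappa> in \<open>auto intro!: continuous_intros cE cT energy_nonneg mult_nonneg_nonneg\<close>)
  then have "real DIM('a) * integral\<^sup>L lborel \<psi> \<le> real DIM('a) * (?E + ?T)"
    by (simp add: distrib_left)
  then have "integral\<^sup>L lborel \<psi> \<le> ?E + ?T" by simp
  moreover have "integral\<^sup>L (lebesgue_on \<Omega>) \<phi> \<le> integral\<^sup>L (lebesgue_on \<Omega>) (\<lambda>x. \<psi> x + \<epsilon>)"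
    using \<Omega> props(2) c\<phi> c\<psi>
    by (intro integral_mono integrable_lebesgue_on_continuous continuous_intros) (auto simp: \<psi>_def algebra_simps)
  moreover have "integral\<^sup>L (lebesgue_on \<Omega>) (\<lambda>x. \<psi> x + \<epsilon>) = integral\<^sup>L lborel \<psi> + \<epsilon> * measure lebesgue \<Omega>"
  proof -
    have "integral\<^sup>L (lebesgue_on \<Omega>) (\<lambda>x. \<psi> x + \<epsilon>)
        = integral\<^sup>L (lebesgue_on \<Omega>) \<psi> + integral\<^sup>L (lebesgue_on \<Omega>) (\<lambda>x. \<epsilon>)"
      using \<Omega> c\<psi> by (intro Bochner_Integration.integral_add integrable_lebesgue_on_continuous) auto
    also have "integral\<^sup>L (lebesgue_on \<Omega>) \<psi> = integral\<^sup>L lborel \<psi>"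
      using \<Omega> c\<psi> compactly_supported_inD[OF s\<psi>]
      by (intro integral_lebesgue_on_eq_lborel borel_measurable_continuous_onI) auto
    also have "integral\<^sup>L (lebesgue_on \<Omega>) (\<lambda>x. \<epsilon>) = \<epsilon> * measure lebesgue \<Omega>"
      using \<Omega> by (simp add: measure_restrict_space)
    finally show ?thesis .
  qed
  ultimately show "integral\<^sup>L (lebesgue_on \<Omega>) \<phi> \<le> ?E + ?T + e"
    using \<epsilon>(2) by linarith
qed

section \<open>Weak gradients\<close>

lemma translation_invariant_integral:
  fixes f :: "'a::euclidean_space \<Rightarrow> real"
  assumes "f \<in> borel_measurable borel"
  shows "integral\<^sup>L lborel (\<lambda>x. f (x + c)) = integral\<^sup>L lborel f"
proof -
  have "integral\<^sup>L lborel f = integral\<^sup>L (distr lborel borel ((+) c)) f"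
    by (simp add: lborel_distr_plus)
  also have "\<dots> = integral\<^sup>L lborel (\<lambda>x. f (c + x))"
    using assms by (intro integral_distr) auto
  finally show ?thesis by (simp add: add.commute)
qed

lemma bounded_of_compact_support:
  fixes f :: "'a::euclidean_space \<Rightarrow> real"
  assumes "continuous_on UNIV f" "compact K" "\<And>x. x \<notin> K \<Longrightarrow> f x = 0"
  obtains C where "0 \<le> C" "\<And>x. \<bar>f x\<bar> \<le> C"
proof -
  have "bounded (f ` K)"
    by (intro compact_imp_bounded compact_continuous_image assms continuous_on_subset[OF assms(1)]) auto
  then obtain C where C: "\<And>x. x \<in> K \<Longrightarrow> \<bar>f x\<bar> \<le> C" by (auto simp: bounded_iff)
  have "\<bar>f x\<bar> \<le> max C 0" for x
    using C[of x] assms(3)[of x] by (cases "x \<in> K") auto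
  then show ?thesis by (intro that[of "max C 0"]) auto
qed

text \<open>Difference quotients integrate to zero by translation invariance and converge
  dominatedly: the mean value theorem bounds them by the maximum of the partial derivative, and step
  sizes of at most 1 keep their supports in \<open>cball 0 (B + 1)\<close>.\<close>

lemma integral_partial_eq_0:
  fixes u :: "'a::euclidean_space \<Rightarrow> real"
  assumes u: "Ck (Suc 0) u" "compactly_supported_in u UNIV" and b: "b \<in> Basis"
  shows "integral\<^sup>L lborel (partial b u) = 0"
proof -
  define K where "K = closure {x. u x \<noteq> 0}"
  have K: "compact K" using u(2) by (simp add: compactly_supported_in_def K_def)
  have uK: "u x = 0" if "x \<notin> K" for x using that closure_subset[of "{x. u x \<noteq> 0}"] by (auto simp: K_def)
  have pK: "partial b u x = 0" if "x \<notin> K" for x using partial_eq_0 that by (auto simp: K_def)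
  obtain C where C: "0 \<le> C" "\<And>x. \<bar>partial b u x\<bar> \<le> C"
    using bounded_of_compact_support[OF continuous_partial[OF u(1) b] K pK] by blast
  obtain B where B: "\<And>x. x \<in> K \<Longrightarrow> norm x \<le> B" using compact_imp_bounded[OF K] by (auto simp: bounded_iff)
  have cu: "continuous_on UNIV u" using u(1) by (rule Ck_continuous)
  have um: "u \<in> borel_measurable borel" using cu by (rule borel_measurable_continuous_onI)
  have ui: "integrable lborel u"
  proof -
    have "integrable lborel (\<lambda>x. indicator K x *\<^sub>R u x)"
      using K by (intro borel_integrable_compact continuous_on_subset[OF cu]) auto
    moreover have "(\<lambda>x. indicator K x *\<^sub>R u x) = u" using uK by (auto simp: fun_eq_iff indicator_def)
    ultimately show ?thesis by simp
  qed
  define h where "h k = inverse (real (Suc k))" for k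
  have h: "0 < h k" "h k \<le> 1" for k by (auto simp: h_def field_simps)
  define q where "q k x = (u (x + h k *\<^sub>R b) - u x) / h k" for k x
  have "(\<lambda>k. integral\<^sup>L lborel (q k)) \<longlonglongrightarrow> integral\<^sup>L lborel (partial b u)"
  proof (rule integral_dominated_convergence[where w = "\<lambda>x. C * indicator (cball 0 (B + 1)) x"])
    show "partial b u \<in> borel_measurable lborel"
      using continuous_partial[OF u(1) b] by (simp add: borel_measurable_continuous_onI)
    have "continuous_on UNIV (q k)" for k
      unfolding q_def using h(1)[of k]
      by (intro continuous_intros continuous_on_compose2[OF cu] cu) auto
    then show "q k \<in> borel_measurable lborel" for k
      by (simp add: borel_measurable_continuous_onI)
    show "integrable lborel (\<lambda>x. C * indicator (cball (0::'a) (B + 1)) x)"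
      by (intro integrable_mult_right integrable_real_indicator emeasure_bounded_finite) auto
    show "AE x in lborel. (\<lambda>k. q k x) \<longlonglongrightarrow> partial b u x"
    proof (intro AE_I2)
      fix x
      have "((\<lambda>s. u (x + s *\<^sub>R b)) has_real_derivative partial b u x) (at 0)"
        using partial_directional_derivative[OF u(1) b, of x 0] by simp
      then have "((\<lambda>s. (u (x + s *\<^sub>R b) - u x) / s) \<longlongrightarrow> partial b u x) (at 0)"
        by (simp add: DERIV_def)
      moreover have "filterlim h (at 0) sequentially"
        unfolding h_def filterlim_at using LIMSEQ_inverse_real_of_nat by (auto simp del: of_nat_Suc)
      ultimately show "(\<lambda>k. q k x) \<longlonglongrightarrow> partial b u x"
        unfolding q_def by (rule filterlim_compose)
    qed
    show "AE x in lborel. norm (q k x) \<le> C * indicator (cball 0 (B + 1)) x" for k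
    proof (intro AE_I2)
      fix x
      show "norm (q k x) \<le> C * indicator (cball 0 (B + 1)) x"
      proof (cases "x \<in> cball 0 (B + 1)")
        case True
        obtain z where "u (x + h k *\<^sub>R b) - u (x + 0 *\<^sub>R b) = (h k - 0) * partial b u (x + z *\<^sub>R b)"
          using MVT2[OF h(1)[of k], of "\<lambda>s. u (x + s *\<^sub>R b)" "\<lambda>s. partial b u (x + s *\<^sub>R b)"]
            partial_directional_derivative[OF u(1) b] by blast
        then have "q k x = partial b u (x + z *\<^sub>R b)" using h(1)[of k] by (simp add: q_def)
        then show ?thesis using True C(2) by simp
      next
        case False
        then have "norm x > B + 1" by simp
        moreover have "norm x \<le> norm (x + h k *\<^sub>R b) + norm (h k *\<^sub>R b)"
          using norm_triangle_ineq4[of "x + h k *\<^sub>R b" "h k *\<^sub>R b"] by simp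
        ultimately have "B < norm x" "B < norm (x + h k *\<^sub>R b)"
          using h[of k] b by auto
        then have "u x = 0" "u (x + h k *\<^sub>R b) = 0" using B uK by force+
        then show ?thesis using C(1) by (simp add: q_def)
      qed
    qed
  qed
  moreover have "integral\<^sup>L lborel (q k) = 0" for k
  proof -
    have "integrable lborel (\<lambda>x. u (x + h k *\<^sub>R b))"
    proof -
      have "integrable (distr lborel borel ((+) (h k *\<^sub>R b))) u" using ui by (simp add: lborel_distr_plus)
      then show ?thesis using um by (subst (asm) integrable_distr_eq) (auto simp: add.commute)
    qed
    then show ?thesis
      using ui translation_invariant_integral[OF um] by (simp add: q_def[abs_def])
  qed
  ultimately show ?thesis by (simp add: LIMSEQ_const_iff)
qed

lemma test_functionsD:
  assumes "\<phi> \<in> test_functions \<Omega>"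
  shows "Ck k \<phi>" "compactly_supported_in \<phi> \<Omega>" "continuous_on UNIV \<phi>"
  using assms Ck_continuous[of k \<phi>] by (auto simp: test_functions_def smooth_def)

lemma partial_mult:
  assumes "Ck (Suc 0) f" "Ck (Suc 0) g" "b \<in> Basis"
  shows "partial b (\<lambda>x. f x * g x) x = f x * partial b g x + partial b f x * g x"
proof -
  have "((\<lambda>x. f x * g x) has_derivative (\<lambda>h. f x * (grad g x \<bullet> h) + (grad f x \<bullet> h) * g x)) (at x)"
    by (rule has_derivative_mult[OF assms(1,2)[THEN Ck_1_has_derivative]])
  from fun_cong[OF frechet_derivative_at[OF this], of b] show ?thesis
    using assms(3) by (simp add: partial_def[of b "\<lambda>x. f x * g x"] inner_grad)
qed

lemma L2_continuous:
  fixes f :: "'a::euclidean_space \<Rightarrow> 'b::euclidean_space"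
  assumes "continuous_on UNIV f" "bounded \<Omega>" "\<Omega> \<in> sets lebesgue"
  shows "f \<in> L2 \<Omega>"
  unfolding L2_def mem_Collect_eq
proof
  show "f \<in> borel_measurable (lebesgue_on \<Omega>)"
    using integrable_lebesgue_on_continuous[OF assms] by (rule borel_measurable_integrable)
  show "integrable (lebesgue_on \<Omega>) (\<lambda>x. (norm (f x))\<^sup>2)"
    by (intro integrable_lebesgue_on_continuous continuous_intros assms)
qed

lemma compactly_supported_in_mult:
  fixes f g :: "'a::euclidean_space \<Rightarrow> real"
  assumes "compactly_supported_in f \<Omega>"
  shows "compactly_supported_in (\<lambda>x. f x * g x) \<Omega>"
proof -
  have "closure {x. f x * g x \<noteq> 0} \<subseteq> closure {x. f x \<noteq> 0}" by (rule closure_mono) auto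
  moreover from this have "compact (closure {x. f x * g x \<noteq> 0})"
    using assms closed_Int_compact[of "closure {x. f x * g x \<noteq> 0}" "closure {x. f x \<noteq> 0}"]
    by (simp add: compactly_supported_in_def Int_absorb2)
  ultimately show ?thesis using assms by (auto simp: compactly_supported_in_def)
qed

lemma has_weak_gradient_test_function:
  fixes \<phi> :: "'a::euclidean_space \<Rightarrow> real"
  assumes \<Omega>: "open \<Omega>" "bounded \<Omega>" and \<phi>: "\<phi> \<in> test_functions \<Omega>"
  shows "has_weak_gradient \<Omega> \<phi> (grad \<phi>)"
  unfolding has_weak_gradient_def
proof (intro conjI ballI)
  have \<Omega>': "\<Omega> \<in> sets lebesgue" using \<Omega> by simp
  note \<phi>' = test_functionsD[OF \<phi>]
  show "\<phi> \<in> L2 \<Omega>" "grad \<phi> \<in> L2 \<Omega>"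
    using \<phi>' continuous_grad[of 0 \<phi>] \<Omega> \<Omega>' by (auto intro!: L2_continuous)
  fix \<theta> and b :: 'a assume \<theta>: "\<theta> \<in> test_functions \<Omega>" and b: "b \<in> Basis"
  note \<theta>' = test_functionsD[OF \<theta>]
  have cont: "continuous_on UNIV (\<lambda>x. \<phi> x * partial b \<theta> x)" "continuous_on UNIV (\<lambda>x. (grad \<phi> x \<bullet> b) * \<theta> x)"
    by (intro continuous_intros \<phi>' \<theta>' continuous_partial[of 0] continuous_grad[of 0] b)+
  have prod: "Ck (Suc 0) (\<lambda>x. \<phi> x * \<theta> x)" "compactly_supported_in (\<lambda>x. \<phi> x * \<theta> x) \<Omega>"
    by (intro Ck_mult \<phi>' \<theta>' compactly_supported_in_mult)+
  have "0 = integral\<^sup>L lborel (partial b (\<lambda>x. \<phi> x * \<theta> x))"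
    using integral_partial_eq_0[OF prod(1) _ b] prod(2) by (simp add: compactly_supported_in_def)
  also have "\<dots> = integral\<^sup>L lborel (\<lambda>x. \<phi> x * partial b \<theta> x + (grad \<phi> x \<bullet> b) * \<theta> x)"
    using partial_mult[OF \<phi>'(1) \<theta>'(1) b] b by (intro Bochner_Integration.integral_cong refl) (simp add: inner_grad)
  also have "\<dots> = (LINT x|lebesgue_on \<Omega>. \<phi> x * partial b \<theta> x + (grad \<phi> x \<bullet> b) * \<theta> x)"
    using compactly_supported_inD[OF \<phi>'(2)] compactly_supported_inD[OF \<theta>'(2)] \<Omega>'
    by (intro integral_lebesgue_on_eq_lborel[symmetric] borel_measurable_continuous_onI continuous_on_add cont) auto
  also have "\<dots> = (LINT x|lebesgue_on \<Omega>. \<phi> x * partial b \<theta> x) + (LINT x|lebesgue_on \<Omega>. (grad \<phi> x \<bullet> b) * \<theta> x)"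
    using cont \<Omega> \<Omega>' by (intro Bochner_Integration.integral_add integrable_lebesgue_on_continuous) auto
  finally show "(LINT x|lebesgue_on \<Omega>. \<phi> x * partial b \<theta> x) = - (LINT x|lebesgue_on \<Omega>. (grad \<phi> x \<bullet> b) * \<theta> x)"
    by simp
qed

section \<open>The fundamental lemma of the calculus of variations\<close>

text \<open>The Borel sets over which H integrates to zero form a Dynkin system, and open boxes are
  an intersection-stable generator.\<close>

lemma AE_zero_of_box_integrals:
  fixes H :: "'a::euclidean_space \<Rightarrow> real"
  assumes "integrable lborel H" "\<And>a b. (LINT x:box a b|lborel. H x) = 0"
  shows "AE x in lborel. H x = 0"
proof (rule density_unique_real[OF assms(1)])
  have si: "set_integrable lborel A H" if "A \<in> sets borel" for A
    unfolding set_integrable_def using integrable_mult_indicator[of A lborel H] that assms(1) by simp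
  \<comment> \<open>Exhausting the space by boxes gives total integral zero, which is what closure
    under complements requires.\<close>
  have "(\<lambda>n. LINT x:box (- (real n *\<^sub>R One)) (real n *\<^sub>R One)|lborel. H x)
      \<longlonglongrightarrow> (LINT x:(\<Union>n. box (- (real n *\<^sub>R One)) (real n *\<^sub>R One))|lborel. H x)"
    by (rule set_integral_cont_up)
       (use si in \<open>auto simp: incseq_def UN_box_eq_UNIV subset_box\<close>)
  then have UNIV: "integral\<^sup>L lborel H = 0"
    using assms(2) by (simp add: UN_box_eq_UNIV LIMSEQ_const_iff set_lebesgue_integral_def)
  fix A assume "A \<in> sets (lborel :: 'a measure)"
  then have A: "A \<in> sigma_sets UNIV (range (\<lambda>(a, b). box a b :: 'a set))"
    by (simp add: borel_eq_box)
  have "Int_stable (range (\<lambda>(a, b). box a b :: 'a set))"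
    by (auto simp: Int_stable_def box_Int_box)
  moreover have "range (\<lambda>(a, b). box a b :: 'a set) \<subseteq> Pow UNIV" by simp
  ultimately have "(LINT x:A|lborel. H x) = 0"
    using A
  proof (induction rule: sigma_sets_induct_disjoint)
    case (basic A)
    then show ?case using assms(2) by auto
  next
    case empty
    show ?case by (simp add: set_lebesgue_integral_def)
  next
    case (compl A)
    then have A: "A \<in> sets borel" by (simp add: borel_eq_box)
    have "(LINT x:UNIV|lborel. H x) = (LINT x:A \<union> (UNIV - A)|lborel. H x)" by simp
    also have "\<dots> = (LINT x:A|lborel. H x) + (LINT x:UNIV - A|lborel. H x)"
      using A by (intro set_integral_Un si) auto
    finally show ?case using compl(2) UNIV by (simp add: set_lebesgue_integral_def)
  next
    case (union F)
    then have F: "F i \<in> sets borel" for i by (auto simp: borel_eq_box)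
    have "(LINT x:(\<Union>i. F i)|lborel. H x) = (\<Sum>i. LINT x:F i|lborel. H x)"
      using F union(1) by (intro lebesgue_integral_countable_add si) (auto simp: disjoint_family_on_def)
    then show ?case using union(3) by simp
  qed
  then show "(LINT x:A|lborel. H x) = (LINT x:A|lborel. 0)" by (simp add: set_lebesgue_integral_def)
qed simp

text \<open>A Lebesgue measurable H agrees almost everywhere with a Borel function, to which the
  previous lemma applies.\<close>

lemma AE_lebesgue_zero_of_box_integrals:
  fixes H :: "'a::euclidean_space \<Rightarrow> real"
  assumes "integrable lebesgue H" "\<And>a b. (LINT x:box a b|lebesgue. H x) = 0"
  shows "AE x in lebesgue. H x = 0"
proof -
  obtain H' where H': "H' \<in> borel_measurable lborel" "AE x in lborel. H x = H' x"
    using completion_ex_borel_measurable_real[OF borel_measurable_integrable[OF assms(1)]] by blast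
  have ae: "AE x in lebesgue. H x = H' x" using H'(2) by (rule AE_completion)
  have "integrable lebesgue H'"
    using ae H'(1) by (intro integrable_cong_AE_imp[OF assms(1)]) (auto intro: measurable_completion)
  then have "integrable lborel H'" using H'(1) by (simp add: integrable_completion)
  moreover have "(LINT x:box a b|lborel. H' x) = 0" for a b
  proof -
    have "(LINT x:box a b|lborel. H' x) = (LINT x:box a b|lebesgue. H' x)"
      unfolding set_lebesgue_integral_def using H'(1) by (intro integral_completion[symmetric]) simp
    also have "\<dots> = (LINT x:box a b|lebesgue. H x)"
      unfolding set_lebesgue_integral_def
    proof (rule integral_cong_AE)
      show "AE x in lebesgue. indicat_real (box a b) x *\<^sub>R H' x = indicat_real (box a b) x *\<^sub>R H x"
        using ae by eventually_elim simp
    qed (intro borel_measurable_scaleR borel_measurable_indicator measurable_completion[OF H'(1)]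
        borel_measurable_integrable[OF assms(1)]; simp)+
    finally show ?thesis using assms(2) by simp
  qed
  ultimately have "AE x in lborel. H' x = 0" by (rule AE_zero_of_box_integrals)
  from AE_completion[OF this] ae show ?thesis by eventually_elim simp
qed

text \<open>A product of one-dimensional cutoffs is smooth and supported in the closed box, and it
  tends pointwise to the indicator of the open box.\<close>

definition box_bump :: "'a::euclidean_space \<Rightarrow> 'a \<Rightarrow> nat \<Rightarrow> 'a \<Rightarrow> real" where
  "box_bump a c k x = (\<Prod>b\<in>Basis. flat_exp 0 (real (Suc k) * (x \<bullet> b - a \<bullet> b)) * flat_exp 0 (real (Suc k) * (c \<bullet> b - x \<bullet> b)))"

lemma box_bump_test_function:
  assumes "cbox a c \<subseteq> \<Omega>"
  shows "box_bump a c k \<in> test_functions \<Omega>"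
proof -
  have "Ck j (box_bump a c k)" for j
    unfolding box_bump_def
    by (intro Ck_prod Ck_mult Ck_flat_exp Ck_cmult Ck_diff Ck_inner Ck_const)
  moreover have "{x. box_bump a c k x \<noteq> 0} \<subseteq> cbox a c"
    by (auto simp: box_bump_def flat_exp_def mem_box mult_le_0_iff split: if_splits) force+
  then have "closure {x. box_bump a c k x \<noteq> 0} \<subseteq> cbox a c"
    by (rule closure_minimal[OF _ closed_cbox])
  moreover from this have "compact (closure {x. box_bump a c k x \<noteq> 0})"
    using closed_Int_compact[of "closure {x. box_bump a c k x \<noteq> 0}" "cbox a c"] by (simp add: Int_absorb2)
  ultimately show ?thesis
    using assms by (auto simp: test_functions_def smooth_def compactly_supported_in_def)
qed

lemma box_bump_bounds: "0 \<le> box_bump a c k x" "box_bump a c k x \<le> 1"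
  unfolding box_bump_def
  by (auto intro!: prod_nonneg prod_le_1 mult_le_one flat_exp_nonneg flat_exp_0_le_1 mult_nonneg_nonneg)

lemma box_bump_tendsto: "(\<lambda>k. box_bump a c k x) \<longlonglongrightarrow> indicator (box a c) x"
proof -
  have "(\<lambda>k. box_bump a c k x) \<longlonglongrightarrow> (\<Prod>b\<in>Basis. (if x \<bullet> b - a \<bullet> b \<le> 0 then 0 else 1) * (if c \<bullet> b - x \<bullet> b \<le> 0 then 0 else 1))"
    unfolding box_bump_def using flat_exp_0_scaled_tendsto[of 0]
    by (intro tendsto_prod tendsto_mult) (simp_all only: diff_zero order_refl)
  also have "(\<Prod>b\<in>Basis. (if x \<bullet> b - a \<bullet> b \<le> 0 then 0 else 1) * (if c \<bullet> b - x \<bullet> b \<le> 0 then 0 else 1))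
      = (indicator (box a c) x :: real)"
  proof (cases "x \<in> box a c")
    case True
    then show ?thesis by (simp add: mem_box not_le prod.neutral)
  next
    case False
    then obtain b where "b \<in> Basis" "x \<bullet> b - a \<bullet> b \<le> 0 \<or> c \<bullet> b - x \<bullet> b \<le> 0" by (force simp: mem_box)
    then show ?thesis using False by (auto intro!: prod_zero)
  qed
  finally show ?thesis .
qed

text \<open>Testing with box bumps shows that h has zero integral over each box whose closed version
  lies in \<Omega>. Cutting h off to such a box turns this into a statement about all boxes, hence h
  vanishes almost everywhere there, and countably many closed boxes fill \<Omega>.\<close>

lemma du_bois_reymond:
  fixes h :: "'a::euclidean_space \<Rightarrow> real"
  assumes \<Omega>: "open \<Omega>" and h: "integrable (lebesgue_on \<Omega>) h"
    and 0: "\<And>\<theta>. \<theta> \<in> test_functions \<Omega> \<Longrightarrow> (LINT x|lebesgue_on \<Omega>. h x * \<theta> x) = 0"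
  shows "AE x in lebesgue_on \<Omega>. h x = 0"
proof -
  have \<Omega>': "\<Omega> \<in> sets lebesgue" using \<Omega> by simp
  have hi: "integrable lebesgue (\<lambda>x. indicator \<Omega> x *\<^sub>R h x)"
    using h \<Omega>' by (simp add: integrable_restrict_space)
  have hm: "(\<lambda>x. indicator \<Omega> x *\<^sub>R h x) \<in> borel_measurable lebesgue" using hi by (rule borel_measurable_integrable)
  have box0: "(LINT x:box a c|lebesgue. indicator \<Omega> x *\<^sub>R h x) = 0" if ac: "cbox a c \<subseteq> \<Omega>" for a c
  proof -
    have bm: "box_bump a c k \<in> borel_measurable lebesgue" for k
      using test_functionsD(3)[OF box_bump_test_function[OF ac]]
      by (intro measurable_completion) (auto intro: borel_measurable_continuous_onI)
    have "(\<lambda>k. integral\<^sup>L lebesgue (\<lambda>x. box_bump a c k x *\<^sub>R (indicator \<Omega> x *\<^sub>R h x)))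
        \<longlonglongrightarrow> integral\<^sup>L lebesgue (\<lambda>x. indicator (box a c) x *\<^sub>R (indicator \<Omega> x *\<^sub>R h x))"
    proof (rule integral_dominated_convergence[where w = "\<lambda>x. norm (indicator \<Omega> x *\<^sub>R h x)"])
      show "AE x in lebesgue. (\<lambda>k. box_bump a c k x *\<^sub>R (indicator \<Omega> x *\<^sub>R h x))
          \<longlonglongrightarrow> indicator (box a c) x *\<^sub>R (indicator \<Omega> x *\<^sub>R h x)"
        by (intro AE_I2 tendsto_scaleR box_bump_tendsto tendsto_const)
      show "AE x in lebesgue. norm (box_bump a c k x *\<^sub>R (indicator \<Omega> x *\<^sub>R h x)) \<le> norm (indicator \<Omega> x *\<^sub>R h x)" for k
        using box_bump_bounds[of a c k] by (intro AE_I2) (simp add: abs_mult mult_left_le_one_le)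
      show "integrable lebesgue (\<lambda>x. norm (indicator \<Omega> x *\<^sub>R h x))" using hi by (rule integrable_norm)
    qed (intro borel_measurable_scaleR borel_measurable_indicator hm bm; simp)+
    moreover have "integral\<^sup>L lebesgue (\<lambda>x. box_bump a c k x *\<^sub>R (indicator \<Omega> x *\<^sub>R h x)) = 0" for k
    proof -
      have "integral\<^sup>L lebesgue (\<lambda>x. box_bump a c k x *\<^sub>R (indicator \<Omega> x *\<^sub>R h x))
          = integral\<^sup>L lebesgue (\<lambda>x. indicator \<Omega> x *\<^sub>R (h x * box_bump a c k x))"
        by (intro Bochner_Integration.integral_cong) auto
      also have "\<dots> = (LINT x|lebesgue_on \<Omega>. h x * box_bump a c k x)"
        using \<Omega>' by (simp add: integral_restrict_space)
      finally show ?thesis using 0[OF box_bump_test_function[OF ac]] by simp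
    qed
    ultimately show ?thesis by (simp add: LIMSEQ_const_iff set_lebesgue_integral_def)
  qed
  have cb: "AE x in lebesgue. x \<in> cbox a c \<longrightarrow> h x = 0" if ac: "cbox a c \<subseteq> \<Omega>" for a c
  proof -
    have "AE x in lebesgue. indicator (box a c) x *\<^sub>R (indicator \<Omega> x *\<^sub>R h x) = 0"
    proof (rule AE_lebesgue_zero_of_box_integrals)
      show "integrable lebesgue (\<lambda>x. indicator (box a c) x *\<^sub>R (indicator \<Omega> x *\<^sub>R h x))"
        by (rule integrable_mult_indicator[OF _ hi]) simp
      fix p q :: 'a
      \<comment> \<open>An arbitrary box meets the cut-off region in a smaller box whose closed
        version still lies in \<Omega>.\<close>
      obtain a' c' where box: "box p q \<inter> box a c = box a' c'" "cbox a' c' \<subseteq> cbox a c \<or> box a' c' = {}"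
      proof -
        define a' c' where "a' = (\<Sum>i\<in>Basis. max (p \<bullet> i) (a \<bullet> i) *\<^sub>R i)" and "c' = (\<Sum>i\<in>Basis. min (q \<bullet> i) (c \<bullet> i) *\<^sub>R i)"
        have "box p q \<inter> box a c = box a' c'" by (simp add: box_Int_box a'_def c'_def)
        moreover have "cbox a' c' \<subseteq> cbox a c" by (auto simp: mem_box a'_def c'_def)
        ultimately show ?thesis using that by blast
      qed
      have "(LINT x:box p q|lebesgue. indicator (box a c) x *\<^sub>R (indicator \<Omega> x *\<^sub>R h x))
          = (LINT x:box a' c'|lebesgue. indicator \<Omega> x *\<^sub>R h x)"
        unfolding set_lebesgue_integral_def box(1)[symmetric]
        by (intro Bochner_Integration.integral_cong) (auto simp: indicator_def)
      also have "\<dots> = 0"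
        using box(2) box0[of a' c'] ac by (auto simp: set_lebesgue_integral_def)
      finally show "(LINT x:box p q|lebesgue. indicator (box a c) x *\<^sub>R (indicator \<Omega> x *\<^sub>R h x)) = 0" .
    qed
    \<comment> \<open>The covering uses closed boxes and the integrals open ones; the faces between
      them are negligible.\<close>
    moreover have "AE x in lebesgue. x \<notin> cbox a c - box a c"
      using negligible_frontier_interval[of a c] negligible_iff_null_sets AE_not_in by blast
    ultimately show ?thesis
      by eventually_elim (use ac box_subset_cbox in \<open>auto simp: indicator_def split: if_splits\<close>)
  qed
  obtain \<D> where \<D>: "countable \<D>" "\<D> \<subseteq> Pow \<Omega>" "\<And>X. X \<in> \<D> \<Longrightarrow> \<exists>a b. X = cbox a b" "\<Union>\<D> = \<Omega>"
    using open_countable_Union_open_cbox[OF \<Omega>] by metis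
  have "AE x in lebesgue. \<forall>X\<in>\<D>. x \<in> X \<longrightarrow> h x = 0"
    unfolding AE_ball_countable[OF \<D>(1)]
  proof
    fix X assume "X \<in> \<D>"
    then obtain a c where "X = cbox a c" "cbox a c \<subseteq> \<Omega>" using \<D> by blast
    then show "AE x in lebesgue. x \<in> X \<longrightarrow> h x = 0" using cb by simp
  qed
  then have "AE x in lebesgue. x \<in> \<Omega> \<longrightarrow> h x = 0"
    by eventually_elim (use \<D>(4) in blast)
  then show ?thesis using \<Omega>' by (simp add: AE_restrict_space_iff)
qed

section \<open>Differences and uniqueness of weak gradients\<close>

lemma integrable_of_L2:
  fixes f :: "'a::euclidean_space \<Rightarrow> 'b::euclidean_space"
  assumes "f \<in> L2 \<Omega>" "bounded \<Omega>" "\<Omega> \<in> sets lebesgue"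
  shows "integrable (lebesgue_on \<Omega>) f"
proof (rule Bochner_Integration.integrable_bound[where f = "\<lambda>x. 1 + (norm (f x))\<^sup>2"])
  show "integrable (lebesgue_on \<Omega>) (\<lambda>x. 1 + (norm (f x))\<^sup>2)"
    using assms integrable_lebesgue_on_continuous[of "\<lambda>_. 1::real" \<Omega>]
    by (intro Bochner_Integration.integrable_add) (auto simp: L2_def)
  have "norm (f x) \<le> 1 + (norm (f x))\<^sup>2" for x
    using sum_squares_bound[of 1 "norm (f x)"] norm_ge_zero[of "f x"] unfolding power2_eq_square by linarith
  then show "AE x in lebesgue_on \<Omega>. norm (f x) \<le> norm (1 + (norm (f x))\<^sup>2)"
    by (intro AE_I2) simp
qed (use assms in \<open>simp add: L2_def\<close>)

lemma L2_diff:
  fixes f g :: "'a::euclidean_space \<Rightarrow> 'b::euclidean_space"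
  assumes "f \<in> L2 \<Omega>" "g \<in> L2 \<Omega>"
  shows "(\<lambda>x. f x - g x) \<in> L2 \<Omega>"
proof -
  have m: "f \<in> borel_measurable (lebesgue_on \<Omega>)" "g \<in> borel_measurable (lebesgue_on \<Omega>)"
    using assms by (auto simp: L2_def)
  have "integrable (lebesgue_on \<Omega>) (\<lambda>x. (norm (f x - g x))\<^sup>2)"
  proof (rule Bochner_Integration.integrable_bound[where f = "\<lambda>x. 2 * (norm (f x))\<^sup>2 + 2 * (norm (g x))\<^sup>2"])
    show "integrable (lebesgue_on \<Omega>) (\<lambda>x. 2 * (norm (f x))\<^sup>2 + 2 * (norm (g x))\<^sup>2)"
      using assms by (auto simp: L2_def)
    have "(norm (f x - g x))\<^sup>2 \<le> 2 * (norm (f x))\<^sup>2 + 2 * (norm (g x))\<^sup>2" for x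
    proof -
      have "(norm (f x - g x))\<^sup>2 \<le> (norm (f x) + norm (g x))\<^sup>2"
        by (intro power_mono norm_triangle_ineq4) simp
      also have "\<dots> \<le> 2 * (norm (f x))\<^sup>2 + 2 * (norm (g x))\<^sup>2"
        using sum_squares_bound[of "norm (f x)" "norm (g x)"] by (simp add: power2_sum)
      finally show ?thesis .
    qed
    then show "AE x in lebesgue_on \<Omega>. norm ((norm (f x - g x))\<^sup>2)
        \<le> norm (2 * (norm (f x))\<^sup>2 + 2 * (norm (g x))\<^sup>2)"
      by (intro AE_I2) simp
  qed (use m in measurable)
  then show ?thesis using m by (simp add: L2_def)
qed

lemma integrable_mult_continuous:
  fixes f \<theta> :: "'a::euclidean_space \<Rightarrow> real"
  assumes "integrable (lebesgue_on \<Omega>) f" "continuous_on UNIV \<theta>" "bounded \<Omega>" "\<Omega> \<in> sets lebesgue"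
  shows "integrable (lebesgue_on \<Omega>) (\<lambda>x. f x * \<theta> x)"
proof -
  have "bounded (\<theta> ` closure \<Omega>)"
    using assms by (intro compact_imp_bounded compact_continuous_image continuous_on_subset[OF assms(2)]) auto
  then obtain C where C: "\<And>x. x \<in> \<Omega> \<Longrightarrow> \<bar>\<theta> x\<bar> \<le> C"
    using closure_subset[of \<Omega>] by (force simp: bounded_iff)
  show ?thesis
  proof (rule Bochner_Integration.integrable_bound[where f = "\<lambda>x. C * f x"])
    show "integrable (lebesgue_on \<Omega>) (\<lambda>x. C * f x)" using assms(1) by simp
    have "\<theta> \<in> borel_measurable (lebesgue_on \<Omega>)"
      using integrable_lebesgue_on_continuous[OF assms(2-4)] by (rule borel_measurable_integrable)
    then show "(\<lambda>x. f x * \<theta> x) \<in> borel_measurable (lebesgue_on \<Omega>)"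
      using assms(1) by (intro borel_measurable_times) auto
    have "norm (f x * \<theta> x) \<le> norm (C * f x)" if "x \<in> \<Omega>" for x
    proof -
      have "\<bar>\<theta> x\<bar> \<le> \<bar>C\<bar>" using C[OF that] by linarith
      then show ?thesis by (simp add: abs_mult mult.commute mult_right_mono)
    qed
    then show "AE x in lebesgue_on \<Omega>. norm (f x * \<theta> x) \<le> norm (C * f x)"
      using assms(4) by (intro AE_I2) simp
  qed
qed

lemma has_weak_gradient_diff:
  fixes u v :: "'a::euclidean_space \<Rightarrow> real"
  assumes \<Omega>: "open \<Omega>" "bounded \<Omega>" and u: "has_weak_gradient \<Omega> u g" and v: "has_weak_gradient \<Omega> v h"
  shows "has_weak_gradient \<Omega> (\<lambda>x. u x - v x) (\<lambda>x. g x - h x)"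
  unfolding has_weak_gradient_def
proof (intro conjI ballI)
  have \<Omega>': "\<Omega> \<in> sets lebesgue" using \<Omega> by simp
  have L2: "u \<in> L2 \<Omega>" "v \<in> L2 \<Omega>" "g \<in> L2 \<Omega>" "h \<in> L2 \<Omega>"
    using u v by (auto simp: has_weak_gradient_def)
  then show "(\<lambda>x. u x - v x) \<in> L2 \<Omega>" "(\<lambda>x. g x - h x) \<in> L2 \<Omega>" by (auto intro: L2_diff)
  note int = L2[THEN integrable_of_L2[OF _ \<Omega>(2) \<Omega>']]
  fix \<theta> and b :: 'a assume \<theta>: "\<theta> \<in> test_functions \<Omega>" and b: "b \<in> Basis"
  note \<theta>' = test_functionsD(3)[OF \<theta>] continuous_partial[OF test_functionsD(1)[OF \<theta>] b]
  note mc = integrable_mult_continuous[OF _ _ \<Omega>(2) \<Omega>']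
  have "(LINT x|lebesgue_on \<Omega>. (u x - v x) * partial b \<theta> x)
      = (LINT x|lebesgue_on \<Omega>. u x * partial b \<theta> x) - (LINT x|lebesgue_on \<Omega>. v x * partial b \<theta> x)"
    unfolding left_diff_distrib by (intro Bochner_Integration.integral_diff mc int \<theta>')
  also have "\<dots> = - (LINT x|lebesgue_on \<Omega>. (g x \<bullet> b) * \<theta> x) + (LINT x|lebesgue_on \<Omega>. (h x \<bullet> b) * \<theta> x)"
    using u v \<theta> b by (simp add: has_weak_gradient_def)
  also have "\<dots> = - (LINT x|lebesgue_on \<Omega>. (g x \<bullet> b) * \<theta> x - (h x \<bullet> b) * \<theta> x)"
    by (subst Bochner_Integration.integral_diff) (intro mc integrable_inner_left int \<theta>' | simp)+
  finally show "(LINT x|lebesgue_on \<Omega>. (u x - v x) * partial b \<theta> x)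
      = - (LINT x|lebesgue_on \<Omega>. ((g x - h x) \<bullet> b) * \<theta> x)"
    by (simp add: inner_diff_left left_diff_distrib)
qed

text \<open>The difference of two weak gradients of u is a weak gradient of u - u = 0, so each of
  its components is orthogonal to all test functions.\<close>

lemma weak_gradient_unique:
  fixes u :: "'a::euclidean_space \<Rightarrow> real"
  assumes \<Omega>: "open \<Omega>" "bounded \<Omega>" and g: "has_weak_gradient \<Omega> u g" and h: "has_weak_gradient \<Omega> u h"
  shows "AE x in lebesgue_on \<Omega>. g x = h x"
proof -
  have \<Omega>': "\<Omega> \<in> sets lebesgue" using \<Omega> by simp
  have d: "has_weak_gradient \<Omega> (\<lambda>x. u x - u x) (\<lambda>x. g x - h x)"
    by (rule has_weak_gradient_diff[OF \<Omega> g h])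
  then have "integrable (lebesgue_on \<Omega>) (\<lambda>x. g x - h x)"
    using integrable_of_L2[OF _ \<Omega>(2) \<Omega>'] by (auto simp: has_weak_gradient_def)
  then have "integrable (lebesgue_on \<Omega>) (\<lambda>x. (g x - h x) \<bullet> b)" for b by (rule integrable_inner_left)
  then have "AE x in lebesgue_on \<Omega>. (g x - h x) \<bullet> b = 0" if "b \<in> Basis" for b
    using d that by (intro du_bois_reymond \<Omega>) (auto simp: has_weak_gradient_def)
  then have "AE x in lebesgue_on \<Omega>. \<forall>b\<in>Basis. (g x - h x) \<bullet> b = 0"
    by (intro AE_finite_allI) auto
  then show ?thesis
  proof eventually_elim
    case (elim x)
    then have "g x - h x = 0" by (simp only: euclidean_all_zero_iff)
    then show ?case by simp
  qed
qed

lemma has_weak_gradient_weak_gradient: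
  "u \<in> H1 \<Omega> \<Longrightarrow> has_weak_gradient \<Omega> u (weak_gradient \<Omega> u)"
  unfolding H1_def weak_gradient_def mem_Collect_eq by (rule someI_ex[of "has_weak_gradient \<Omega> u"])

lemma weak_gradient_AE_eq:
  fixes u :: "'a::euclidean_space \<Rightarrow> real"
  assumes "open \<Omega>" "bounded \<Omega>" "has_weak_gradient \<Omega> u g"
  shows "has_weak_gradient \<Omega> u (weak_gradient \<Omega> u)" "AE x in lebesgue_on \<Omega>. weak_gradient \<Omega> u x = g x"
proof -
  show "has_weak_gradient \<Omega> u (weak_gradient \<Omega> u)"
    using assms(3) by (intro has_weak_gradient_weak_gradient) (auto simp: H1_def)
  then show "AE x in lebesgue_on \<Omega>. weak_gradient \<Omega> u x = g x"
    using weak_gradient_unique assms by blast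
qed

section \<open>Lower bound of the functional on H^1_0\<close>

text \<open>The envelope inequality is carried from approximating test functions to \<psi>. Young's
  inequality with a free weight \<eta> splits the error into \<eta> times a fixed quantity and a
  multiple of the squared H^1 distance; k tends to infinity at fixed \<eta>, and \<eta> to 0
  afterwards.\<close>

lemma F_functional_lower_bound:
  fixes \<psi> :: "'a::euclidean_space \<Rightarrow> real"
  assumes \<Omega>: "open \<Omega>" "bounded \<Omega>" and r: "0 < r"
    and vol: "measure lebesgue (ball (0::'a) r) = measure lebesgue \<Omega>"
    and \<Lambda>: "0 < \<Lambda>" and \<psi>: "\<psi> \<in> H10 \<Omega>"
  shows "- integral\<^sup>L (lebesgue_on (ball 0 r)) (\<lambda>y::'a. energy_dual (sqrt (2 * \<Lambda>)) (norm y / DIM('a)))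
    \<le> F_functional \<Omega> \<Lambda> \<psi>"
proof -
  have \<Omega>': "\<Omega> \<in> sets lebesgue" using \<Omega> by simp
  define \<kappa> where "\<kappa> = sqrt (2 * \<Lambda>)"
  have \<kappa>: "0 \<le> \<kappa>" "\<kappa>\<^sup>2 = 2 * \<Lambda>" using \<Lambda> by (auto simp: \<kappa>_def)
  let ?T = "integral\<^sup>L (lebesgue_on (ball 0 r)) (\<lambda>y::'a. energy_dual \<kappa> (norm y / DIM('a)))"
  let ?I = "integral\<^sup>L (lebesgue_on \<Omega>)"
  define g where "g = weak_gradient \<Omega> \<psi>"
  have g: "has_weak_gradient \<Omega> \<psi> g"
    using \<psi> has_weak_gradient_weak_gradient unfolding H10_def g_def by blast
  then have L2: "\<psi> \<in> L2 \<Omega>" "g \<in> L2 \<Omega>" by (auto simp: has_weak_gradient_def)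
  note int\<psi> = integrable_of_L2[OF L2(1) \<Omega>(2) \<Omega>'] and intg = integrable_of_L2[OF L2(2) \<Omega>(2) \<Omega>']
  have gm: "g \<in> borel_measurable (lebesgue_on \<Omega>)" using L2 by (simp add: L2_def)
  have g2: "integrable (lebesgue_on \<Omega>) (\<lambda>x. (norm (g x))\<^sup>2)" using L2 by (simp add: L2_def)
  have const: "integrable (lebesgue_on \<Omega>) (\<lambda>_. c)" for c :: real
    by (rule integrable_lebesgue_on_continuous[OF _ \<Omega>(2) \<Omega>']) simp
  obtain \<phi> where \<phi>: "\<And>k. \<phi> k \<in> test_functions \<Omega>"
    and lim: "(\<lambda>k. H1_norm \<Omega> (\<lambda>x. \<phi> k x - \<psi> x)) \<longlonglongrightarrow> 0"
    using \<psi> unfolding H10_def by blast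
  \<comment> \<open>\<open>H1_norm\<close> involves the weak gradient chosen for the difference;
    uniqueness identifies it almost everywhere with \<open>grad (\<phi> k) x - g x\<close>.\<close>
  define w where "w k = weak_gradient \<Omega> (\<lambda>x. \<phi> k x - \<psi> x)" for k
  have w: "has_weak_gradient \<Omega> (\<lambda>x. \<phi> k x - \<psi> x) (w k)"
    "AE x in lebesgue_on \<Omega>. w k x = grad (\<phi> k) x - g x" for k
    unfolding w_def
    using weak_gradient_AE_eq[OF \<Omega> has_weak_gradient_diff[OF \<Omega> has_weak_gradient_test_function[OF \<Omega> \<phi>] g]]
    by blast+
  have w2: "integrable (lebesgue_on \<Omega>) (\<lambda>x. (norm (w k x))\<^sup>2)"
    and d2: "integrable (lebesgue_on \<Omega>) (\<lambda>x. (\<phi> k x - \<psi> x)\<^sup>2)" for k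
    using w(1)[of k] by (auto simp: has_weak_gradient_def L2_def)
  define a b where "a k = ?I (\<lambda>x. (\<phi> k x - \<psi> x)\<^sup>2)" and "b k = ?I (\<lambda>x. (norm (w k x))\<^sup>2)" for k
  have ab0: "0 \<le> a k" "0 \<le> b k" for k by (auto simp: a_def b_def)
  have "(\<lambda>k. (H1_norm \<Omega> (\<lambda>x. \<phi> k x - \<psi> x))\<^sup>2) \<longlonglongrightarrow> 0\<^sup>2"
    by (intro tendsto_power lim)
  moreover have "(H1_norm \<Omega> (\<lambda>x. \<phi> k x - \<psi> x))\<^sup>2 = a k + b k" for k
    using ab0[of k] by (simp add: H1_norm_def a_def b_def w_def)
  ultimately have ablim: "(\<lambda>k. a k + b k) \<longlonglongrightarrow> 0" by simp
  have blim: "b \<longlonglongrightarrow> 0"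
    by (rule tendsto_sandwich[OF _ _ tendsto_const ablim]) (use ab0 in auto)
  have S: "{x\<in>\<Omega>. g x \<noteq> 0} \<in> sets (lebesgue_on \<Omega>)"
  proof -
    have "{x\<in>space (lebesgue_on \<Omega>). g x \<noteq> 0} \<in> sets (lebesgue_on \<Omega>)"
      using gm by measurable
    then show ?thesis using \<Omega>' by simp
  qed
  \<comment> \<open>The coefficient of \<eta> in the two uses of Young's inequality: s = 1 for
    comparing \<psi> with \<open>\<phi> k\<close>, and s = \<kappa> + |g| for comparing the
    envelopes.\<close>
  define Q where "Q = measure lebesgue \<Omega> / 2 + ?I (\<lambda>x. (\<kappa> + norm (g x))\<^sup>2 / 2)"
  have intQ: "integrable (lebesgue_on \<Omega>) (\<lambda>x. (\<kappa> + norm (g x))\<^sup>2 / 2)"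
    unfolding power2_sum using g2 intg const
    by (intro integrable_divide Bochner_Integration.integrable_add integrable_mult_right integrable_norm) auto
  have intE: "integrable (lebesgue_on \<Omega>) (\<lambda>x. energy_envelope \<kappa> (norm (g x)))"
  proof (rule Bochner_Integration.integrable_bound[where f = "\<lambda>x. (norm (g x))\<^sup>2 / 2 + \<kappa>\<^sup>2 / 2"])
    show "integrable (lebesgue_on \<Omega>) (\<lambda>x. (norm (g x))\<^sup>2 / 2 + \<kappa>\<^sup>2 / 2)"
      using g2 const by (intro Bochner_Integration.integrable_add integrable_divide) auto
    show "(\<lambda>x. energy_envelope \<kappa> (norm (g x))) \<in> borel_measurable (lebesgue_on \<Omega>)"
      using gm unfolding energy_envelope_def by measurable
    have "energy_envelope \<kappa> (norm (g x)) \<le> (norm (g x))\<^sup>2 / 2 + \<kappa>\<^sup>2 / 2" for x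
    proof -
      have "(if norm (g x) = 0 then 0 else \<kappa>\<^sup>2 / 2) \<le> \<kappa>\<^sup>2 / 2" by simp
      then show ?thesis using energy_envelope_le[OF \<kappa>(1) norm_ge_zero, of "g x"] by linarith
    qed
    moreover have "0 \<le> energy_envelope \<kappa> (norm (g x))" for x by (rule energy_nonneg(1)[OF \<kappa>(1) norm_ge_zero])
    ultimately show "AE x in lebesgue_on \<Omega>. norm (energy_envelope \<kappa> (norm (g x))) \<le> norm ((norm (g x))\<^sup>2 / 2 + \<kappa>\<^sup>2 / 2)"
      by (intro AE_I2) simp
  qed
  have young: "s * t \<le> \<eta> * (s\<^sup>2 / 2) + t\<^sup>2 / (2 * \<eta>)" if "0 < \<eta>" for s t \<eta> :: real
  proof -
    have "0 \<le> (\<eta> * s - t)\<^sup>2 / (2 * \<eta>)" using that by simp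
    also have "\<dots> = \<eta> * (s\<^sup>2 / 2) + t\<^sup>2 / (2 * \<eta>) - s * t"
      using that by (simp add: power2_diff divide_simps) (simp add: algebra_simps power2_eq_square)
    finally show ?thesis by simp
  qed
  have step: "?I \<psi> \<le> ?T + ?I (\<lambda>x. energy_envelope \<kappa> (norm (g x))) + \<eta> * Q + ((a k + b k) / (2 * \<eta>) + b k / 2)"
    if \<eta>: "0 < \<eta>" for \<eta> k
  proof -
    note \<phi>k = test_functionsD[OF \<phi>[of k]]
    have int\<phi>: "integrable (lebesgue_on \<Omega>) (\<phi> k)"
      by (rule integrable_lebesgue_on_continuous[OF \<phi>k(3) \<Omega>(2) \<Omega>'])
    have "?I \<psi> \<le> ?I (\<lambda>x. \<phi> k x + (\<eta> * (1 / 2) + (\<phi> k x - \<psi> x)\<^sup>2 / (2 * \<eta>)))"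
    proof (rule integral_mono)
      show "integrable (lebesgue_on \<Omega>) (\<lambda>x. \<phi> k x + (\<eta> * (1 / 2) + (\<phi> k x - \<psi> x)\<^sup>2 / (2 * \<eta>)))"
        by (intro Bochner_Integration.integrable_add int\<phi> const integrable_divide d2)
      show "\<psi> x \<le> \<phi> k x + (\<eta> * (1 / 2) + (\<phi> k x - \<psi> x)\<^sup>2 / (2 * \<eta>))" for x
        using young[OF \<eta>, of 1 "\<psi> x - \<phi> k x"] by (simp add: power2_commute)
    qed (rule int\<psi>)
    also have "\<dots> = ?I (\<phi> k) + (\<eta> * measure lebesgue \<Omega> / 2 + a k / (2 * \<eta>))"
      using int\<phi> const d2[of k] \<Omega>' \<Omega>
      by (simp add: Bochner_Integration.integral_add integrable_divide a_def measure_restrict_space)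
    finally have 1: "?I \<psi> \<le> ?I (\<phi> k) + (\<eta> * measure lebesgue \<Omega> / 2 + a k / (2 * \<eta>))" .
    have 2: "?I (\<phi> k) \<le> ?I (\<lambda>x. energy_envelope \<kappa> (norm (grad (\<phi> k) x))) + ?T"
      by (rule integral_le_envelope_dual[OF \<Omega> r vol \<phi>k(1) \<phi>k(2) \<kappa>(1)])
    have intR: "integrable (lebesgue_on \<Omega>) (\<lambda>x. energy_envelope \<kappa> (norm (g x))
        + (\<eta> * ((\<kappa> + norm (g x))\<^sup>2 / 2) + (norm (w k x))\<^sup>2 / (2 * \<eta>)) + (norm (w k x))\<^sup>2 / 2)"
      by (intro Bochner_Integration.integrable_add intE integrable_mult_right intQ integrable_divide w2)
    have "?I (\<lambda>x. energy_envelope \<kappa> (norm (grad (\<phi> k) x))) \<le> ?I (\<lambda>x. energy_envelope \<kappa> (norm (g x))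
        + (\<eta> * ((\<kappa> + norm (g x))\<^sup>2 / 2) + (norm (w k x))\<^sup>2 / (2 * \<eta>)) + (norm (w k x))\<^sup>2 / 2)"
    proof (rule integral_mono_AE)
      show "integrable (lebesgue_on \<Omega>) (\<lambda>x. energy_envelope \<kappa> (norm (grad (\<phi> k) x)))"
        unfolding energy_envelope_def
        by (intro integrable_lebesgue_on_continuous \<Omega>(2) \<Omega>' continuous_intros continuous_grad[OF \<phi>k(1)]) auto
      show "AE x in lebesgue_on \<Omega>. energy_envelope \<kappa> (norm (grad (\<phi> k) x)) \<le> energy_envelope \<kappa> (norm (g x))
        + (\<eta> * ((\<kappa> + norm (g x))\<^sup>2 / 2) + (norm (w k x))\<^sup>2 / (2 * \<eta>)) + (norm (w k x))\<^sup>2 / 2"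
        using w(2)[of k]
      proof eventually_elim
        case (elim x)
        have "norm (grad (\<phi> k) x) \<le> norm (g x) + norm (w k x)"
          using norm_triangle_ineq[of "g x" "w k x"] elim by simp
        from energy_envelope_add_le[OF \<kappa>(1) _ _ _ this]
        have "energy_envelope \<kappa> (norm (grad (\<phi> k) x))
            \<le> energy_envelope \<kappa> (norm (g x)) + (\<kappa> + norm (g x)) * norm (w k x) + (norm (w k x))\<^sup>2 / 2" by simp
        then show ?case using young[OF \<eta>, of "\<kappa> + norm (g x)" "norm (w k x)"] by linarith
      qed
    qed (rule intR)
    also have "\<dots> = ?I (\<lambda>x. energy_envelope \<kappa> (norm (g x)))
        + (\<eta> * ?I (\<lambda>x. (\<kappa> + norm (g x))\<^sup>2 / 2) + b k / (2 * \<eta>)) + b k / 2"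
      unfolding b_def
      by (subst Bochner_Integration.integral_add
          | intro Bochner_Integration.integrable_add intE integrable_mult_right intQ integrable_divide w2 | simp)+
    finally show ?thesis
      using 1 2 by (simp add: Q_def algebra_simps add_divide_distrib)
  qed
  have step2: "?I \<psi> \<le> ?T + ?I (\<lambda>x. energy_envelope \<kappa> (norm (g x))) + \<eta> * Q" if \<eta>: "0 < \<eta>" for \<eta>
  proof -
    have "(\<lambda>k. ?T + ?I (\<lambda>x. energy_envelope \<kappa> (norm (g x))) + \<eta> * Q + ((a k + b k) / (2 * \<eta>) + b k / 2))
        \<longlonglongrightarrow> ?T + ?I (\<lambda>x. energy_envelope \<kappa> (norm (g x))) + \<eta> * Q + (0 / (2 * \<eta>) + 0 / 2)"
      using \<eta> by (intro tendsto_intros ablim blim) auto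
    from tendsto_lowerbound[OF this] show ?thesis using step[OF \<eta>] by simp
  qed
  have "?I \<psi> \<le> ?T + ?I (\<lambda>x. energy_envelope \<kappa> (norm (g x)))"
  proof (rule field_le_epsilon)
    fix e :: real assume e: "0 < e"
    have Q0: "0 \<le> Q" by (simp add: Q_def)
    have "e / (Q + 1) * Q \<le> e" using e Q0 by (simp add: field_simps)
    then show "?I \<psi> \<le> ?T + ?I (\<lambda>x. energy_envelope \<kappa> (norm (g x))) + e"
      using step2[of "e / (Q + 1)"] e Q0 by (simp add: add_nonneg_pos)
  qed
  \<comment> \<open>Only now, for the limit itself, is the envelope replaced by the original
    discontinuous integrand.\<close>
  also have "?I (\<lambda>x. energy_envelope \<kappa> (norm (g x)))
      \<le> ?I (\<lambda>x. (norm (g x))\<^sup>2 / 2 + \<Lambda> * indicator {x\<in>\<Omega>. g x \<noteq> 0} x)"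
  proof (rule integral_mono)
    show "integrable (lebesgue_on \<Omega>) (\<lambda>x. (norm (g x))\<^sup>2 / 2 + \<Lambda> * indicator {x\<in>\<Omega>. g x \<noteq> 0} x)"
      using g2 S integrable_mult_indicator[OF S const[of 1]]
      by (intro Bochner_Integration.integrable_add integrable_divide integrable_mult_right) auto
    show "energy_envelope \<kappa> (norm (g x)) \<le> (norm (g x))\<^sup>2 / 2 + \<Lambda> * indicator {x\<in>\<Omega>. g x \<noteq> 0} x"
      if "x \<in> space (lebesgue_on \<Omega>)" for x
      using energy_envelope_le[OF \<kappa>(1) norm_ge_zero, of "g x"] \<kappa>(2) that \<Omega>' by (auto split: if_splits)
  qed (rule intE)
  also have "\<dots> = ?I (\<lambda>x. (norm (g x))\<^sup>2) / 2 + \<Lambda> * measure lebesgue {x\<in>\<Omega>. g x \<noteq> 0}"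
  proof -
    have "integrable (lebesgue_on \<Omega>) (\<lambda>x. indicator {x\<in>\<Omega>. g x \<noteq> 0} x :: real)"
      using integrable_mult_indicator[OF S const[of 1]] by simp
    moreover have "?I (indicator {x\<in>\<Omega>. g x \<noteq> 0}) = measure lebesgue {x\<in>\<Omega>. g x \<noteq> 0}"
    proof -
      have "{x\<in>\<Omega>. g x \<noteq> 0} \<inter> \<Omega> = {x\<in>\<Omega>. g x \<noteq> 0}" by auto
      then show ?thesis using \<Omega>' S
        by (simp add: measure_restrict_space)
    qed
    ultimately show ?thesis using g2
      by (subst Bochner_Integration.integral_add) auto
  qed
  finally show ?thesis
    by (simp add: F_functional_def g_def \<kappa>_def)
qed

section \<open>Competitors on the ball\<close>

text \<open>The constant sequence works, but \<open>weak_gradient\<close> of the zero function is a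
  choice and must first be shown to vanish almost everywhere.\<close>

lemma test_function_in_H10:
  fixes v :: "'a::euclidean_space \<Rightarrow> real"
  assumes \<Omega>: "open \<Omega>" "bounded \<Omega>" and v: "v \<in> test_functions \<Omega>"
  shows "v \<in> H10 \<Omega>"
proof -
  have "has_weak_gradient \<Omega> (\<lambda>x. v x - v x) (\<lambda>x. grad v x - grad v x)"
    using has_weak_gradient_test_function[OF \<Omega> v] by (intro has_weak_gradient_diff \<Omega>)
  from weak_gradient_AE_eq(2)[OF \<Omega> this]
  have "AE x in lebesgue_on \<Omega>. weak_gradient \<Omega> (\<lambda>x. v x - v x) x = 0" by simp
  then have "(LINT x|lebesgue_on \<Omega>. (norm (weak_gradient \<Omega> (\<lambda>x. v x - v x) x))\<^sup>2) = 0"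
    by (intro integral_eq_zero_AE) (auto elim!: eventually_mono)
  then have "H1_norm \<Omega> (\<lambda>x. v x - v x) = 0" by (simp add: H1_norm_def)
  moreover have "v \<in> H1 \<Omega>"
    using has_weak_gradient_test_function[OF \<Omega> v] by (auto simp: H1_def)
  ultimately show ?thesis
    using v by (auto simp: H10_def intro!: exI[of _ "\<lambda>_. v"])
qed

lemma F_functional_test_function:
  fixes v :: "'a::euclidean_space \<Rightarrow> real"
  assumes \<Omega>: "open \<Omega>" "bounded \<Omega>" and v: "v \<in> test_functions \<Omega>"
  shows "F_functional \<Omega> \<Lambda> v = 1/2 * (LINT x|lebesgue_on \<Omega>. (norm (grad v x))\<^sup>2)
     - (LINT x|lebesgue_on \<Omega>. v x) + \<Lambda> * measure lebesgue {x\<in>\<Omega>. grad v x \<noteq> 0}"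
proof -
  have \<Omega>': "\<Omega> \<in> sets lebesgue" using \<Omega> by simp
  note g = weak_gradient_AE_eq[OF \<Omega> has_weak_gradient_test_function[OF \<Omega> v]]
  have m: "weak_gradient \<Omega> v \<in> borel_measurable (lebesgue_on \<Omega>)" "grad v \<in> borel_measurable (lebesgue_on \<Omega>)"
    using g(1) has_weak_gradient_test_function[OF \<Omega> v] by (auto simp: has_weak_gradient_def L2_def)
  have sets: "{x\<in>\<Omega>. h x \<noteq> 0} \<in> sets lebesgue" if "h \<in> borel_measurable (lebesgue_on \<Omega>)" for h :: "'a \<Rightarrow> 'a"
  proof -
    have "{x\<in>space (lebesgue_on \<Omega>). h x \<noteq> 0} \<in> sets (lebesgue_on \<Omega>)"
      using that by measurable
    then show ?thesis using \<Omega>' by (simp add: sets_restrict_space_iff)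
  qed
  have "(LINT x|lebesgue_on \<Omega>. (norm (weak_gradient \<Omega> v x))\<^sup>2) = (LINT x|lebesgue_on \<Omega>. (norm (grad v x))\<^sup>2)"
    using m g(2) by (intro integral_cong_AE) auto
  moreover have "measure lebesgue {x\<in>\<Omega>. weak_gradient \<Omega> v x \<noteq> 0} = measure lebesgue {x\<in>\<Omega>. grad v x \<noteq> 0}"
  proof (rule measure_eq_AE)
    have "AE x in lebesgue. x \<in> \<Omega> \<longrightarrow> weak_gradient \<Omega> v x = grad v x"
      using g(2) \<Omega>' by (simp add: AE_restrict_space_iff)
    then show "AE x in lebesgue. x \<in> {x\<in>\<Omega>. weak_gradient \<Omega> v x \<noteq> 0} \<longleftrightarrow> x \<in> {x\<in>\<Omega>. grad v x \<noteq> 0}"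
      by eventually_elim auto
  qed (use sets m in auto)
  ultimately show ?thesis by (simp add: F_functional_def)
qed

text \<open>The field v(x) x has divergence n v + x \<bullet> grad v and integral zero. On the ball
  this is the transport estimate for the identity map, with equality.\<close>

lemma integral_eq_position_inner_grad:
  fixes v :: "'a::euclidean_space \<Rightarrow> real"
  assumes v: "v \<in> test_functions \<Omega>"
  shows "real DIM('a) * integral\<^sup>L lborel v = - integral\<^sup>L lborel (\<lambda>x. x \<bullet> grad v x)"
proof -
  note v' = test_functionsD[OF v]
  have K: "compact (closure {x. v x \<noteq> 0})" using v'(2) by (simp add: compactly_supported_in_def)
  have int: "integrable lborel h" if "continuous_on UNIV h" "\<And>x. x \<notin> closure {x. v x \<noteq> 0} \<Longrightarrow> h x = 0"
    for h :: "'a \<Rightarrow> real"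
  proof -
    have "integrable lborel (\<lambda>x. indicator (closure {x. v x \<noteq> 0}) x *\<^sub>R h x)"
      by (intro borel_integrable_compact K continuous_on_subset[OF that(1)]) auto
    moreover have "(\<lambda>x. indicator (closure {x. v x \<noteq> 0}) x *\<^sub>R h x) = h"
      using that(2) by (auto simp: fun_eq_iff indicator_def)
    ultimately show ?thesis by simp
  qed
  have v0: "v x = 0" if "x \<notin> closure {x. v x \<noteq> 0}" for x
    using that closure_subset[of "{x. v x \<noteq> 0}"] by auto
  have intv: "integrable lborel v" by (rule int[OF v'(3) v0])
  have intp: "integrable lborel (\<lambda>x. (x \<bullet> b) * partial b v x)" if "b \<in> Basis" for b
    using continuous_partial[OF v'(1) that] partial_eq_0 by (intro int continuous_intros) auto
  have "integral\<^sup>L lborel v = - integral\<^sup>L lborel (\<lambda>x. (x \<bullet> b) * partial b v x)" if b: "b \<in> Basis" for b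
  proof -
    have "compactly_supported_in (\<lambda>x. v x * (x \<bullet> b)) UNIV"
      using compactly_supported_in_mult[OF v'(2), of "\<lambda>x. x \<bullet> b"] by (auto simp: compactly_supported_in_def)
    then have "0 = integral\<^sup>L lborel (partial b (\<lambda>x. v x * (x \<bullet> b)))"
      using integral_partial_eq_0[OF Ck_mult[OF v'(1) Ck_inner], of b b] b by simp
    also have "\<dots> = integral\<^sup>L lborel (\<lambda>x. v x + (x \<bullet> b) * partial b v x)"
    proof (intro Bochner_Integration.integral_cong refl)
      fix x :: 'a
      have "((\<lambda>x. x \<bullet> b) has_derivative (\<lambda>h. h \<bullet> b)) (at x)" by (auto intro!: derivative_eq_intros)
      from fun_cong[OF frechet_derivative_at[OF this], of b]
      have "partial b (\<lambda>x. x \<bullet> b) x = 1" using b by (simp add: partial_def)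
      then show "partial b (\<lambda>x. v x * (x \<bullet> b)) x = v x + (x \<bullet> b) * partial b v x"
        using partial_mult[OF v'(1) Ck_inner b, where x = x] by simp
    qed
    also have "\<dots> = integral\<^sup>L lborel v + integral\<^sup>L lborel (\<lambda>x. (x \<bullet> b) * partial b v x)"
      by (rule Bochner_Integration.integral_add[OF intv intp[OF b]])
    finally show ?thesis by simp
  qed
  then have "(\<Sum>b\<in>(Basis::'a set). integral\<^sup>L lborel v) = (\<Sum>b\<in>Basis. - integral\<^sup>L lborel (\<lambda>x. (x \<bullet> b) * partial b v x))"
    by (rule sum.cong[OF refl])
  also have "\<dots> = - integral\<^sup>L lborel (\<lambda>x. \<Sum>b\<in>Basis. (x \<bullet> b) * partial b v x)"
    using intp by (simp add: sum_negf)
  also have "(\<lambda>x. \<Sum>b\<in>Basis. (x \<bullet> b) * partial b v x) = (\<lambda>x. x \<bullet> grad v x)"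
    by (simp add: grad_def inner_sum_right mult.commute)
  finally show ?thesis by simp
qed

text \<open>The function is half the integral of \<eta> from |x|^2 to r^2. Using |x|^2 in place of
  |x| as radial variable keeps it smooth at the origin.\<close>

lemma radial_test_function:
  fixes \<eta> :: "real \<Rightarrow> real"
  assumes \<eta>: "continuous_on UNIV \<eta>" "\<And>j. Ck j (\<lambda>x::'a::euclidean_space. \<eta> ((norm x)\<^sup>2))"
    and s: "s < r\<^sup>2" "\<And>t. s \<le> t \<Longrightarrow> \<eta> t = 0" and r: "0 < r"
  obtains v where "v \<in> test_functions (ball (0::'a) r)" "\<And>x. grad v x = - (\<eta> ((norm x)\<^sup>2) *\<^sub>R x)"
proof -
  obtain Y where Y: "\<And>t. 0 \<le> t \<Longrightarrow> (Y has_real_derivative \<eta> t) (at t)"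
    "\<And>t. 0 \<le> t \<Longrightarrow> integral {0..t} \<eta> = Y t" "Y 0 = 0"
    using continuous_antiderivative[OF \<eta>(1), of 0] by blast
  define v where "v x = (Y (r\<^sup>2) - Y ((norm x)\<^sup>2)) / 2" for x :: 'a
  have dv: "(v has_derivative (\<lambda>h. - \<eta> ((norm x)\<^sup>2) * (x \<bullet> h))) (at x)" for x
  proof -
    have "((\<lambda>x::'a. (norm x)\<^sup>2) has_derivative (\<lambda>h. 2 * (x \<bullet> h))) (at x)"
      unfolding power2_norm_eq_inner by (auto intro!: derivative_eq_intros simp: inner_commute)
    from has_derivative_compose[OF this Y(1)[unfolded has_field_derivative_def]]
    have "((\<lambda>x::'a. Y ((norm x)\<^sup>2)) has_derivative (\<lambda>h. \<eta> ((norm x)\<^sup>2) * (2 * (x \<bullet> h)))) (at x)" by simp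
    then show ?thesis unfolding v_def by (auto intro!: derivative_eq_intros)
  qed
  have "Ck j v" for j
  proof (cases j)
    case 0
    have "isCont v x" for x using dv by (rule has_derivative_continuous)
    then show ?thesis using 0 by (simp add: continuous_at_imp_continuous_on)
  next
    case (Suc i)
    \<comment> \<open>The gradient is explicit and as smooth as \<eta> composed with |x|^2, so v
      gains one order.\<close>
    have "Ck i (\<lambda>x::'a. - \<eta> ((norm x)\<^sup>2))"
      using Ck_cmult[OF \<eta>(2), of i "-1"] by simp
    then have c: "Ck i (\<lambda>x::'a. - \<eta> ((norm x)\<^sup>2) * (x \<bullet> b))" for b
      by (rule Ck_mult[OF _ Ck_inner])
    show ?thesis unfolding Suc by (rule Ck_SucI[OF dv c])
  qed
  moreover have "compactly_supported_in v (ball 0 r)"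
  proof -
    have "v x = 0" if "s < (norm x)\<^sup>2" for x
    proof -
      have const: "Y q = Y p" if "0 \<le> p" "s \<le> p" "p \<le> q" for p q
      proof -
        have "\<bar>Y q - Y p\<bar> \<le> 0 * (Y q - Y p)"
          by (rule increment_bound_of_deriv_le[OF that(3) Y(1) Y(1)]) (use that s(2) in auto)
        then show ?thesis by simp
      qed
      show ?thesis
        using const[of "(norm x)\<^sup>2" "r\<^sup>2"] const[of "r\<^sup>2" "(norm x)\<^sup>2"] s(1) that
        by (cases "(norm x)\<^sup>2 \<le> r\<^sup>2") (auto simp: v_def)
    qed
    then have "{x. v x \<noteq> 0} \<subseteq> {x. (norm x)\<^sup>2 \<le> s}" by (auto simp: not_less[symmetric])
    then have cl: "closure {x. v x \<noteq> 0} \<subseteq> {x. (norm x)\<^sup>2 \<le> s}"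
      by (rule closure_minimal) (auto intro!: closed_Collect_le continuous_intros)
    have sub: "{x::'a. (norm x)\<^sup>2 \<le> s} \<subseteq> ball 0 r"
    proof
      fix x :: 'a assume "x \<in> {x. (norm x)\<^sup>2 \<le> s}"
      then have "(norm x)\<^sup>2 < r\<^sup>2" using s(1) by simp
      then show "x \<in> ball 0 r" using r by (simp add: power_less_imp_less_base)
    qed
    then have "bounded (closure {x. v x \<noteq> 0})" using cl bounded_subset[OF bounded_ball] by blast
    then show ?thesis using cl sub by (auto simp: compactly_supported_in_def compact_eq_bounded_closed)
  qed
  moreover have "grad v x = - (\<eta> ((norm x)\<^sup>2) *\<^sub>R x)" for x
  proof (rule euclidean_eqI)
    fix b :: 'a assume "b \<in> Basis"
    then show "grad v x \<bullet> b = - (\<eta> ((norm x)\<^sup>2) *\<^sub>R x) \<bullet> b"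
      using fun_cong[OF frechet_derivative_at[OF dv], of x b] by (simp add: inner_grad partial_def)
  qed
  ultimately show ?thesis
    by (intro that[of v]) (auto simp: test_functions_def smooth_def)
qed

text \<open>The ideal gradient jumps at |x| = n \<kappa> and the corresponding function need not
  have compact support in the open ball; smooth cutoffs in |x|^2 repair both and disappear in the
  limit.\<close>

lemma F_functional_ball_competitor:
  assumes r: "0 < r" and \<Lambda>: "0 < \<Lambda>" and e: "0 < e"
  shows "\<exists>v\<in>test_functions (ball (0::'a::euclidean_space) r). F_functional (ball 0 r) \<Lambda> v
    \<le> - integral\<^sup>L (lebesgue_on (ball 0 r)) (\<lambda>y::'a. energy_dual (sqrt (2 * \<Lambda>)) (norm y / DIM('a))) + e"
proof -
  define n where "n = real DIM('a)"
  have n: "0 < n" by (simp add: n_def)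
  define \<kappa> where "\<kappa> = sqrt (2 * \<Lambda>)"
  have \<kappa>: "0 \<le> \<kappa>" "\<kappa>\<^sup>2 = 2 * \<Lambda>" using \<Lambda> by (auto simp: \<kappa>_def)
  \<comment> \<open>The radius at which |x|/n reaches the threshold \<kappa>. If it is at least r,
    the set S below is empty and the competitors have zero gradient.\<close>
  define \<rho> where "\<rho> = n * \<kappa>"
  have \<rho>: "0 \<le> \<rho>" using n \<kappa> by (simp add: \<rho>_def)
  let ?B = "ball (0::'a) r"
  have B: "open ?B" "bounded ?B" "?B \<in> sets lebesgue" by auto
  let ?I = "integral\<^sup>L (lebesgue_on ?B)"
  \<comment> \<open>The first factor switches the gradient off up to radius \<rho>. In the second,
    the shift by 1 makes the cutoff vanish from r^2 - 1/(k+1) on, hence near the sphere.\<close>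
  define \<theta> where "\<theta> k t = flat_exp 0 (real (Suc k) * (t - \<rho>\<^sup>2)) * flat_exp 0 (real (Suc k) * (r\<^sup>2 - t) - 1)" for k t
  have flat_cont: "continuous_on UNIV (flat_exp 0)"
    using flat_exp_deriv by (auto intro!: DERIV_isCont continuous_at_imp_continuous_on)
  have \<theta>_cont: "continuous_on UNIV (\<theta> k)" for k
    unfolding \<theta>_def by (intro continuous_intros continuous_on_compose2[OF flat_cont]) auto
  have \<theta>01: "0 \<le> \<theta> k t" "\<theta> k t \<le> 1" for k t
    unfolding \<theta>_def by (auto intro!: mult_le_one flat_exp_nonneg flat_exp_0_le_1 mult_nonneg_nonneg)
  have \<theta>_low: "\<theta> k t = 0" if "t \<le> \<rho>\<^sup>2" for k t
    using that by (simp add: \<theta>_def flat_exp_def mult_nonneg_nonpos)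
  have \<theta>_high: "\<theta> k t = 0" if "r\<^sup>2 - inverse (real (Suc k)) \<le> t" for k t
  proof -
    have "real (Suc k) * (r\<^sup>2 - t) \<le> real (Suc k) * inverse (real (Suc k))"
      using that by (intro mult_left_mono) auto
    then have "real (Suc k) * (r\<^sup>2 - t) - 1 \<le> 0" by simp
    then show ?thesis unfolding \<theta>_def by (simp only: flat_exp_def) simp
  qed
  have \<theta>_lim: "(\<lambda>k. \<theta> k t) \<longlonglongrightarrow> (if t \<le> \<rho>\<^sup>2 then 0 else 1)" if "t < r\<^sup>2" for t
  proof -
    have "(\<lambda>k. \<theta> k t) \<longlonglongrightarrow> (if t - \<rho>\<^sup>2 \<le> 0 then 0 else 1) * (if r\<^sup>2 - t \<le> 0 then 0 else 1)"
      unfolding \<theta>_def using flat_exp_0_scaled_tendsto[of 0 "t - \<rho>\<^sup>2"]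
      by (intro tendsto_mult flat_exp_0_scaled_tendsto) (simp_all only: diff_zero order_refl zero_le_one)
    then show ?thesis using that by simp
  qed
  have "\<exists>v\<in>test_functions ?B. \<forall>x. grad v x = - ((\<theta> k ((norm x)\<^sup>2) / n) *\<^sub>R x)" for k
  proof -
    have ck: "Ck j (\<lambda>x::'a. \<theta> k ((norm x)\<^sup>2) / n)" for j
    proof -
      have "Ck j (\<lambda>x::'a. inverse n * \<theta> k ((norm x)\<^sup>2))"
        unfolding \<theta>_def
        by (intro Ck_mult Ck_flat_exp Ck_cmult Ck_diff Ck_norm_power2 Ck_const)
      then show ?thesis by (simp add: divide_inverse mult.commute)
    qed
    have c: "continuous_on UNIV (\<lambda>t. \<theta> k t / n)" using n by (intro continuous_intros \<theta>_cont) auto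
    have lt: "r\<^sup>2 - inverse (real (Suc k)) < r\<^sup>2" by simp
    have z: "\<theta> k t / n = 0" if "r\<^sup>2 - inverse (real (Suc k)) \<le> t" for t using \<theta>_high[OF that] by simp
    show ?thesis
      by (rule radial_test_function[OF c ck lt z r]) auto
  qed
  then obtain v where v: "\<And>k. v k \<in> test_functions ?B"
    and grad_v: "\<And>k x. grad (v k) x = - ((\<theta> k ((norm x)\<^sup>2) / n) *\<^sub>R x)"
    by metis
  define S where "S = {x \<in> ?B. \<rho> < norm x}"
  have S: "S \<in> sets lebesgue" "S \<in> sets borel" "S \<subseteq> ?B"
  proof -
    show "S \<in> sets borel" unfolding S_def by measurable
    then show "S \<in> sets lebesgue" by simp
  qed (auto simp: S_def)
  have S_fin: "S \<in> lmeasurable"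
    using S B by (intro bounded_set_imp_lmeasurable) (auto intro: bounded_subset)
  \<comment> \<open>Dirichlet energy minus the integral of v, the latter rewritten by integration by
    parts so that both are integrals of |x|^2/n^2. Where the cutoff tends to 1 the bracket tends to
    -1/2.\<close>
  define J where "J k = ?I (\<lambda>x. ((\<theta> k ((norm x)\<^sup>2))\<^sup>2 / 2 - \<theta> k ((norm x)\<^sup>2)) * ((norm x)\<^sup>2 / n\<^sup>2))" for k
  have \<theta>n: "continuous_on UNIV (\<lambda>x::'a. \<theta> k ((norm x)\<^sup>2))" for k
    by (intro continuous_on_compose2[OF \<theta>_cont] continuous_intros) auto
  have F_le: "F_functional ?B \<Lambda> (v k) \<le> J k + \<Lambda> * measure lebesgue S" for k
  proof -
    have "?I (v k) = integral\<^sup>L lborel (v k)"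
      using test_functionsD[OF v[of k]] compactly_supported_inD[OF test_functionsD(2)[OF v[of k]]] B
      by (intro integral_lebesgue_on_eq_lborel borel_measurable_continuous_onI) auto
    also have "\<dots> = integral\<^sup>L lborel (\<lambda>x::'a. \<theta> k ((norm x)\<^sup>2) * ((norm x)\<^sup>2 / n\<^sup>2))"
    proof -
      define h where "h x = \<theta> k ((norm x)\<^sup>2) * ((norm x)\<^sup>2 / n\<^sup>2)" for x :: 'a
      have eq: "x \<bullet> grad (v k) x = - (n * h x)" for x
        using n by (simp add: grad_v h_def power2_eq_square[of n] flip: power2_norm_eq_inner)
      have "n * integral\<^sup>L lborel (v k) = n * integral\<^sup>L lborel h"
        using integral_eq_position_inner_grad[OF v[of k]] unfolding eq n_def[symmetric] by simp
      then have "integral\<^sup>L lborel (v k) = integral\<^sup>L lborel h" using n by simp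
      then show ?thesis by (simp only: h_def[abs_def])
    qed
    also have "\<dots> = ?I (\<lambda>x. \<theta> k ((norm x)\<^sup>2) * ((norm x)\<^sup>2 / n\<^sup>2))"
    proof (rule integral_lebesgue_on_eq_lborel[symmetric])
      have "continuous_on UNIV (\<lambda>x::'a. \<theta> k ((norm x)\<^sup>2) * ((norm x)\<^sup>2 / n\<^sup>2))"
        using n by (intro continuous_intros \<theta>n) auto
      then show "(\<lambda>x::'a. \<theta> k ((norm x)\<^sup>2) * ((norm x)\<^sup>2 / n\<^sup>2)) \<in> borel_measurable borel"
        by (rule borel_measurable_continuous_onI)
      fix x :: 'a assume "x \<notin> ?B"
      then have "r\<^sup>2 \<le> (norm x)\<^sup>2" using r by (intro power_mono) auto
      moreover have "0 \<le> inverse (real (Suc k))" by simp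
      ultimately have "r\<^sup>2 - inverse (real (Suc k)) \<le> (norm x)\<^sup>2" by linarith
      then show "\<theta> k ((norm x)\<^sup>2) * ((norm x)\<^sup>2 / n\<^sup>2) = 0" using \<theta>_high by simp
    qed (rule B)
    finally have Iv: "?I (v k) = ?I (\<lambda>x. \<theta> k ((norm x)\<^sup>2) * ((norm x)\<^sup>2 / n\<^sup>2))" .
    have "(\<lambda>x. (norm (grad (v k) x))\<^sup>2) = (\<lambda>x. (\<theta> k ((norm x)\<^sup>2))\<^sup>2 * ((norm x)\<^sup>2 / n\<^sup>2))"
      using n by (simp add: grad_v power_mult_distrib power_divide)
    then have "1/2 * ?I (\<lambda>x. (norm (grad (v k) x))\<^sup>2) - ?I (v k)
        = ?I (\<lambda>x. 1/2 * ((\<theta> k ((norm x)\<^sup>2))\<^sup>2 * ((norm x)\<^sup>2 / n\<^sup>2))) - ?I (\<lambda>x. \<theta> k ((norm x)\<^sup>2) * ((norm x)\<^sup>2 / n\<^sup>2))"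
      unfolding Iv by simp
    also have "\<dots> = ?I (\<lambda>x. 1/2 * ((\<theta> k ((norm x)\<^sup>2))\<^sup>2 * ((norm x)\<^sup>2 / n\<^sup>2)) - \<theta> k ((norm x)\<^sup>2) * ((norm x)\<^sup>2 / n\<^sup>2))"
      using n by (intro Bochner_Integration.integral_diff[symmetric] integrable_lebesgue_on_continuous B continuous_intros \<theta>n) auto
    also have "\<dots> = J k"
    proof -
      have "1/2 * (A * c) - t * c = (A / 2 - t) * c" for A c t :: real by (simp add: algebra_simps)
      then show ?thesis unfolding J_def by (simp only:)
    qed
    finally have "1/2 * ?I (\<lambda>x. (norm (grad (v k) x))\<^sup>2) - ?I (v k) = J k" .
    \<comment> \<open>The gradients vanish off S for every k, so the measure term is bounded
      uniformly and only \<open>J\<close> needs a limit.\<close>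
    moreover have "measure lebesgue {x\<in>?B. grad (v k) x \<noteq> 0} \<le> measure lebesgue S"
    proof (rule measure_mono_fmeasurable[OF _ _ S_fin])
      show "{x\<in>?B. grad (v k) x \<noteq> 0} \<subseteq> S"
      proof
        fix x assume x: "x \<in> {x\<in>?B. grad (v k) x \<noteq> 0}"
        then have "\<rho>\<^sup>2 < (norm x)\<^sup>2" using \<theta>_low[of "(norm x)\<^sup>2" k] by (force simp: grad_v)
        then show "x \<in> S" using x by (auto simp: S_def power_less_imp_less_base)
      qed
      have "{x\<in>?B. grad (v k) x \<noteq> 0} = ?B \<inter> {x. grad (v k) x \<noteq> 0}" by auto
      moreover have "open {x. grad (v k) x \<noteq> 0}"
        using continuous_grad[OF test_functionsD(1)[OF v]] by (intro open_Collect_neq continuous_intros) auto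
      ultimately show "{x\<in>?B. grad (v k) x \<noteq> 0} \<in> sets lebesgue" by simp
    qed
    ultimately show ?thesis
      unfolding F_functional_test_function[OF B(1,2) v] using \<Lambda> by (simp add: mult_left_mono)
  qed
  have iS: "integrable (lebesgue_on ?B) (\<lambda>x. indicator S x * h x)" if "continuous_on UNIV h" for h :: "'a \<Rightarrow> real"
  proof -
    have "S \<in> sets (lebesgue_on ?B)" using S by (auto simp: sets_restrict_space_iff)
    from integrable_mult_indicator[OF this integrable_lebesgue_on_continuous[OF that B(2,3)]] show ?thesis by simp
  qed
  have "J \<longlonglongrightarrow> ?I (\<lambda>x. indicator S x * (- ((norm x)\<^sup>2 / n\<^sup>2) / 2))"
    unfolding J_def
  proof (rule integral_dominated_convergence[where w = "\<lambda>x. 2 * ((norm x)\<^sup>2 / n\<^sup>2)"])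
    show "integrable (lebesgue_on ?B) (\<lambda>x. 2 * ((norm x)\<^sup>2 / n\<^sup>2))"
      using n by (intro integrable_lebesgue_on_continuous B continuous_intros) auto
    show "(\<lambda>x. indicator S x * (- ((norm x)\<^sup>2 / n\<^sup>2) / 2)) \<in> borel_measurable (lebesgue_on ?B)"
      using n by (intro borel_measurable_integrable iS continuous_intros) auto
    show "(\<lambda>x. ((\<theta> k ((norm x)\<^sup>2))\<^sup>2 / 2 - \<theta> k ((norm x)\<^sup>2)) * ((norm x)\<^sup>2 / n\<^sup>2)) \<in> borel_measurable (lebesgue_on ?B)" for k
      using n by (intro borel_measurable_integrable integrable_lebesgue_on_continuous B continuous_intros \<theta>n) auto
    show "AE x in lebesgue_on ?B. norm (((\<theta> k ((norm x)\<^sup>2))\<^sup>2 / 2 - \<theta> k ((norm x)\<^sup>2)) * ((norm x)\<^sup>2 / n\<^sup>2)) \<le> 2 * ((norm x)\<^sup>2 / n\<^sup>2)" for k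
    proof (intro AE_I2)
      fix x :: 'a
      have "(\<theta> k ((norm x)\<^sup>2))\<^sup>2 \<le> 1" using \<theta>01[of k "(norm x)\<^sup>2"] by (simp add: power_le_one)
      then have "\<bar>(\<theta> k ((norm x)\<^sup>2))\<^sup>2 / 2 - \<theta> k ((norm x)\<^sup>2)\<bar> \<le> 2"
        using \<theta>01[of k "(norm x)\<^sup>2"] zero_le_power2[of "\<theta> k ((norm x)\<^sup>2)"] by (intro abs_leI) linarith+
      then show "norm (((\<theta> k ((norm x)\<^sup>2))\<^sup>2 / 2 - \<theta> k ((norm x)\<^sup>2)) * ((norm x)\<^sup>2 / n\<^sup>2)) \<le> 2 * ((norm x)\<^sup>2 / n\<^sup>2)"
        unfolding real_norm_def abs_mult by (intro mult_mono) auto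
    qed
    show "AE x in lebesgue_on ?B. (\<lambda>k. ((\<theta> k ((norm x)\<^sup>2))\<^sup>2 / 2 - \<theta> k ((norm x)\<^sup>2)) * ((norm x)\<^sup>2 / n\<^sup>2))
        \<longlonglongrightarrow> indicator S x * (- ((norm x)\<^sup>2 / n\<^sup>2) / 2)"
    proof (intro AE_I2)
      fix x assume "x \<in> space (lebesgue_on ?B)"
      then have x: "norm x < r" by simp
      then have lt: "(norm x)\<^sup>2 < r\<^sup>2" by (intro power_strict_mono) auto
      define L :: real where "L = (if (norm x)\<^sup>2 \<le> \<rho>\<^sup>2 then 0 else 1)"
      have "(\<lambda>k. ((\<theta> k ((norm x)\<^sup>2))\<^sup>2 / 2 - \<theta> k ((norm x)\<^sup>2)) * ((norm x)\<^sup>2 / n\<^sup>2))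
          \<longlonglongrightarrow> (L\<^sup>2 / 2 - L) * ((norm x)\<^sup>2 / n\<^sup>2)"
        unfolding L_def using n by (intro tendsto_intros \<theta>_lim lt) auto
      moreover have "L = indicator S x"
      proof -
        have "(norm x)\<^sup>2 \<le> \<rho>\<^sup>2 \<longleftrightarrow> norm x \<le> \<rho>" using \<rho> by (simp add: power2_le_iff_abs_le)
        then show ?thesis using x by (simp add: L_def S_def indicator_def)
      qed
      ultimately have "(\<lambda>k. ((\<theta> k ((norm x)\<^sup>2))\<^sup>2 / 2 - \<theta> k ((norm x)\<^sup>2)) * ((norm x)\<^sup>2 / n\<^sup>2))
          \<longlonglongrightarrow> ((indicator S x)\<^sup>2 / 2 - indicator S x) * ((norm x)\<^sup>2 / n\<^sup>2)" by simp
      moreover have "((indicator S x)\<^sup>2 / 2 - indicator S x) * z = indicator S x * (- z / 2)" for z :: real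
        by (simp add: indicator_def)
      ultimately show "(\<lambda>k. ((\<theta> k ((norm x)\<^sup>2))\<^sup>2 / 2 - \<theta> k ((norm x)\<^sup>2)) * ((norm x)\<^sup>2 / n\<^sup>2))
          \<longlonglongrightarrow> indicator S x * (- ((norm x)\<^sup>2 / n\<^sup>2) / 2)"
        by (simp only:)
    qed
  qed
  then have "(\<lambda>k. J k + \<Lambda> * measure lebesgue S)
      \<longlonglongrightarrow> ?I (\<lambda>x. indicator S x * (- ((norm x)\<^sup>2 / n\<^sup>2) / 2)) + \<Lambda> * measure lebesgue S"
    by (intro tendsto_intros)
  moreover have "?I (\<lambda>x. indicator S x * (- ((norm x)\<^sup>2 / n\<^sup>2) / 2)) + \<Lambda> * measure lebesgue S
      = - ?I (\<lambda>y. energy_dual \<kappa> (norm y / n))"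
  proof -
    have "S \<inter> ?B = S" using S(3) by auto
    then have meas: "\<Lambda> * measure lebesgue S = ?I (\<lambda>x. indicator S x * \<Lambda>)"
      using S S_fin B by (simp add: measure_restrict_space)
    have "?I (\<lambda>x. indicator S x * (- ((norm x)\<^sup>2 / n\<^sup>2) / 2)) + \<Lambda> * measure lebesgue S
        = ?I (\<lambda>x. indicator S x * (- ((norm x)\<^sup>2 / n\<^sup>2) / 2) + indicator S x * \<Lambda>)"
    proof -
      have "?I (\<lambda>x. indicator S x * (- ((norm x)\<^sup>2 / n\<^sup>2) / 2) + indicator S x * \<Lambda>)
          = ?I (\<lambda>x. indicator S x * (- ((norm x)\<^sup>2 / n\<^sup>2) / 2)) + ?I (\<lambda>x. indicator S x * \<Lambda>)"
        using n by (intro Bochner_Integration.integral_add iS continuous_intros) auto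
      then show ?thesis using meas by simp
    qed
    also have "\<dots> = ?I (\<lambda>y. - energy_dual \<kappa> (norm y / n))"
    proof (intro Bochner_Integration.integral_cong refl)
      fix x assume "x \<in> space (lebesgue_on ?B)"
      then have x: "norm x < r" by simp
      \<comment> \<open>With \<Lambda> = \<kappa>^2/2 the left side is (\<kappa>^2 - |x|^2/n^2)/2 on
        S; off S the maximum in \<open>energy_dual\<close> is 0.\<close>
      show "indicator S x * (- ((norm x)\<^sup>2 / n\<^sup>2) / 2) + indicator S x * \<Lambda> = - energy_dual \<kappa> (norm x / n)"
      proof (cases "\<rho> < norm x")
        case True
        then have "\<kappa> \<le> norm x / n" using n by (simp add: \<rho>_def field_simps)
        then have "\<kappa>\<^sup>2 \<le> (norm x / n)\<^sup>2" using \<kappa>(1) by (intro power_mono) auto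
        then show ?thesis using True x \<kappa>(2) by (simp add: S_def energy_dual_def power_divide field_simps)
      next
        case False
        then have "norm x / n \<le> \<kappa>" using n by (simp add: \<rho>_def field_simps)
        then have "(norm x / n)\<^sup>2 \<le> \<kappa>\<^sup>2" using n by (intro power_mono) auto
        then show ?thesis using False by (simp add: S_def energy_dual_def)
      qed
    qed
    finally show ?thesis by simp
  qed
  ultimately have "(\<lambda>k. J k + \<Lambda> * measure lebesgue S) \<longlonglongrightarrow> - ?I (\<lambda>y. energy_dual \<kappa> (norm y / n))"
    by simp
  from order_tendstoD(2)[OF this, of "- ?I (\<lambda>y. energy_dual \<kappa> (norm y / n)) + e"] e
  obtain k where "J k + \<Lambda> * measure lebesgue S < - ?I (\<lambda>y. energy_dual \<kappa> (norm y / n)) + e"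
    by (auto dest: eventually_happens)
  then show ?thesis
    using v[of k] F_le[of k] by (intro bexI[of _ "v k"]) (auto simp: \<kappa>_def n_def)
qed

theorem corollary4p2:
  fixes \<Omega> \<Omega>sharp :: "'a::euclidean_space set" and \<Lambda> r :: real
  assumes "open \<Omega>" and "bounded \<Omega>" and "finite_perimeter \<Omega>"
    and "\<Omega>sharp = ball 0 r" and "measure lebesgue \<Omega>sharp = measure lebesgue \<Omega>"
    and "\<Lambda> > 0"
  shows "T_F \<Omega> \<Lambda> \<le> T_F \<Omega>sharp \<Lambda>"
proof (cases "0 < r")
  \<comment> \<open>A nonpositive radius makes the ball empty, and an open set of measure zero is
    empty too, so both sides coincide.\<close>
  case False
  then have "\<Omega>sharp = {}" using assms(4) by simp
  then have "negligible \<Omega>"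
    using assms(1,2,5) by (simp add: negligible_iff_measure lmeasurable_open)
  then have "\<Omega> = {}" using assms(1) open_not_negligible by blast
  then show ?thesis using \<open>\<Omega>sharp = {}\<close> by simp
next
  case True
  define T where "T = integral\<^sup>L (lebesgue_on (ball 0 r)) (\<lambda>y::'a. energy_dual (sqrt (2 * \<Lambda>)) (norm y / DIM('a)))"
  have "(INF \<psi>\<in>H10 \<Omega>sharp. ereal (F_functional \<Omega>sharp \<Lambda> \<psi>)) \<le> ereal (- T)"
  proof (rule ereal_le_epsilon2)
    fix e :: real assume "0 < e"
    then obtain v where v: "v \<in> test_functions (ball (0::'a) r)" "F_functional (ball 0 r) \<Lambda> v \<le> - T + e"
      using F_functional_ball_competitor[OF True assms(6)] unfolding T_def by blast
    have "v \<in> H10 \<Omega>sharp" unfolding assms(4) by (intro test_function_in_H10 v) auto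
    then have "(INF \<psi>\<in>H10 \<Omega>sharp. ereal (F_functional \<Omega>sharp \<Lambda> \<psi>)) \<le> ereal (F_functional \<Omega>sharp \<Lambda> v)"
      by (rule INF_lower)
    also have "\<dots> \<le> ereal (- T) + ereal e" using v(2) assms(4) by simp
    finally show "(INF \<psi>\<in>H10 \<Omega>sharp. ereal (F_functional \<Omega>sharp \<Lambda> \<psi>)) \<le> ereal (- T) + ereal e" .
  qed
  also have "ereal (- T) \<le> (INF \<psi>\<in>H10 \<Omega>. ereal (F_functional \<Omega> \<Lambda> \<psi>))"
    using F_functional_lower_bound[OF assms(1,2) True _ assms(6)] assms(4,5)
    by (intro INF_greatest) (simp add: T_def)
  finally show ?thesis by (simp add: T_F_def ereal_minus_le_minus)
qed

end
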